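(* Let $G=(V,E)$ be an unweighted undirected graph with $n$ vertices and $m$ edges, and let $k,p,t\ge 1$ be integers. Then there exists a path-reporting distance oracle for $G$ with $\left(O(t\cdot kn^{1/k}),\,O(p\cdot kn^{1/k})\right)$-stretch, using $O(kn+tn^{1+1/t}/p)$ space, whose query time is proportional to the length of the returned path. The oracle can be constructed in $O(tmn^{1/t})$ time.
   Context: $d_G$ is the shortest-path (hop) distance in $G$. For $\alpha\ge1$ and $\beta\ge0$, a path-reporting distance oracle has $(\alpha,\beta)$-stretch if for every query pair $u,v\in V$ it returns a $u$–$v$ path in $G$ whose length $\tilde d(u,v)$ satisfies $d_G(u,v)\le\tilde d(u,v)\le\alpha\, d_G(u,v)+\beta$. Space is measured in words of $O(\log n)$ bits. *)

theory Defs
  imports Complex_Main "HOL-Library.Log_Nat"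
begin

section \<open>Unweighted undirected graphs on the vertex set \<open>{..<n}\<close>\<close>

text \<open>Vertices are numbered, since they are handed to a machine; an edge is a two-element set.\<close>

definition simple_graph :: "nat \<Rightarrow> nat set set \<Rightarrow> bool" where
  "simple_graph n E \<longleftrightarrow> E \<subseteq> {{u, v} | u v. u < n \<and> v < n \<and> u \<noteq> v}"

definition is_path :: "nat set set \<Rightarrow> nat \<Rightarrow> nat list \<Rightarrow> nat \<Rightarrow> bool" where
  "is_path E u P v \<longleftrightarrow> P \<noteq> [] \<and> hd P = u \<and> last P = v \<and> distinct P \<and>
     successively (\<lambda>x y. {x, y} \<in> E) P"

definition path_length :: "nat list \<Rightarrow> nat" where
  "path_length P = length P - 1"

text \<open>Only meaningful if \<open>u\<close> and \<open>v\<close> lie in the same component.\<close>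

definition graph_dist :: "nat set set \<Rightarrow> nat \<Rightarrow> nat \<Rightarrow> nat" where
  "graph_dist E u v = (LEAST l. \<exists>P. is_path E u P v \<and> path_length P = l)"

definition isolated :: "nat \<Rightarrow> nat set set \<Rightarrow> nat set" where
  "isolated n E = {v. v < n \<and> (\<forall>e\<in>E. v \<notin> e)}"


section \<open>The word RAM\<close>

text \<open>
  A word of \<open>w\<close> bits is a natural number below \<open>2 ^ w\<close>. A program is a fixed finite list of
  instructions; it refers to finitely many registers and addresses a memory of \<open>2 ^ w\<close> words
  indirectly through registers. Arithmetic is modulo \<open>2 ^ w\<close>. \<open>Emit\<close> appends a word to a
  write-only output. The machine halts when the program counter leaves the program.
\<close>

datatype binop = Add | Sub | Mul | Div | Mod | Band | Bor | Bxor | Shl | Shr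

datatype instr =
    Const nat nat        \<comment> \<open>target register, literal\<close>
  | Oper binop nat nat nat   \<comment> \<open>target register, operand registers\<close>
  | Load nat nat         \<comment> \<open>target register, register holding the address\<close>
  | Store nat nat        \<comment> \<open>register holding the address, source register\<close>
  | Emit nat
  | Jump nat
  | JumpLess nat nat nat \<comment> \<open>registers to compare, jump target\<close>

record ram =
  pc :: nat
  reg :: "nat \<Rightarrow> nat"
  mem :: "nat \<Rightarrow> nat"
  out :: "nat list"

fun binop_val :: "nat \<Rightarrow> binop \<Rightarrow> nat \<Rightarrow> nat \<Rightarrow> nat" where
  "binop_val w Add a b = (a + b) mod 2 ^ w"
| "binop_val w Sub a b = (a + 2 ^ w - b) mod 2 ^ w"
| "binop_val w Mul a b = (a * b) mod 2 ^ w"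
| "binop_val w Div a b = a div b"
| "binop_val w Mod a b = a mod b"
| "binop_val w Band a b = and a b"
| "binop_val w Bor a b = or a b"
| "binop_val w Bxor a b = xor a b"
| "binop_val w Shl a b = (a * 2 ^ b) mod 2 ^ w"
| "binop_val w Shr a b = a div 2 ^ b"

fun exec_instr :: "nat \<Rightarrow> instr \<Rightarrow> ram \<Rightarrow> ram" where
  "exec_instr w (Const r a) s =
     s\<lparr>pc := Suc (pc s), reg := (reg s)(r := a mod 2 ^ w)\<rparr>"
| "exec_instr w (Oper f r x y) s =
     s\<lparr>pc := Suc (pc s), reg := (reg s)(r := binop_val w f (reg s x) (reg s y))\<rparr>"
| "exec_instr w (Load r x) s =
     s\<lparr>pc := Suc (pc s), reg := (reg s)(r := mem s (reg s x))\<rparr>"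
| "exec_instr w (Store x r) s =
     s\<lparr>pc := Suc (pc s), mem := (mem s)(reg s x := reg s r)\<rparr>"
| "exec_instr w (Emit r) s =
     s\<lparr>pc := Suc (pc s), out := out s @ [reg s r]\<rparr>"
| "exec_instr w (Jump l) s = s\<lparr>pc := l\<rparr>"
| "exec_instr w (JumpLess x y l) s =
     s\<lparr>pc := (if reg s x < reg s y then l else Suc (pc s))\<rparr>"

definition step :: "nat \<Rightarrow> instr list \<Rightarrow> ram \<Rightarrow> ram" where
  "step w prog s = (if pc s < length prog then exec_instr w (prog ! pc s) s else s)"

definition start :: "nat list \<Rightarrow> (nat \<Rightarrow> nat) \<Rightarrow> ram" where
  "start args M =
     \<lparr>pc = 0, reg = (\<lambda>i. if i < length args then args ! i else 0), mem = M, out = []\<rparr>"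

text \<open>Each instruction takes unit time.\<close>

definition halts_within :: "nat \<Rightarrow> instr list \<Rightarrow> ram \<Rightarrow> nat \<Rightarrow> ram \<Rightarrow> bool" where
  "halts_within w prog s T s' \<longleftrightarrow> (step w prog ^^ T) s = s' \<and> length prog \<le> pc s'"

text \<open>\<open>fits\<close>: the list is a sequence of words that fits into the memory.\<close>

definition fits :: "nat \<Rightarrow> nat list \<Rightarrow> bool" where
  "fits w xs \<longleftrightarrow> length xs \<le> 2 ^ w \<and> (\<forall>x\<in>set xs. x < 2 ^ w)"

text \<open>
  \<open>holds\<close>: the memory starts with \<open>xs\<close>. The remaining words are unconstrained: memory is not
  assumed to be initialised.
\<close>

definition holds :: "nat \<Rightarrow> nat list \<Rightarrow> (nat \<Rightarrow> nat) \<Rightarrow> bool" where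
  "holds w xs M \<longleftrightarrow> (\<forall>i<length xs. M i = xs ! i) \<and> (\<forall>i. M i < 2 ^ w)"


section \<open>Input of the construction algorithm\<close>

definition adj_lists :: "nat \<Rightarrow> nat set set \<Rightarrow> nat list list \<Rightarrow> bool" where
  "adj_lists n E adj \<longleftrightarrow> length adj = n \<and>
     (\<forall>u<n. distinct (adj ! u) \<and> set (adj ! u) = {v. {u, v} \<in> E})"

text \<open>
  The input lists \<open>n\<close>, \<open>m\<close>, the parameters, the \<open>n + 1\<close> offsets of the adjacency lists
  in their concatenation, and this concatenation. The parameters may be arbitrarily large
  compared to \<open>n\<close>; one that does not fit into a word is replaced by the largest word.
\<close>

definition graph_input ::
  "nat \<Rightarrow> nat \<Rightarrow> nat set set \<Rightarrow> nat list list \<Rightarrow> nat \<Rightarrow> nat \<Rightarrow> nat \<Rightarrow> nat list" where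
  "graph_input w n E adj k p t =
     [n, card E, min k (2 ^ w - 1), min p (2 ^ w - 1), min t (2 ^ w - 1)]
     @ map (\<lambda>i. length (concat (take i adj))) [0..<Suc n]
     @ concat adj"


section \<open>Path-reporting distance oracles\<close>

text \<open>
  The data structure \<open>D\<close>, together with the query program, is a path-reporting distance oracle
  with \<open>(\<alpha>, \<beta>)\<close>-stretch whose query time is at most \<open>C\<close> times one plus the length of the
  returned path; the summand one accounts for paths of length zero. Between two components,
  where there is no path to return, the query reports this by an empty output. Queries leave
  \<open>D\<close> intact and tolerate arbitrary contents of the rest of the memory, so that any sequence
  of queries can be answered.
\<close>

definition path_reporting_oracle ::
  "nat \<Rightarrow> nat \<Rightarrow> nat set set \<Rightarrow> real \<Rightarrow> real \<Rightarrow> real \<Rightarrow> instr list \<Rightarrow> nat list \<Rightarrow> bool" where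
  "path_reporting_oracle w n E \<alpha> \<beta> C query D \<longleftrightarrow>
     1 \<le> \<alpha> \<and> 0 \<le> \<beta> \<and> fits w D \<and>
     (\<forall>u<n. \<forall>v<n. \<forall>M. holds w D M \<longrightarrow>
        (\<exists>T s. halts_within w query (start [u, v] M) T s \<and>
           holds w D (mem s) \<and>
           real T \<le> C * (1 + real (path_length (out s))) \<and>
           (if \<exists>P. is_path E u P v
            then is_path E u (out s) v \<and>
                 graph_dist E u v \<le> path_length (out s) \<and>
                 real (path_length (out s)) \<le> \<alpha> * real (graph_dist E u v) + \<beta>
            else out s = [])))"

end

theory Submission
  imports Defs
begin

text \<open>
  A purely multiplicative stretch \<open>O(k n\<^bsup>1/k\<^esup>)\<close> with \<open>O(kn)\<close> words already meets all bounds. Let \<open>L\<close> be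
  the binary length of \<open>n\<close> and \<open>b = \<lfloor>L / 2k\<rfloor> + 1\<close>, so that \<open>2\<^sup>b = O(n\<^bsup>1/2k\<^esup>)\<close> and \<open>O(k)\<close> scales
  \<open>r = 2\<^bsup>b i\<^esup>\<close> reach from 1 to \<open>n\<close>. At each scale the graph is covered in rounds of ball carving. A ball
  grows in steps of width \<open>4r\<close> until a step adds at most half of the weight inside, which happens
  within \<open>O(L)\<close> steps. The vertices within the first half of this last annulus or inside it are
  carved off; only those in the last annulus take part in the next round, so that the weights of
  the rounds form a geometric series. The \<open>r\<close>-ball around a vertex that is not in the middle of an
  annulus lies in a single breadth-first tree of its round; the first such round is the home of
  the vertex. A query takes the first scale at which the second vertex lies in the home tree of
  the first one. As the trees have depth \<open>O(r L)\<close>, this loses a factor \<open>O(2\<^sup>b L) = O(k n\<^bsup>1/k\<^esup>)\<close>,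
  because \<open>L = O(k n\<^bsup>1/2k\<^esup>)\<close>. The path is found by climbing in the tree from both ends, at
  constant cost per reported vertex.

  A vertex weighs its degree plus the average degree, so that one geometric series bounds both
  the number of scanned edges and the number of stored records.
\<close>

section \<open>A while language compiled to the word RAM\<close>

text \<open>The annulus width \<open>4r\<close> comes from cutting in the middle: a vertex whose
  \<open>r\<close>-ball may cross the cut has depth within \<open>r\<close> of it, so its whole ball
  lies in the annulus and moves on to the next round. A vertex thus keeps its home until a cut comes
  near, and afterwards its ball is again intact. The time bound holds for every \<open>t\<close>
  because the binary length of \<open>n\<close> is \<open>O(t n^(1/t))\<close>: it is enough to
  treat each of the logarithmically many scales in time linear in the number of edges. The search
  through the scales has to be paid for by the reported path. A miss at scale \<open>i\<close>
  certifies a distance above \<open>2^(b i)\<close>, so trying the scales in order is affordable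
  whenever a path exists. Two components offer nothing to charge, which is why the last scale, whose
  radius is at least \<open>n\<close>, is asked before all others. Running times are counted in loop
  iterations, since straight-line code of a fixed program costs a constant; the programs are
  verified in exact arithmetic, with the absence of overflow as a side condition.\<close>

datatype aexp = Lit nat | Reg nat | Bin binop aexp aexp | Rd nat aexp

datatype com =
    Skip
  | Asgn nat aexp
  | Wr nat aexp aexp
  | Out aexp
  | Seq com com  (infixr ";;" 60)
  | Cond aexp aexp com com
  | While aexp aexp com

record st =
  vr :: "nat \<Rightarrow> nat"
  ar :: "nat \<Rightarrow> nat \<Rightarrow> nat"
  ou :: "nat list"

text \<open>The arithmetic of the language is exact. \<open>ok\<close> below demands for every
  operation that the machine computes the same value, so overflow is ruled out where a program is
  verified and never modelled; for words, subtraction is thereby restricted to a subtrahend that is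
  not larger.\<close>

fun opv :: "binop \<Rightarrow> nat \<Rightarrow> nat \<Rightarrow> nat" where
  "opv Add a b = a + b"
| "opv Sub a b = a - b"
| "opv Mul a b = a * b"
| "opv Div a b = a div b"
| "opv Mod a b = a mod b"
| "opv Band a b = and a b"
| "opv Bor a b = or a b"
| "opv Bxor a b = xor a b"
| "opv Shl a b = a * 2 ^ b"
| "opv Shr a b = a div 2 ^ b"

fun aval :: "aexp \<Rightarrow> st \<Rightarrow> nat" where
  "aval (Lit a) s = a"
| "aval (Reg x) s = vr s x"
| "aval (Bin f a b) s = opv f (aval a s) (aval b s)"
| "aval (Rd a e) s = ar s a (aval e s)"

text \<open>
  Registers from 100 on serve as evaluation stack, and \<open>Bor\<close> of a register with itself copies it.
  Register 2 holds the length of an array, the factor by which array numbers are multiplied.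
\<close>

fun cexp :: "aexp \<Rightarrow> nat \<Rightarrow> instr list" where
  "cexp (Lit a) t = [Const t a]"
| "cexp (Reg x) t = [Oper Bor t x x]"
| "cexp (Bin f a b) t = cexp a t @ cexp b (Suc t) @ [Oper f t t (Suc t)]"
| "cexp (Rd a e) t = cexp e t @
     [Const (Suc t) a, Oper Mul (Suc t) (Suc t) 2, Oper Add t (Suc t) t, Load t t]"

text \<open>\<open>p\<close> is the address of the code, which the absolute jump targets need.
  \<open>JumpLess\<close> is the only test of the machine, hence all conditions have the form
  \<open>e < f\<close>; the jump leads to the positive branch, and control falls through to the
  other one or to the exit jump of a loop.\<close>

fun comp :: "nat \<Rightarrow> com \<Rightarrow> instr list" where
  "comp p Skip = []"
| "comp p (Asgn x e) = cexp e 100 @ [Oper Bor x 100 100]"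
| "comp p (Wr a e f) = cexp e 100 @ cexp f 101 @
     [Const 102 a, Oper Mul 102 102 2, Oper Add 100 102 100, Store 100 101]"
| "comp p (Out e) = cexp e 100 @ [Emit 100]"
| "comp p (c ;; d) = (let x = comp p c in x @ comp (p + length x) d)"
| "comp p (Cond e f c d) =
     (let t = cexp e 100 @ cexp f 101; q = p + length t + 1; y = comp q d;
          q' = q + length y + 1; x = comp q' c
      in t @ [JumpLess 100 101 q'] @ y @ [Jump (q' + length x)] @ x)"
| "comp p (While e f c) =
     (let t = cexp e 100 @ cexp f 101; q = p + length t + 2; x = comp q c
      in t @ [JumpLess 100 101 q, Jump (q + length x + 1)] @ x @ [Jump p])"

fun assigned :: "com \<Rightarrow> nat set" where
  "assigned (Asgn x e) = {x}"
| "assigned (c ;; d) = assigned c \<union> assigned d"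
| "assigned (Cond e f c d) = assigned c \<union> assigned d"
| "assigned (While e f c) = assigned c"
| "assigned _ = {}"

fun written :: "com \<Rightarrow> nat set" where
  "written (Wr a e f) = {a}"
| "written (c ;; d) = written c \<union> written d"
| "written (Cond e f c d) = written c \<union> written d"
| "written (While e f c) = written c"
| "written _ = {}"

fun silent :: "com \<Rightarrow> bool" where
  "silent (Out e) \<longleftrightarrow> False"
| "silent (c ;; d) \<longleftrightarrow> silent c \<and> silent d"
| "silent (Cond e f c d) \<longleftrightarrow> silent c \<and> silent d"
| "silent (While e f c) \<longleftrightarrow> silent c"
| "silent _ \<longleftrightarrow> True"

section \<open>Correctness and running time of compiled code\<close>

definition code_at :: "instr list \<Rightarrow> nat \<Rightarrow> instr list \<Rightarrow> bool" where
  "code_at prog p xs \<longleftrightarrow> (\<forall>i<length xs. p + i < length prog \<and> prog ! (p + i) = xs ! i)"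

lemma code_at_Nil [simp]: "code_at prog p []"
  by (simp add: code_at_def)

lemma code_at_Cons [simp]:
  "code_at prog p (x # xs) \<longleftrightarrow> p < length prog \<and> prog ! p = x \<and> code_at prog (Suc p) xs"
  unfolding code_at_def by (auto simp: less_Suc_eq_0_disj)

lemma code_at_append [simp]:
  "code_at prog p (xs @ ys) \<longleftrightarrow> code_at prog p xs \<and> code_at prog (p + length xs) ys"
  by (induction xs arbitrary: p) auto

lemma code_at_self: "code_at (pre @ xs) (length pre) xs"
  by (auto simp: code_at_def nth_append)

lemma step_code_at:
  "pc \<sigma> < length prog \<Longrightarrow> step w prog \<sigma> = exec_instr w (prog ! pc \<sigma>) \<sigma>"
  by (simp add: step_def)

lemma funpow_step_trans:
  "(f ^^ a) x = y \<Longrightarrow> (f ^^ b) y = z \<Longrightarrow> (f ^^ (a + b)) x = z"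
  by (metis add.commute comp_apply funpow_add)

lemma funpow_2_4: "(f ^^ 2) x = f (f x)" "(f ^^ 4) x = f (f (f (f x)))"
  by (simp_all add: numeral_eq_Suc)

text \<open>The type of machine states admits arbitrary numbers. That words stay words is used twice
  at the end: \<open>holds\<close> asks for it on all of memory after a query, and
  \<open>fits\<close> on the list emitted by the construction.\<close>

definition bounded :: "nat \<Rightarrow> ram \<Rightarrow> bool" where
  "bounded w \<sigma> \<longleftrightarrow> (\<forall>i. reg \<sigma> i < 2 ^ w) \<and> (\<forall>i. mem \<sigma> i < 2 ^ w) \<and> (\<forall>x\<in>set (out \<sigma>). x < 2 ^ w)"

lemma nat_bitop_less:
  fixes a b :: nat
  assumes "a < 2 ^ w" "b < 2 ^ w"
  shows "and a b < 2 ^ w" "or a b < 2 ^ w" "xor a b < 2 ^ w"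
  using assms by (auto simp flip: take_bit_nat_eq_self_iff)

lemma binop_val_less:
  assumes "a < 2 ^ w" "b < 2 ^ w"
  shows "binop_val w f a b < 2 ^ w"
proof (cases f)
  case Div
  then show ?thesis using assms by (auto intro: le_less_trans[OF div_le_dividend])
next
  case Mod
  then show ?thesis using assms by (auto intro: le_less_trans[OF mod_less_eq_dividend])
next
  case Shr
  then show ?thesis using assms by (auto intro: le_less_trans[OF div_le_dividend])
qed (use assms in \<open>auto simp: nat_bitop_less\<close>)

lemma bounded_step: "bounded w \<sigma> \<Longrightarrow> bounded w (step w prog \<sigma>)"
  by (cases "prog ! pc \<sigma>") (auto simp: step_def bounded_def binop_val_less)

lemma bounded_steps: "bounded w \<sigma> \<Longrightarrow> bounded w ((step w prog ^^ T) \<sigma>)"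
  by (induction T) (auto simp: bounded_step)

text \<open>\<open>W\<close> is the common length of sixteen arrays; array \<open>a\<close> occupies
  the addresses from \<open>a * W\<close> on. The construction takes a polynomial in
  \<open>n\<close> for \<open>W\<close>, the query the length of the stored structure.\<close>

locale machine =
  fixes w W :: nat
  assumes space: "16 * W \<le> 2 ^ w"
begin

fun ok :: "aexp \<Rightarrow> st \<Rightarrow> bool" where
  "ok (Lit a) s \<longleftrightarrow> a < 2 ^ w"
| "ok (Reg x) s \<longleftrightarrow> x < 100"
| "ok (Bin f a b) s \<longleftrightarrow>
     ok a s \<and> ok b s \<and> binop_val w f (aval a s) (aval b s) = opv f (aval a s) (aval b s)"
| "ok (Rd a e) s \<longleftrightarrow> ok e s \<and> aval e s < W \<and> a < 16"

text \<open>The second last argument counts the executed loop iterations.\<close>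

inductive exec :: "com \<Rightarrow> st \<Rightarrow> nat \<Rightarrow> st \<Rightarrow> bool" where
  Skip: "exec Skip s 0 s"
| Asgn: "ok e s \<Longrightarrow> x < 100 \<Longrightarrow> x \<noteq> 2 \<Longrightarrow>
    exec (Asgn x e) s 0 (s\<lparr>vr := (vr s)(x := aval e s)\<rparr>)"
| Wr: "ok e s \<Longrightarrow> ok f s \<Longrightarrow> a < 16 \<Longrightarrow> aval e s < W \<Longrightarrow>
    exec (Wr a e f) s 0 (s\<lparr>ar := (ar s)(a := (ar s a)(aval e s := aval f s))\<rparr>)"
| Out: "ok e s \<Longrightarrow> exec (Out e) s 0 (s\<lparr>ou := ou s @ [aval e s]\<rparr>)"
| Seq: "exec c s t s' \<Longrightarrow> exec d s' t' s'' \<Longrightarrow> exec (c ;; d) s (t + t') s''"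
| CondT: "ok e s \<Longrightarrow> ok f s \<Longrightarrow> aval e s < aval f s \<Longrightarrow> exec c s t s' \<Longrightarrow> exec (Cond e f c d) s t s'"
| CondF: "ok e s \<Longrightarrow> ok f s \<Longrightarrow> \<not> aval e s < aval f s \<Longrightarrow> exec d s t s' \<Longrightarrow> exec (Cond e f c d) s t s'"
| WhileF: "ok e s \<Longrightarrow> ok f s \<Longrightarrow> \<not> aval e s < aval f s \<Longrightarrow> exec (While e f c) s 0 s"
| WhileT: "ok e s \<Longrightarrow> ok f s \<Longrightarrow> aval e s < aval f s \<Longrightarrow> exec c s t s' \<Longrightarrow>
    exec (While e f c) s' t' s'' \<Longrightarrow> exec (While e f c) s (Suc (t + t')) s''"

text \<open>The registers from 100 on are left open because the evaluation of expressions overwrites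
  them.\<close>

definition sim :: "ram \<Rightarrow> st \<Rightarrow> bool" where
  "sim \<sigma> s \<longleftrightarrow> (\<forall>x<100. reg \<sigma> x = vr s x) \<and> vr s 2 = W \<and>
     (\<forall>a<16. \<forall>x<W. mem \<sigma> (a * W + x) = ar s a x) \<and> out \<sigma> = ou s"

lemma array_address_less: "a < 16 \<Longrightarrow> x < W \<Longrightarrow> a * W + x < 2 ^ w"
proof -
  assume "a < 16" "x < W"
  then have "a * W + x < Suc a * W" by simp
  also have "\<dots> \<le> 16 * W" using \<open>a < 16\<close> by (intro mult_right_mono) auto
  finally show ?thesis using space by simp
qed

lemma array_address_inject:
  "x < W \<Longrightarrow> y < W \<Longrightarrow> a * W + x = b * W + y \<longleftrightarrow> a = b \<and> x = y"
  by (metis add.commute div_mult_self1 div_less less_nat_zero_code mod_less mod_mult_self1 add_0 mult.commute)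

text \<open>The induction rests on the last conjunct: evaluating at stack position \<open>t\<close>
  leaves everything below \<open>t\<close> alone, so a left operand stored in \<open>t\<close>
  survives the evaluation of the right one at \<open>Suc t\<close>, and register 2 with the array
  length survives throughout.\<close>

lemma cexp_correct:
  assumes "code_at prog p (cexp e t)" "pc \<sigma> = p" "ok e s" "100 \<le> t" "sim \<sigma> s"
  shows "\<exists>\<rho>. (step w prog ^^ length (cexp e t)) \<sigma> =
      \<sigma>\<lparr>pc := p + length (cexp e t), reg := \<rho>\<rparr> \<and> \<rho> t = aval e s \<and> (\<forall>x<t. \<rho> x = reg \<sigma> x)"
  using assms
proof (induction e arbitrary: p t \<sigma>)
  case (Lit a)
  then show ?case by (intro exI[of _ "(reg \<sigma>)(t := a)"]) (auto simp: step_code_at add.assoc fun_upd_def)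
next
  case (Reg x)
  then show ?case
    by (intro exI[of _ "(reg \<sigma>)(t := vr s x)"]) (auto simp: step_code_at add.assoc sim_def fun_upd_def)
next
  case (Bin f a b)
  let ?m = "length (cexp a t)" and ?k = "length (cexp b (Suc t))"
  obtain \<rho> where r: "(step w prog ^^ ?m) \<sigma> = \<sigma>\<lparr>pc := p + ?m, reg := \<rho>\<rparr>"
    "\<rho> t = aval a s" "\<forall>x<t. \<rho> x = reg \<sigma> x"
    using Bin.IH(1)[of p t \<sigma>] Bin.prems by auto
  have "sim (\<sigma>\<lparr>pc := p + ?m, reg := \<rho>\<rparr>) s" using Bin.prems r by (auto simp: sim_def)
  then obtain \<rho>' where r': "(step w prog ^^ ?k) (\<sigma>\<lparr>pc := p + ?m, reg := \<rho>\<rparr>) =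
      \<sigma>\<lparr>pc := p + ?m + ?k, reg := \<rho>'\<rparr>" "\<rho>' (Suc t) = aval b s" "\<forall>x<Suc t. \<rho>' x = \<rho> x"
    using Bin.IH(2)[of "p + ?m" "Suc t" "\<sigma>\<lparr>pc := p + ?m, reg := \<rho>\<rparr>"] Bin.prems by auto
  let ?\<rho> = "\<rho>'(t := opv f (aval a s) (aval b s))"
  have "step w prog (\<sigma>\<lparr>pc := p + ?m + ?k, reg := \<rho>'\<rparr>) = \<sigma>\<lparr>pc := p + ?m + ?k + 1, reg := ?\<rho>\<rparr>"
    using Bin.prems r r' by (simp add: step_code_at add.assoc)
  then have "(step w prog ^^ (?m + ?k + 1)) \<sigma> = \<sigma>\<lparr>pc := p + ?m + ?k + 1, reg := ?\<rho>\<rparr>"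
    using funpow_step_trans[OF funpow_step_trans[OF r(1) r'(1)], of 1] by simp
  then show ?case using r r' by (intro exI[of _ ?\<rho>]) (auto simp: add.assoc fun_upd_def)
next
  case (Rd a e)
  let ?m = "length (cexp e t)"
  obtain \<rho> where r: "(step w prog ^^ ?m) \<sigma> = \<sigma>\<lparr>pc := p + ?m, reg := \<rho>\<rparr>"
    "\<rho> t = aval e s" "\<forall>x<t. \<rho> x = reg \<sigma> x"
    using Rd.IH[of p t \<sigma>] Rd.prems by auto
  have W: "reg \<sigma> 2 = W" using Rd.prems by (auto simp: sim_def)
  have lim: "a * W + aval e s < 2 ^ w" using Rd.prems by (intro array_address_less) auto
  then have lim': "a * W < 2 ^ w" by simp
  have "0 < W" "a < 16" using Rd.prems by auto
  then have "a < 16 * W" by linarith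
  then have "a < 2 ^ w" using space by simp
  let ?\<rho> = "\<rho>(Suc t := a * W, t := ar s a (aval e s))"
  have "(step w prog ^^ 4) (\<sigma>\<lparr>pc := p + ?m, reg := \<rho>\<rparr>) = \<sigma>\<lparr>pc := p + ?m + 4, reg := ?\<rho>\<rparr>"
    using Rd.prems r W lim lim' \<open>a < 2 ^ w\<close>
    by (auto simp: step_code_at add.assoc funpow_2_4 sim_def fun_upd_twist add.assoc)
  then have 1: "(step w prog ^^ (?m + 4)) \<sigma> = \<sigma>\<lparr>pc := p + ?m + 4, reg := ?\<rho>\<rparr>"
    by (rule funpow_step_trans[OF r(1)])
  have l: "length (cexp (Rd a e) t) = ?m + 4" by simp
  have "?\<rho> t = aval (Rd a e) s" "\<forall>x<t. ?\<rho> x = reg \<sigma> x" using r by auto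
  then show ?case unfolding l using 1[unfolded add.assoc[of p]] by blast
qed

text \<open>Loop case of the time bound below. With \<open>l\<close> the code length of the loop,
  one pass costs at most \<open>l\<close> for each iteration inside it plus \<open>l\<close>;
  counting the pass itself as an iteration pays for the latter.\<close>

lemma while_time:
  fixes a b l t t' :: nat
  shows "a \<le> l * Suc t \<Longrightarrow> b \<le> l * Suc t' \<Longrightarrow> a + b \<le> l * Suc (Suc (t + t'))"
  by (simp add: algebra_simps)

lemma body_time:
  fixes m x T t :: nat
  shows "T \<le> x * Suc t \<Longrightarrow> m + 1 + T + 1 \<le> (m + 2 + x + 1) * Suc t"
  by (simp add: algebra_simps)

lemma sim_reg: "sim \<sigma> s \<Longrightarrow> \<forall>x<100. \<rho> x = reg \<sigma> x \<Longrightarrow> sim (\<sigma>\<lparr>pc := p, reg := \<rho>\<rparr>) s"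
  by (simp add: sim_def)

lemma sim_pc: "sim \<sigma> s \<Longrightarrow> sim (\<sigma>\<lparr>pc := p\<rparr>) s"
  by (simp add: sim_def)

lemma tests_correct:
  assumes "code_at prog p (cexp e 100 @ cexp f 101)" "pc \<sigma> = p" "ok e s" "ok f s" "sim \<sigma> s"
  shows "\<exists>\<rho>. (step w prog ^^ length (cexp e 100 @ cexp f 101)) \<sigma> =
      \<sigma>\<lparr>pc := p + length (cexp e 100 @ cexp f 101), reg := \<rho>\<rparr> \<and>
      \<rho> 100 = aval e s \<and> \<rho> 101 = aval f s \<and> (\<forall>x<100. \<rho> x = reg \<sigma> x)"
proof -
  let ?m = "length (cexp e 100)" and ?k = "length (cexp f 101)"
  obtain \<rho> where r: "(step w prog ^^ ?m) \<sigma> = \<sigma>\<lparr>pc := p + ?m, reg := \<rho>\<rparr>"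
    "\<rho> 100 = aval e s" "\<forall>x<100. \<rho> x = reg \<sigma> x"
    using cexp_correct[of prog p e 100 \<sigma> s] assms by auto
  then obtain \<rho>' where r': "(step w prog ^^ ?k) (\<sigma>\<lparr>pc := p + ?m, reg := \<rho>\<rparr>) =
      \<sigma>\<lparr>pc := p + ?m + ?k, reg := \<rho>'\<rparr>" "\<rho>' 101 = aval f s" "\<forall>x<101. \<rho>' x = \<rho> x"
    using cexp_correct[of prog "p + ?m" f 101 "\<sigma>\<lparr>pc := p + ?m, reg := \<rho>\<rparr>" s]
      sim_reg[OF assms(5) r(3)] assms by auto
  show ?thesis
    using funpow_step_trans[OF r(1) r'(1)] r r' by (intro exI[of _ \<rho>']) (auto simp: add.assoc)
qed

text \<open>Between two loop iterations the program counter only moves forward.\<close>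

theorem comp_correct:
  assumes "exec c s t s'" "code_at prog p (comp p c)" "pc \<sigma> = p" "sim \<sigma> s"
  shows "\<exists>T \<sigma>'. (step w prog ^^ T) \<sigma> = \<sigma>' \<and> pc \<sigma>' = p + length (comp p c) \<and> sim \<sigma>' s' \<and>
    T \<le> length (comp p c) * Suc t"
  using assms
proof (induction arbitrary: p \<sigma> rule: exec.induct)
  case (Skip s)
  then show ?case by (intro exI[of _ 0]) simp
next
  case (Asgn e s x)
  let ?m = "length (cexp e 100)"
  obtain \<rho> where r: "(step w prog ^^ ?m) \<sigma> = \<sigma>\<lparr>pc := p + ?m, reg := \<rho>\<rparr>"
    "\<rho> 100 = aval e s" "\<forall>x<100. \<rho> x = reg \<sigma> x"
    using cexp_correct[of prog p e 100 \<sigma> s] Asgn.prems Asgn.hyps by auto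
  have "(step w prog ^^ (?m + 1)) \<sigma> =
      \<sigma>\<lparr>pc := Suc (p + ?m), reg := \<rho>(x := aval e s)\<rparr>"
    by (rule funpow_step_trans[OF r(1)]) (use Asgn.prems r in \<open>simp add: step_code_at add.assoc\<close>)
  then show ?case
    using Asgn r by (intro exI[of _ "?m + 1"]) (auto simp: sim_def)
next
  case (Wr e s f a)
  let ?m = "length (cexp e 100 @ cexp f 101)"
  obtain \<rho> where r: "(step w prog ^^ ?m) \<sigma> = \<sigma>\<lparr>pc := p + ?m, reg := \<rho>\<rparr>"
    "\<rho> 100 = aval e s" "\<rho> 101 = aval f s" "\<forall>x<100. \<rho> x = reg \<sigma> x"
    using tests_correct[of prog p e f \<sigma> s] Wr.prems Wr.hyps by auto
  have W: "reg \<sigma> 2 = W" using Wr.prems by (auto simp: sim_def)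
  have lim: "a * W + aval e s < 2 ^ w" using Wr.hyps by (intro array_address_less) auto
  then have lim': "a * W < 2 ^ w" by simp
  have "0 < W" "a < 16" using Wr.hyps by auto
  then have "a < 16 * W" by linarith
  then have a: "a < 2 ^ w" using space by simp
  have "(step w prog ^^ (?m + 4)) \<sigma> = \<sigma>\<lparr>pc := p + ?m + 4,
      reg := \<rho>(102 := a * W, 100 := a * W + aval e s),
      mem := (mem \<sigma>)(a * W + aval e s := aval f s)\<rparr>"
    by (rule funpow_step_trans[OF r(1)])
      (use Wr.prems r W lim lim' a in \<open>auto simp: step_code_at add.assoc funpow_2_4 sim_def add.assoc\<close>)
  then show ?case
    using Wr r by (intro exI[of _ "?m + 4"]) (auto simp: sim_def array_address_inject)
next
  case (Out e s)
  let ?m = "length (cexp e 100)"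
  obtain \<rho> where r: "(step w prog ^^ ?m) \<sigma> = \<sigma>\<lparr>pc := p + ?m, reg := \<rho>\<rparr>"
    "\<rho> 100 = aval e s" "\<forall>x<100. \<rho> x = reg \<sigma> x"
    using cexp_correct[of prog p e 100 \<sigma> s] Out.prems Out.hyps by auto
  have "(step w prog ^^ (?m + 1)) \<sigma> =
      \<sigma>\<lparr>pc := Suc (p + ?m), reg := \<rho>, out := out \<sigma> @ [aval e s]\<rparr>"
    by (rule funpow_step_trans[OF r(1)]) (use Out.prems r in \<open>simp add: step_code_at add.assoc\<close>)
  then show ?case
    using Out r by (intro exI[of _ "?m + 1"]) (auto simp: sim_def)
next
  case (Seq c s t s' d t' s'')
  let ?x = "length (comp p c)" and ?y = "length (comp (p + length (comp p c)) d)"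
  obtain T \<sigma>' where 1: "(step w prog ^^ T) \<sigma> = \<sigma>'" "pc \<sigma>' = p + ?x" "sim \<sigma>' s'" "T \<le> ?x * Suc t"
    using Seq.IH(1)[of p \<sigma>] Seq.prems by (auto simp: Let_def)
  obtain T' \<sigma>'' where 2: "(step w prog ^^ T') \<sigma>' = \<sigma>''" "pc \<sigma>'' = p + ?x + ?y" "sim \<sigma>'' s''"
    "T' \<le> ?y * Suc t'"
    using Seq.IH(2)[of "p + ?x" \<sigma>'] Seq.prems 1 by (auto simp: Let_def)
  have "T + T' \<le> ?x * Suc t + ?y * Suc t'" using 1 2 by simp
  also have "\<dots> \<le> ?x * Suc (t + t') + ?y * Suc (t + t')" by (intro add_mono mult_le_mono) auto
  finally have "T + T' \<le> (?x + ?y) * Suc (t + t')" by (simp add: algebra_simps)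
  then show ?case
    using funpow_step_trans[OF 1(1) 2(1)] 2 by (intro exI[of _ "T + T'"]) (auto simp: Let_def)
next
  case (CondT e s f c t s' d)
  let ?m = "length (cexp e 100 @ cexp f 101)"
  let ?y = "length (comp (p + ?m + 1) d)"
  let ?q = "p + ?m + 1 + ?y + 1"
  obtain \<rho> where r: "(step w prog ^^ ?m) \<sigma> = \<sigma>\<lparr>pc := p + ?m, reg := \<rho>\<rparr>"
    "\<rho> 100 = aval e s" "\<rho> 101 = aval f s" "\<forall>x<100. \<rho> x = reg \<sigma> x"
    using tests_correct[of prog p e f \<sigma> s] CondT.prems CondT.hyps by (auto simp: Let_def)
  have 1: "(step w prog ^^ (?m + 1)) \<sigma> = \<sigma>\<lparr>pc := ?q, reg := \<rho>\<rparr>"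
    by (rule funpow_step_trans[OF r(1)])
      (use CondT.prems CondT.hyps r in \<open>simp add: step_code_at add.assoc Let_def\<close>)
  obtain T \<sigma>' where 2: "(step w prog ^^ T) (\<sigma>\<lparr>pc := ?q, reg := \<rho>\<rparr>) = \<sigma>'"
    "pc \<sigma>' = ?q + length (comp ?q c)" "sim \<sigma>' s'" "T \<le> length (comp ?q c) * Suc t"
    using CondT.IH[of ?q "\<sigma>\<lparr>pc := ?q, reg := \<rho>\<rparr>"] CondT.prems sim_reg[OF _ r(4)]
    by (auto simp: Let_def add.assoc)
  have "?m + 1 + T \<le> length (comp p (Cond e f c d)) * Suc t"
    using 2(4) by (simp add: Let_def add.assoc algebra_simps)
  then show ?case
    using funpow_step_trans[OF 1 2(1)] 2
    by (intro exI[of _ "?m + 1 + T"]) (auto simp: Let_def add.assoc)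
next
  case (CondF e s f d t s' c)
  let ?m = "length (cexp e 100 @ cexp f 101)"
  let ?q = "p + ?m + 1"
  let ?y = "length (comp ?q d)"
  let ?x = "length (comp (?q + ?y + 1) c)"
  obtain \<rho> where r: "(step w prog ^^ ?m) \<sigma> = \<sigma>\<lparr>pc := p + ?m, reg := \<rho>\<rparr>"
    "\<rho> 100 = aval e s" "\<rho> 101 = aval f s" "\<forall>x<100. \<rho> x = reg \<sigma> x"
    using tests_correct[of prog p e f \<sigma> s] CondF.prems CondF.hyps by (auto simp: Let_def)
  have 1: "(step w prog ^^ (?m + 1)) \<sigma> = \<sigma>\<lparr>pc := ?q, reg := \<rho>\<rparr>"
    by (rule funpow_step_trans[OF r(1)])
      (use CondF.prems CondF.hyps r in \<open>simp add: step_code_at add.assoc Let_def\<close>)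
  obtain T \<sigma>' where 2: "(step w prog ^^ T) (\<sigma>\<lparr>pc := ?q, reg := \<rho>\<rparr>) = \<sigma>'"
    "pc \<sigma>' = ?q + ?y" "sim \<sigma>' s'" "T \<le> ?y * Suc t"
    using CondF.IH[of ?q "\<sigma>\<lparr>pc := ?q, reg := \<rho>\<rparr>"] CondF.prems sim_reg[OF _ r(4)]
    by (auto simp: Let_def add.assoc)
  have 3: "(step w prog ^^ (?m + 1 + T + 1)) \<sigma> = \<sigma>'\<lparr>pc := ?q + ?y + 1 + ?x\<rparr>"
    by (rule funpow_step_trans[OF funpow_step_trans[OF 1 2(1)]])
      (use CondF.prems 2 in \<open>simp add: step_code_at add.assoc Let_def add.assoc\<close>)
  have "?m + 1 + T + 1 \<le> length (comp p (Cond e f c d)) * Suc t"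
    using 2(4) by (simp add: Let_def add.assoc algebra_simps)
  then show ?case
    using 3 2 by (intro exI[of _ "?m + 1 + T + 1"]) (auto simp: Let_def add.assoc sim_pc)
next
  case (WhileF e s f c)
  let ?m = "length (cexp e 100 @ cexp f 101)"
  let ?x = "length (comp (p + ?m + 2) c)"
  obtain \<rho> where r: "(step w prog ^^ ?m) \<sigma> = \<sigma>\<lparr>pc := p + ?m, reg := \<rho>\<rparr>"
    "\<rho> 100 = aval e s" "\<rho> 101 = aval f s" "\<forall>x<100. \<rho> x = reg \<sigma> x"
    using tests_correct[of prog p e f \<sigma> s] WhileF.prems WhileF.hyps by (auto simp: Let_def)
  have 1: "(step w prog ^^ (?m + 2)) \<sigma> = \<sigma>\<lparr>pc := p + ?m + 2 + ?x + 1, reg := \<rho>\<rparr>"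
    by (rule funpow_step_trans[OF r(1)])
      (use WhileF.prems WhileF.hyps r in \<open>simp add: step_code_at add.assoc Let_def funpow_2_4\<close>)
  then show ?case
    using WhileF.prems sim_reg[OF _ r(4)]
    by (intro exI[of _ "?m + 2"]) (auto simp: Let_def add.assoc)
next
  case (WhileT e s f c t s' t' s'')
  let ?m = "length (cexp e 100 @ cexp f 101)"
  let ?q = "p + ?m + 2"
  let ?x = "length (comp ?q c)" and ?l = "length (comp p (While e f c))"
  obtain \<rho> where r: "(step w prog ^^ ?m) \<sigma> = \<sigma>\<lparr>pc := p + ?m, reg := \<rho>\<rparr>"
    "\<rho> 100 = aval e s" "\<rho> 101 = aval f s" "\<forall>x<100. \<rho> x = reg \<sigma> x"
    using tests_correct[of prog p e f \<sigma> s] WhileT.prems WhileT.hyps by (auto simp: Let_def)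
  have 1: "(step w prog ^^ (?m + 1)) \<sigma> = \<sigma>\<lparr>pc := ?q, reg := \<rho>\<rparr>"
    by (rule funpow_step_trans[OF r(1)])
      (use WhileT.prems WhileT.hyps r in \<open>simp add: step_code_at add.assoc Let_def\<close>)
  obtain T \<sigma>' where 2: "(step w prog ^^ T) (\<sigma>\<lparr>pc := ?q, reg := \<rho>\<rparr>) = \<sigma>'"
    "pc \<sigma>' = ?q + ?x" "sim \<sigma>' s'" "T \<le> ?x * Suc t"
    using WhileT.IH(1)[of ?q "\<sigma>\<lparr>pc := ?q, reg := \<rho>\<rparr>"] WhileT.prems sim_reg[OF _ r(4)]
    by (auto simp: Let_def add.assoc)
  have 3: "(step w prog ^^ (?m + 1 + T + 1)) \<sigma> = \<sigma>'\<lparr>pc := p\<rparr>"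
    by (rule funpow_step_trans[OF funpow_step_trans[OF 1 2(1)]])
      (use WhileT.prems 2 in \<open>simp add: step_code_at add.assoc Let_def add.assoc\<close>)
  have pc: "pc (\<sigma>'\<lparr>pc := p\<rparr>) = p" by simp
  obtain T' \<sigma>'' where 4: "(step w prog ^^ T') (\<sigma>'\<lparr>pc := p\<rparr>) = \<sigma>''"
    "pc \<sigma>'' = p + ?l" "sim \<sigma>'' s''" "T' \<le> ?l * Suc t'"
    using WhileT.IH(2)[OF WhileT.prems(1) pc sim_pc[OF 2(3)]] by (elim exE conjE) (rule that)
  have l: "?l = ?m + 2 + ?x + 1" by (simp add: Let_def)
  have "?m + 1 + T + 1 \<le> ?l * Suc t" unfolding l by (rule body_time[OF 2(4)])
  note 5 = while_time[OF this 4(4)]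
  show ?case
    by (intro exI conjI, rule funpow_step_trans[OF 3 4(1)], rule 4(2), rule 4(3), rule 5)
qed

section \<open>Weakest preconditions with a time budget\<close>

text \<open>Total correctness with a budget: \<open>T\<close> loop iterations may be spent, and the
  postcondition receives what is left. A time bound is then stated as a lower bound on the remaining
  budget, which composes along a sequence of programs.\<close>

definition wp :: "com \<Rightarrow> (st \<Rightarrow> nat \<Rightarrow> bool) \<Rightarrow> st \<Rightarrow> nat \<Rightarrow> bool" where
  "wp c Q s T \<longleftrightarrow> (\<exists>t s'. exec c s t s' \<and> t \<le> T \<and> Q s' (T - t))"

inductive_cases exec_elims [elim!]:
  "exec Skip s t s'" "exec (Asgn x e) s t s'" "exec (Wr a e f) s t s'" "exec (Out e) s t s'"
  "exec (c ;; d) s t s'" "exec (Cond e f c d) s t s'"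

lemma wp_Skip [simp]: "wp Skip Q s T \<longleftrightarrow> Q s T"
  unfolding wp_def by (auto intro: exec.intros intro!: exI[of _ 0])

lemma wp_Asgn [simp]: "wp (Asgn x e) Q s T \<longleftrightarrow>
    ok e s \<and> x < 100 \<and> x \<noteq> 2 \<and> Q (s\<lparr>vr := (vr s)(x := aval e s)\<rparr>) T"
  unfolding wp_def by (auto intro: exec.intros intro!: exI[of _ 0])

lemma wp_Wr [simp]: "wp (Wr a e f) Q s T \<longleftrightarrow> ok e s \<and> ok f s \<and> a < 16 \<and> aval e s < W \<and>
    Q (s\<lparr>ar := (ar s)(a := (ar s a)(aval e s := aval f s))\<rparr>) T"
  unfolding wp_def by (auto intro: exec.intros intro!: exI[of _ 0])

lemma wp_Out [simp]: "wp (Out e) Q s T \<longleftrightarrow> ok e s \<and> Q (s\<lparr>ou := ou s @ [aval e s]\<rparr>) T"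
  unfolding wp_def by (auto intro: exec.intros intro!: exI[of _ 0])

lemma wp_Seq [simp]: "wp (c ;; d) Q s T \<longleftrightarrow> wp c (wp d Q) s T"
proof
  assume "wp (c ;; d) Q s T"
  then obtain t s1 t' s2 where "exec c s t s1" "exec d s1 t' s2" "t + t' \<le> T" "Q s2 (T - (t + t'))"
    unfolding wp_def by blast
  then show "wp c (wp d Q) s T"
    unfolding wp_def by (intro exI[of _ t] exI[of _ s1]) (auto intro!: exI[of _ t'] exI[of _ s2])
next
  assume "wp c (wp d Q) s T"
  then obtain t s1 t' s2 where "exec c s t s1" "t \<le> T" "exec d s1 t' s2" "t' \<le> T - t"
    "Q s2 (T - t - t')" unfolding wp_def by blast
  then show "wp (c ;; d) Q s T"
    unfolding wp_def using exec.Seq by (intro exI[of _ "t + t'"] exI[of _ s2]) auto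
qed

lemma wp_Cond [simp]: "wp (Cond e f c d) Q s T \<longleftrightarrow>
    ok e s \<and> ok f s \<and> (if aval e s < aval f s then wp c Q s T else wp d Q s T)"
  unfolding wp_def by (auto intro: exec.CondT exec.CondF)

lemma wp_mono: "wp c Q s T \<Longrightarrow> (\<And>s' T'. Q s' T' \<Longrightarrow> R s' T') \<Longrightarrow> wp c R s T"
  unfolding wp_def by blast

text \<open>Read off from the syntax, this relieves every loop invariant of naming the registers and
  arrays that the loop does not touch.\<close>

definition frame :: "com \<Rightarrow> st \<Rightarrow> st \<Rightarrow> bool" where
  "frame c s s' \<longleftrightarrow> (\<forall>x. x \<notin> assigned c \<longrightarrow> vr s' x = vr s x) \<and>
     (\<forall>a. a \<notin> written c \<longrightarrow> ar s' a = ar s a) \<and> (silent c \<longrightarrow> ou s' = ou s)"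

lemma frame_refl [simp]: "frame c s s"
  by (simp add: frame_def)

lemma frame_trans: "frame c s s' \<Longrightarrow> frame c s' s'' \<Longrightarrow> frame c s s''"
  by (simp add: frame_def)

lemma exec_frame: "exec c s t s' \<Longrightarrow> frame c s s'"
  by (induction rule: exec.induct) (auto simp: frame_def)

lemma wp_frame: "wp c Q s T \<Longrightarrow> (\<And>s' T'. Q s' T' \<Longrightarrow> frame c s s' \<Longrightarrow> R s' T') \<Longrightarrow> wp c R s T"
  unfolding wp_def using exec_frame by blast

text \<open>The budget serves as the termination measure: each iteration takes one unit, and the
  induction is on the remaining \<open>T'\<close>. The frame relative to the state before the loop
  is available in every iteration and at the exit.\<close>

lemma wp_While:
  assumes "I s T"
    and step: "\<And>s' T'. I s' T' \<Longrightarrow> frame c s s' \<Longrightarrow> ok e s' \<and> ok f s' \<and>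
      (aval e s' < aval f s' \<longrightarrow> 0 < T' \<and> wp c I s' (T' - 1))"
    and post: "\<And>s' T'. I s' T' \<Longrightarrow> frame c s s' \<Longrightarrow> \<not> aval e s' < aval f s' \<Longrightarrow> Q s' T'"
  shows "wp (While e f c) Q s T"
proof -
  have "wp (While e f c) Q s' T'" if "I s' T'" "frame c s s'" for s' T'
    using that
  proof (induction T' arbitrary: s' rule: less_induct)
    case (less T')
    note st = step[OF less.prems]
    show ?case
    proof (cases "aval e s' < aval f s'")
      case False
      then show ?thesis
        using st post[OF less.prems False] exec.WhileF[of e s' f c] unfolding wp_def by force
    next
      case True
      with st obtain t s'' where 1: "exec c s' t s''" "t \<le> T' - 1" "I s'' (T' - 1 - t)" "0 < T'"
        unfolding wp_def by blast
      then have "wp (While e f c) Q s'' (T' - 1 - t)"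
        using less.prems(2) by (intro less.IH) (auto intro: frame_trans exec_frame)
      then obtain t' s''' where "exec (While e f c) s'' t' s'''" "t' \<le> T' - 1 - t"
        "Q s''' (T' - 1 - t - t')" unfolding wp_def by blast
      then show ?thesis
        using 1 st True exec.WhileT[of e s' f c t s'' t' s'''] unfolding wp_def
        by (intro exI[of _ "Suc (t + t')"] exI[of _ s''']) auto
    qed
  qed
  then show ?thesis using assms(1) by simp
qed

end

section \<open>Sparse covers by ball carving\<close>

locale weighted_graph =
  fixes V :: "nat set" and nbr :: "nat \<Rightarrow> nat set" and wt :: "nat \<Rightarrow> nat"
  assumes finite_V: "finite V"
    and nbr_subset: "x \<in> V \<Longrightarrow> nbr x \<subseteq> V"
    and nbr_sym: "y \<in> nbr x \<Longrightarrow> x \<in> nbr y"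
begin

fun walk :: "nat \<Rightarrow> nat \<Rightarrow> nat \<Rightarrow> bool" where
  "walk 0 u v \<longleftrightarrow> u = v"
| "walk (Suc l) u v \<longleftrightarrow> (\<exists>x. walk l u x \<and> v \<in> nbr x)"

lemma walk_in_V: "walk l u v \<Longrightarrow> u \<in> V \<Longrightarrow> v \<in> V"
  by (induction l arbitrary: v) (use nbr_subset in auto)

text \<open>Balls are taken in the whole graph, while the search trees live in the shrinking set of
  waiting vertices. For a ball contained in that set the two views fit together; this is what the
  two lemmas on \<open>lipschitz\<close> express.\<close>

definition ball :: "nat \<Rightarrow> nat \<Rightarrow> nat set" where
  "ball r u = {v. \<exists>l\<le>r. walk l u v}"

lemma ball_self [simp]: "u \<in> ball r u"
  by (auto simp: ball_def intro: exI[of _ 0])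

lemma ball_subset_V: "u \<in> V \<Longrightarrow> ball r u \<subseteq> V"
  using walk_in_V by (auto simp: ball_def)

text \<open>Stands in for distances within \<open>A\<close>: the depths of a search stopped at
  \<open>thr\<close> satisfy it, and it locates a whole ball from the depth of one of its
  vertices.\<close>

definition lipschitz :: "nat set \<Rightarrow> nat set \<Rightarrow> (nat \<Rightarrow> nat) \<Rightarrow> nat \<Rightarrow> bool" where
  "lipschitz A Q dp thr \<longleftrightarrow>
     (\<forall>x\<in>Q. dp x < thr \<longrightarrow> (\<forall>y\<in>nbr x \<inter> A. y \<in> Q \<and> dp y \<le> Suc (dp x)))"

lemma lipschitz_from_center:
  assumes "lipschitz A Q dp thr" "ball r u \<subseteq> A" "u \<in> Q" "walk l u v" "l \<le> r" "dp u + l \<le> thr"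
  shows "v \<in> Q \<and> dp v \<le> dp u + l"
  using assms(4-6)
proof (induction l arbitrary: v)
  case (Suc l)
  then obtain x where x: "walk l u x" "v \<in> nbr x" by auto
  with Suc have "x \<in> Q \<and> dp x \<le> dp u + l" by simp
  moreover have "v \<in> A" using Suc.prems assms(2) unfolding ball_def by blast
  ultimately show ?case using x Suc.prems assms(1) by (force simp: lipschitz_def)
qed (use assms in simp)

text \<open>It is the ball around \<open>u\<close> that is known to lie in \<open>A\<close>, so the
  walk is followed backwards from \<open>v\<close>: the vertices before \<open>v\<close> on it
  belong to that ball, and adjacency is symmetric.\<close>

lemma lipschitz_to_center:
  assumes "lipschitz A Q dp thr" "ball r u \<subseteq> A" "v \<in> Q" "walk l u v" "l \<le> r" "dp v + l \<le> thr"
  shows "u \<in> Q \<and> dp u \<le> dp v + l"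
  using assms(3-6)
proof (induction l arbitrary: v)
  case (Suc l)
  then obtain x where x: "walk l u x" "x \<in> nbr v" using nbr_sym by auto
  have "x \<in> ball r u" using x(1) Suc.prems(3) unfolding ball_def by (auto intro!: exI[of _ l])
  then have "x \<in> A" using assms(2) by blast
  then have "x \<in> Q \<and> dp x \<le> Suc (dp v)" using x Suc.prems assms(1) by (force simp: lipschitz_def)
  then show ?case using Suc.IH[of x] x Suc.prems by auto
qed simp

text \<open>\<open>qs\<close> holds all vertices reached so far and \<open>h\<close> counts those
  already expanded. The lower bound \<open>lm\<close> on the depth of unexpanded vertices says that
  the search has passed depth \<open>lm\<close>: new vertices become deeper than that, so the weight
  within depth \<open>lm\<close> is final.\<close>

definition bfs ::
  "nat set \<Rightarrow> nat \<Rightarrow> nat \<Rightarrow> nat \<Rightarrow> nat list \<Rightarrow> nat \<Rightarrow> (nat \<Rightarrow> nat) \<Rightarrow> (nat \<Rightarrow> nat) \<Rightarrow> bool" where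
  "bfs A c lm thr qs h dp pr \<longleftrightarrow> distinct qs \<and> set qs \<subseteq> A \<and> c \<in> set qs \<and> dp c = 0 \<and> h \<le> length qs \<and>
     (\<forall>x\<in>set qs. dp x \<le> thr \<and> (dp x = 0 \<longrightarrow> x = c) \<and>
        (0 < dp x \<longrightarrow> pr x \<in> set qs \<and> Suc (dp (pr x)) = dp x \<and> pr x \<in> nbr x)) \<and>
     sorted (map dp qs) \<and> (\<forall>i. h \<le> i \<and> i < length qs \<longrightarrow> lm \<le> dp (qs ! i)) \<and>
     (h < length qs \<longrightarrow> (\<forall>x\<in>set qs. dp x \<le> Suc (dp (qs ! h)))) \<and>
     (\<forall>i<h. \<forall>y\<in>nbr (qs ! i) \<inter> A. y \<in> set qs \<and> dp y \<le> Suc (dp (qs ! i)))"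

lemma bfs_push:
  assumes "bfs A c lm thr qs h dp pr" "h < length qs" "dp (qs ! h) < thr"
    and "y \<in> A" "y \<in> nbr (qs ! h)" "y \<notin> set qs"
  shows "bfs A c lm thr (qs @ [y]) h (dp(y := Suc (dp (qs ! h)))) (pr(y := qs ! h))"
proof -
  let ?dp = "dp(y := Suc (dp (qs ! h)))"
  have ne: "qs ! i \<noteq> y" if "i < length qs" for i using assms(6) that by auto
  have map: "map ?dp (qs @ [y]) = map dp qs @ [Suc (dp (qs ! h))]" using assms(6) by auto
  have "sorted (map ?dp (qs @ [y]))"
    unfolding map using assms(1,2) unfolding bfs_def by (auto simp: sorted_append)
  moreover have "lm \<le> ?dp ((qs @ [y]) ! i)" if "h \<le> i" "i < length (qs @ [y])" for i
    using assms(1,2) that ne unfolding bfs_def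
    by (cases "i = length qs") (auto simp: nth_append le_Suc_eq)
  moreover have "\<forall>x\<in>set (qs @ [y]). ?dp x \<le> Suc (?dp ((qs @ [y]) ! h))"
    using assms(1,2,6) ne unfolding bfs_def by (auto simp: nth_append)
  moreover have "\<forall>i<h. \<forall>z\<in>nbr ((qs @ [y]) ! i) \<inter> A. z \<in> set (qs @ [y]) \<and>
      ?dp z \<le> Suc (?dp ((qs @ [y]) ! i))"
    using assms(1,2,6) ne unfolding bfs_def by (fastforce simp: nth_append)
  moreover have "\<forall>x\<in>set (qs @ [y]). ?dp x \<le> thr \<and> (?dp x = 0 \<longrightarrow> x = c) \<and>
      (0 < ?dp x \<longrightarrow> (pr(y := qs ! h)) x \<in> set (qs @ [y]) \<and>
        Suc (?dp ((pr(y := qs ! h)) x)) = ?dp x \<and> (pr(y := qs ! h)) x \<in> nbr x)"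
    using assms ne nbr_sym unfolding bfs_def by auto
  ultimately show ?thesis using assms(1,4,6) unfolding bfs_def by auto
qed

lemma bfs_advance:
  assumes b: "bfs A c lm thr qs h dp pr" and h: "h < length qs" and nb: "nbr (qs ! h) \<inter> A \<subseteq> set qs"
  shows "bfs A c lm thr qs (Suc h) dp pr"
proof -
  have le: "\<forall>y\<in>set qs. dp y \<le> Suc (dp (qs ! h))" using b h unfolding bfs_def by blast
  have srt: "sorted (map dp qs)" using b unfolding bfs_def by blast
  have 1: "\<forall>x\<in>set qs. dp x \<le> Suc (dp (qs ! Suc h))" if "Suc h < length qs"
  proof -
    have "dp (qs ! h) \<le> dp (qs ! Suc h)"
      using sorted_nth_mono[OF srt, of h "Suc h"] that by simp
    then show ?thesis using le by (meson Suc_le_mono le_trans)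
  qed
  have "\<forall>i<h. \<forall>y\<in>nbr (qs ! i) \<inter> A. y \<in> set qs \<and> dp y \<le> Suc (dp (qs ! i))"
    using b unfolding bfs_def by blast
  then have 2: "\<forall>i<Suc h. \<forall>y\<in>nbr (qs ! i) \<inter> A. y \<in> set qs \<and> dp y \<le> Suc (dp (qs ! i))"
    using nb le by (metis less_Suc_eq subsetD)
  have "\<forall>i. h \<le> i \<and> i < length qs \<longrightarrow> lm \<le> dp (qs ! i)"
    using b unfolding bfs_def by blast
  then have 3: "\<forall>i. Suc h \<le> i \<and> i < length qs \<longrightarrow> lm \<le> dp (qs ! i)" by (meson Suc_leD)
  have 4: "distinct qs \<and> set qs \<subseteq> A \<and> c \<in> set qs \<and> dp c = 0" using b unfolding bfs_def by blast
  have 5: "\<forall>x\<in>set qs. dp x \<le> thr \<and> (dp x = 0 \<longrightarrow> x = c) \<and>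
        (0 < dp x \<longrightarrow> pr x \<in> set qs \<and> Suc (dp (pr x)) = dp x \<and> pr x \<in> nbr x)"
    using b unfolding bfs_def by blast
  show ?thesis unfolding bfs_def by (intro conjI 5 2 3 srt impI 1) (use 4 h in simp_all)
qed

text \<open>Once the head has depth at least \<open>thr\<close>, so has by sortedness everything
  behind it, and \<open>thr\<close> can become the inner radius of the next annulus.\<close>

lemma bfs_layer:
  assumes "bfs A c lm thr qs h dp pr" "h < length qs \<longrightarrow> thr \<le> dp (qs ! h)" "thr \<le> thr'"
  shows "bfs A c thr thr' qs h dp pr"
proof -
  have "thr \<le> dp (qs ! i)" if "h \<le> i" "i < length qs" for i
    using assms that sorted_nth_mono[of "map dp qs" h i] unfolding bfs_def by auto
  moreover have "dp x \<le> thr'" if "x \<in> set qs" for x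
    using assms(1,3) that unfolding bfs_def by (meson le_trans)
  ultimately show ?thesis using assms(1) unfolding bfs_def by simp
qed

text \<open>The search may stop with unexpanded vertices, but by sortedness all of them have depth
  at least \<open>thr\<close>; a vertex of smaller depth has been expanded.\<close>

lemma bfs_lipschitz:
  assumes "bfs A c lm thr qs h dp pr" "h < length qs \<longrightarrow> thr \<le> dp (qs ! h)"
  shows "lipschitz A (set qs) dp thr"
  unfolding lipschitz_def
proof (intro ballI impI)
  fix x y assume x: "x \<in> set qs" "dp x < thr" and y: "y \<in> nbr x \<inter> A"
  obtain i where i: "i < length qs" "x = qs ! i" using x by (auto simp: in_set_conv_nth)
  have "i < h"
  proof (rule ccontr)
    assume "\<not> i < h"
    then have "thr \<le> dp (qs ! i)"
      using assms i sorted_nth_mono[of "map dp qs" h i] unfolding bfs_def by auto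
    then show False using x i by simp
  qed
  then show "y \<in> set qs \<and> dp y \<le> Suc (dp x)" using assms(1) i y unfolding bfs_def by blast
qed

section \<open>One round of carving\<close>

definition tree_node :: "nat set \<Rightarrow> nat \<Rightarrow> (nat \<Rightarrow> nat) \<Rightarrow> (nat \<Rightarrow> nat) \<Rightarrow> (nat \<Rightarrow> nat) \<Rightarrow> nat \<Rightarrow> bool" where
  "tree_node X R dp pr rt x \<longleftrightarrow> dp x \<le> R \<and> (dp x = 0 \<longrightarrow> rt x = x) \<and>
     (0 < dp x \<longrightarrow> pr x \<in> X \<and> rt (pr x) = rt x \<and> Suc (dp (pr x)) = dp x \<and> pr x \<in> nbr x)"

text \<open>\<open>M\<close> is the set of vertices of round \<open>j\<close>, \<open>A\<close>
  those still waiting, \<open>X\<close> those collected for the next round. Homes are assigned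
  optimistically: a vertex counts as at home in round \<open>j\<close> until a cut comes close to
  it, and up to then its ball lies wholly among the waiting vertices or wholly in one tree. The
  weight of \<open>X\<close> is charged to the vertices carved off, which halves the weight from
  round to round.\<close>

definition round_inv ::
  "nat \<Rightarrow> nat \<Rightarrow> nat \<Rightarrow> (nat \<Rightarrow> nat) \<Rightarrow> nat set \<Rightarrow> nat set \<Rightarrow> nat set \<Rightarrow> (nat \<Rightarrow> nat) \<Rightarrow>
    (nat \<Rightarrow> nat) \<Rightarrow> (nat \<Rightarrow> nat) \<Rightarrow> (nat \<Rightarrow> nat) \<Rightarrow> bool" where
  "round_inv r R j H\<^sub>0 M A X H dp pr rt \<longleftrightarrow> A \<subseteq> M \<and> X \<subseteq> M \<and> M \<subseteq> V \<and>
     2 * sum wt X \<le> sum wt (M - A) \<and> (\<forall>x\<in>M - A. tree_node (M - A) R dp pr rt x) \<and>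
     (\<forall>u\<in>V. H u = H\<^sub>0 u \<or> H\<^sub>0 u = j \<and> H u = Suc j) \<and>
     (\<forall>u\<in>V. H u = j \<longrightarrow> ball r u \<subseteq> A \<or> ball r u \<subseteq> M - A \<and> (\<forall>v\<in>ball r u. rt v = rt u)) \<and>
     (\<forall>u\<in>V. H u = Suc j \<longrightarrow> ball r u \<subseteq> X)"

text \<open>The search has reached depth \<open>lm + 4 * r\<close> and the cut is made at
  \<open>lm + 2 * r\<close>. Consider a ball of radius \<open>r\<close> inside \<open>A\<close>.
  Centred at depth at most \<open>lm + r\<close>, it is carved off whole; centred beyond
  \<open>lm + 3 * r\<close>, or outside the search, it is spared whole; centred in between, it lies
  in the annulus and passes into \<open>X'\<close>. By \<open>slow\<close> the annulus weighs at
  most half of its inside. This pays for \<open>X'\<close> and bounds the searched weight by three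
  halves of the weight removed from \<open>A\<close>.\<close>

lemma carve_step:
  assumes inv: "round_inv r R j H\<^sub>0 M A X H dp\<^sub>0 pr\<^sub>0 rt\<^sub>0"
    and bfs: "bfs A c lm (lm + 4 * r) qs h dp pr" "h < length qs \<longrightarrow> lm + 4 * r \<le> dp (qs ! h)"
    and slow: "2 * sum wt (set qs) \<le> 3 * sum wt {x \<in> set qs. dp x \<le> lm}"
    and R: "lm + 2 * r \<le> R"
    and same: "\<And>x. x \<notin> set qs \<Longrightarrow> dp x = dp\<^sub>0 x \<and> pr x = pr\<^sub>0 x \<and> rt x = rt\<^sub>0 x"
    and rt: "\<And>x. x \<in> set qs \<Longrightarrow> rt x = c"
    and H': "\<And>x. x \<in> V \<Longrightarrow> H' x =
      (if x \<in> set qs \<and> lm + r < dp x \<and> dp x \<le> lm + 3 * r \<and> H x = j then Suc j else H x)"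
    and A': "A' = A - {x \<in> set qs. dp x \<le> lm + 2 * r}"
    and X': "X' = X \<union> {x \<in> set qs. lm < dp x}"
  shows "round_inv r R j H\<^sub>0 M A' X' H' dp pr rt" and "sum wt (set qs) + sum wt (set qs) \<le> 3 * sum wt (A - A')"
proof -
  let ?Q = "set qs" and ?C = "{x \<in> set qs. dp x \<le> lm + 2 * r}"
  have sub: "A \<subseteq> M" "X \<subseteq> M" "M \<subseteq> V" "?Q \<subseteq> A" using inv bfs unfolding round_inv_def bfs_def by auto
  then have fin: "finite M" "finite A" "finite X" using finite_V by (auto intro: finite_subset)
  note lip = bfs_lipschitz[OF bfs]
  have MA: "M - A' = (M - A) \<union> ?C" using sub by (auto simp: A')
  have C_le: "sum wt {x \<in> ?Q. dp x \<le> lm} \<le> sum wt ?C" by (intro sum_mono2) auto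
  have AA: "A - A' = ?C" using sub by (auto simp: A')
  show "sum wt (set qs) + sum wt (set qs) \<le> 3 * sum wt (A - A')" using slow C_le unfolding AA by simp
  have "sum wt ?Q = sum wt {x \<in> ?Q. dp x \<le> lm} + sum wt {x \<in> ?Q. lm < dp x}"
    by (subst sum.union_disjoint[symmetric]) (auto intro!: sum.cong)
  moreover have "sum wt X' \<le> sum wt X + sum wt {x \<in> ?Q. lm < dp x}"
    unfolding X' using fin by (subst sum.union_inter[symmetric]) auto
  moreover have "sum wt (M - A') = sum wt (M - A) + sum wt ?C"
    unfolding MA using fin sub by (intro sum.union_disjoint) auto
  moreover have "2 * sum wt X \<le> sum wt (M - A)" using inv unfolding round_inv_def by blast
  ultimately have 1: "2 * sum wt X' \<le> sum wt (M - A')" using slow C_le by linarith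
  have 2: "tree_node (M - A') R dp pr rt x" if "x \<in> M - A'" for x
  proof (cases "x \<in> ?C")
    case True
    have "pr x \<in> ?C" if "0 < dp x"
    proof -
      have "pr x \<in> ?Q" "Suc (dp (pr x)) = dp x" using True that bfs unfolding bfs_def by auto
      then show ?thesis using True by simp
    qed
    then show ?thesis using True R rt bfs MA unfolding bfs_def tree_node_def by auto
  next
    case False
    with that have x: "x \<in> M - A" "x \<notin> ?Q" using sub MA by auto
    then have t: "tree_node (M - A) R dp\<^sub>0 pr\<^sub>0 rt\<^sub>0 x" using inv unfolding round_inv_def by blast
    \<comment> \<open>The searched set lies in \<open>A\<close>, so the trees made earlier keep
      their depths, parents and roots.\<close>
    have "y \<notin> ?Q" if "y \<in> M - A" for y using that sub by auto
    with t x show ?thesis unfolding tree_node_def MA using same by auto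
  qed
  have 3: "ball r u \<subseteq> A' \<or> ball r u \<subseteq> M - A' \<and> (\<forall>v\<in>ball r u. rt v = rt u)"
    if u: "u \<in> V" "H' u = j" for u
  proof -
    have Hu: "H u = j" using u H' by (metis n_not_Suc_n)
    then consider "ball r u \<subseteq> A" | "ball r u \<subseteq> M - A" "\<forall>v\<in>ball r u. rt\<^sub>0 v = rt\<^sub>0 u"
      using inv u unfolding round_inv_def by blast
    then show ?thesis
    proof cases
      case 1
      show ?thesis
      proof (cases "u \<in> ?Q \<and> dp u \<le> lm + r")
        case True
        have "v \<in> ?C" if v: "v \<in> ball r u" for v
        proof -
          obtain l where l: "walk l u v" "l \<le> r" using v by (auto simp: ball_def)
          have "v \<in> ?Q \<and> dp v \<le> dp u + l"
            by (rule lipschitz_from_center[OF lip 1 _ l]) (use True l in auto)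
          then show ?thesis using True l by simp
        qed
        then have "ball r u \<subseteq> ?C" by blast
        then show ?thesis using MA rt True by blast
      next
        case False
        \<comment> \<open>A ball vertex in the carved part would put the centre at a depth of at
          most \<open>lm + 3 * r\<close>, between the two thresholds, and the home of the centre
          would have moved on.\<close>
        have "v \<notin> ?C" if v: "v \<in> ball r u" for v
        proof
          assume C: "v \<in> ?C"
          obtain l where l: "walk l u v" "l \<le> r" using v by (auto simp: ball_def)
          have "u \<in> ?Q \<and> dp u \<le> dp v + l"
            by (rule lipschitz_to_center[OF lip 1 _ l]) (use C l in auto)
          then have "u \<in> ?Q" "dp u \<le> lm + 3 * r" "lm + r < dp u" using C l False by auto
          then have "H' u = Suc j" using H' u Hu by simp
          then show False using u by simp
        qed
        then show ?thesis using 1 A' by blast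
      qed
    next
      case 2
      then have "v \<notin> ?Q" if "v \<in> ball r u" for v using sub that by blast
      then have "\<forall>v\<in>ball r u. rt v = rt u" using 2 same ball_self by metis
      then show ?thesis using 2 MA by blast
    qed
  qed
  have 4: "ball r u \<subseteq> X'" if u: "u \<in> V" "H' u = Suc j" for u
  proof (cases "H u = Suc j")
    case True
    then show ?thesis using inv u X' unfolding round_inv_def by blast
  next
    case False
    then have q: "u \<in> ?Q" "lm + r < dp u" "dp u \<le> lm + 3 * r" "H u = j"
      using u H' by (auto split: if_splits)
    \<comment> \<open>The ball is either still waiting or carved whole; as \<open>u\<close> itself
      is in the queue, hence waiting, the former holds.\<close>
    then have 1: "ball r u \<subseteq> A" using inv u sub unfolding round_inv_def
      by (metis Diff_iff ball_self subsetD)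
    have "v \<in> ?Q \<and> lm < dp v" if v: "v \<in> ball r u" for v
    proof -
      obtain l where l: "walk l u v" "l \<le> r" using v by (auto simp: ball_def)
      have Q: "v \<in> ?Q" using lipschitz_from_center[OF lip 1 _ l] q l by auto
      have "lm < dp v"
      proof (rule ccontr)
        assume "\<not> lm < dp v"
        then have "dp u \<le> dp v + l" using lipschitz_to_center[OF lip 1 Q l] l by auto
        then show False using \<open>\<not> lm < dp v\<close> q l by simp
      qed
      then show ?thesis using Q by simp
    qed
    then show ?thesis using X' by blast
  qed
  have 5: "\<forall>u\<in>V. H' u = H\<^sub>0 u \<or> H\<^sub>0 u = j \<and> H' u = Suc j"
    using inv H' unfolding round_inv_def by (metis n_not_Suc_n)
  show "round_inv r R j H\<^sub>0 M A' X' H' dp pr rt"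
    unfolding round_inv_def using 1 2 3 4 5 sub A' X' by blast
qed

section \<open>All rounds of one scale\<close>

definition row_ok :: "(nat \<Rightarrow> nat) \<Rightarrow> nat \<Rightarrow> (nat \<Rightarrow> nat \<Rightarrow> nat) \<Rightarrow> (nat \<Rightarrow> nat \<Rightarrow> nat) \<Rightarrow>
    (nat \<Rightarrow> nat \<Rightarrow> nat) \<Rightarrow> nat \<Rightarrow> bool" where
  "row_ok S R dp pr rt j \<longleftrightarrow>
     (\<forall>x\<in>V. j \<le> S x \<longrightarrow> tree_node {y \<in> V. j \<le> S y} R (dp j) (pr j) (rt j) x)"

text \<open>The last conjunct is a potential. \<open>D\<close> will be the average degree, a lower
  bound for every weight. Each vertex entering a further round adds \<open>D\<close> to the first
  term, and the weight in play drops by at least as much, because at most half of it goes on. Hence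
  the number of records of a scale stays linear in the number of vertices.\<close>

definition scale_inv :: "nat \<Rightarrow> nat \<Rightarrow> nat \<Rightarrow> nat \<Rightarrow> (nat \<Rightarrow> nat) \<Rightarrow> (nat \<Rightarrow> nat) \<Rightarrow>
    (nat \<Rightarrow> nat \<Rightarrow> nat) \<Rightarrow> (nat \<Rightarrow> nat \<Rightarrow> nat) \<Rightarrow> (nat \<Rightarrow> nat \<Rightarrow> nat) \<Rightarrow> bool" where
  "scale_inv r R D j S H dp pr rt \<longleftrightarrow> (\<forall>x\<in>V. H x \<le> S x \<and> S x \<le> j) \<and>
     (\<forall>u\<in>V. H u = j \<longrightarrow> ball r u \<subseteq> {x \<in> V. S x = j}) \<and>
     (\<forall>u\<in>V. H u < j \<longrightarrow> (\<forall>v\<in>ball r u. H u \<le> S v \<and> rt (H u) v = rt (H u) u)) \<and>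
     (\<forall>i<j. row_ok S R dp pr rt i) \<and>
     D * (\<Sum>x\<in>V. Suc (S x)) + sum wt {x \<in> V. S x = j} \<le> D * card V + sum wt V"

text \<open>
  \<open>S x\<close> is the last round in which \<open>x\<close> takes part, \<open>H x\<close> its home round, and \<open>dp j\<close>, \<open>pr j\<close>, \<open>rt j\<close> are the depths,
  parents and roots in the trees of round \<open>j\<close>.
\<close>

definition scale_ok :: "nat \<Rightarrow> nat \<Rightarrow> (nat \<Rightarrow> nat) \<Rightarrow> (nat \<Rightarrow> nat) \<Rightarrow>
    (nat \<Rightarrow> nat \<Rightarrow> nat) \<Rightarrow> (nat \<Rightarrow> nat \<Rightarrow> nat) \<Rightarrow> (nat \<Rightarrow> nat \<Rightarrow> nat) \<Rightarrow> bool" where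
  "scale_ok r R S H dp pr rt \<longleftrightarrow> (\<forall>x\<in>V. H x \<le> S x) \<and> (\<forall>j. row_ok S R dp pr rt j) \<and>
     (\<forall>u\<in>V. \<forall>v\<in>ball r u. H u \<le> S v \<and> rt (H u) v = rt (H u) u)"

lemma scale_init:
  assumes "\<forall>x\<in>V. S x = 0" "\<forall>x\<in>V. H x = 0"
  shows "scale_inv r R D 0 S H dp pr rt"
proof -
  have "(\<Sum>x\<in>V. Suc (S x)) = card V" "{x \<in> V. S x = 0} = V" using assms by auto
  then show ?thesis using assms ball_subset_V unfolding scale_inv_def by auto
qed

lemma round_start:
  assumes "scale_inv r R D j S H dp pr rt" "M = {x \<in> V. S x = j}"
  shows "round_inv r R j H M M {} H dp' pr' rt'"
  using assms unfolding scale_inv_def round_inv_def by force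

lemma round_end:
  assumes scale: "scale_inv r R D j S H dp pr rt"
    and "round": "round_inv r R j H {x \<in> V. S x = j} {} X H' (dp' j) (pr' j) (rt' j)"
    and D: "\<And>x. x \<in> V \<Longrightarrow> D \<le> wt x"
    and S': "\<And>x. x \<in> V \<Longrightarrow> S' x = (if x \<in> X then Suc j else S x)"
    and same: "\<And>i x. i < j \<Longrightarrow> x \<in> V \<Longrightarrow> dp' i x = dp i x \<and> pr' i x = pr i x \<and> rt' i x = rt i x"
  shows "scale_inv r R D (Suc j) S' H' dp' pr' rt'"
proof -
  let ?M = "{x \<in> V. S x = j}"
  have X: "X \<subseteq> ?M" "2 * sum wt X \<le> sum wt ?M" using "round" unfolding round_inv_def by auto
  then have XV: "X \<subseteq> V" "finite X" using finite_V by (auto intro: finite_subset)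
  have H': "H' u = H u \<or> H u = j \<and> H' u = Suc j" if "u \<in> V" for u
    using "round" that unfolding round_inv_def by blast
  have S_le: "S x \<le> j" "H x \<le> S x" if "x \<in> V" for x using scale that unfolding scale_inv_def by auto
  have S'_ge: "S x \<le> S' x" if "x \<in> V" for x using S'[OF that] S_le[OF that] by auto
  have X_eq: "{x \<in> V. S' x = Suc j} = X" using S' S_le XV by (fastforce split: if_splits)
  have 1: "H' x \<le> S' x \<and> S' x \<le> Suc j" if x: "x \<in> V" for x
  proof -
    have "x \<in> X" if "H' x = Suc j"
      using "round" that x ball_self[of x r] unfolding round_inv_def by blast
    then show ?thesis using H'[OF x] S'[OF x] S_le[OF x] by (cases "H' x = Suc j") auto
  qed
  have 2: "ball r u \<subseteq> {x \<in> V. S' x = Suc j}" if "u \<in> V" "H' u = Suc j" for u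
    using "round" that X_eq unfolding round_inv_def by auto
  have 3: "H' u \<le> S' v \<and> rt' (H' u) v = rt' (H' u) u"
    if u: "u \<in> V" "H' u < Suc j" and v: "v \<in> ball r u" for u v
  proof -
    have vV: "v \<in> V" using ball_subset_V u v by blast
    show ?thesis
    proof (cases "H' u = j")
      case True
      then have "ball r u \<subseteq> ?M" "\<forall>v\<in>ball r u. rt' j v = rt' j u"
        using "round" u ball_self[of u r] unfolding round_inv_def by auto
      then have "S v = j" "rt' j v = rt' j u" using v by blast+
      then show ?thesis using S'_ge[OF vV] unfolding True by simp
    next
      case False
      then have lt: "H' u < j" and eq: "H u = H' u" using u H'[OF u(1)] by auto
      have "\<forall>u\<in>V. H u < j \<longrightarrow> (\<forall>v\<in>ball r u. H u \<le> S v \<and> rt (H u) v = rt (H u) u)"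
        using scale unfolding scale_inv_def by blast
      then have "H' u \<le> S v \<and> rt (H' u) v = rt (H' u) u" using u(1) v lt eq by metis
      then show ?thesis using S'_ge[OF vV] same[OF lt vV] same[OF lt u(1)] by simp
    qed
  qed
  have 4: "row_ok S' R dp' pr' rt' i" if i: "i < Suc j" for i
  proof (cases "i = j")
    case True
    have "{x \<in> V. j \<le> S' x} = ?M" using S' S_le X(1) by (auto simp: le_antisym split: if_splits)
    then show ?thesis using "round" True unfolding row_ok_def round_inv_def by auto
  next
    case False
    then have "i < j" using i by simp
    then have le: "(i \<le> S' x) = (i \<le> S x)" if "x \<in> V" for x
      using that S' X(1) by (auto split: if_splits)
    then have eq: "{x \<in> V. i \<le> S' x} = {x \<in> V. i \<le> S x}" by auto
    have "row_ok S R dp pr rt i" using scale \<open>i < j\<close> unfolding scale_inv_def by blast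
    then have t: "tree_node {y \<in> V. i \<le> S y} R (dp i) (pr i) (rt i) x" if "x \<in> V" "i \<le> S x" for x
      using that unfolding row_ok_def by blast
    have "tree_node {y \<in> V. i \<le> S y} R (dp' i) (pr' i) (rt' i) x" if x: "x \<in> V" "i \<le> S x" for x
    proof -
      have "pr i x \<in> V" if "0 < dp i x" using t[OF x] that unfolding tree_node_def by auto
      then show ?thesis using t[OF x] same[OF \<open>i < j\<close>] x(1) unfolding tree_node_def
        by (cases "0 < dp i x") simp_all
    qed
    then show ?thesis using le unfolding row_ok_def eq by simp
  qed
  have "(\<Sum>x\<in>V. Suc (S' x)) = (\<Sum>x\<in>V. Suc (S x) + (if x \<in> X then 1 else 0))"
    using S' X(1) by (intro sum.cong) auto
  also have "\<dots> = (\<Sum>x\<in>V. Suc (S x)) + (\<Sum>x\<in>V. if x \<in> X then 1 else 0)"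
    by (rule sum.distrib)
  also have "(\<Sum>x\<in>V. if x \<in> X then 1 else 0) = card X"
    using XV finite_V by (simp add: sum.If_cases Int_absorb1)
  finally have sum: "D * (\<Sum>x\<in>V. Suc (S' x)) = D * (\<Sum>x\<in>V. Suc (S x)) + D * card X"
    by (simp add: algebra_simps)
  \<comment> \<open>Twice the weight of \<open>X\<close> is at most the weight of the finished
    round: one copy pays for the new records, the other is the weight of the next round.\<close>
  have "D * card X \<le> sum wt X"
    using sum_bounded_below[of X D wt] D XV by (auto simp: mult.commute)
  then have 5: "D * (\<Sum>x\<in>V. Suc (S' x)) + sum wt {x \<in> V. S' x = Suc j} \<le> D * card V + sum wt V"
    unfolding sum X_eq using X scale unfolding scale_inv_def by linarith
  show ?thesis unfolding scale_inv_def using 1 2 3 4 5 by blast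
qed

text \<open>When no vertex is left for round \<open>j\<close>, no home can be \<open>j\<close> and
  the rows from \<open>j\<close> on are empty, so the statements restricted to earlier rounds cover
  all vertices and all rows.\<close>

lemma scale_done:
  assumes "scale_inv r R D j S H dp pr rt" "{x \<in> V. S x = j} = {}"
  shows "scale_ok r R S H dp pr rt"
proof -
  have *: "S x < j" "H x \<le> S x" if "x \<in> V" for x
    using assms that unfolding scale_inv_def by (auto simp: le_less)
  have "row_ok S R dp pr rt i" for i
  proof (cases "i < j")
    case False
    then have "\<not> i \<le> S x" if "x \<in> V" for x using *[OF that] by simp
    then show ?thesis by (simp add: row_ok_def)
  qed (use assms in \<open>auto simp: scale_inv_def\<close>)
  then show ?thesis using assms * unfolding scale_inv_def scale_ok_def
    by (meson le_less_trans)
qed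

end

section \<open>The query program\<close>

abbreviation Plus (infixl "\<oplus>" 65) where "a \<oplus> b \<equiv> Bin Add a b"
abbreviation Minus (infixl "\<ominus>" 65) where "a \<ominus> b \<equiv> Bin Sub a b"
abbreviation Times (infixl "\<otimes>" 70) where "a \<otimes> b \<equiv> Bin Mul a b"
abbreviation Quot (infixl "\<oslash>" 70) where "a \<oslash> b \<equiv> Bin Div a b"

text \<open>Equality has to be tested with \<open><\<close>; the exclusive or of two words is
  positive exactly if they differ, and it cannot overflow. The branches change places, since the
  comparison succeeds on inequality.\<close>

abbreviation If_eq :: "aexp \<Rightarrow> aexp \<Rightarrow> com \<Rightarrow> com \<Rightarrow> com" where
  "If_eq e f c d \<equiv> Cond (Lit 0) (Bin Bxor e f) d c"

lemma xor_pos_iff [simp]: "0 < xor (a :: nat) b \<longleftrightarrow> a \<noteq> b"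
proof -
  have "a = b" if "xor a b = 0"
    using that by (intro bit_eqI) (metis bit_0_eq bit_xor_iff bot_apply bot_bool_def)
  then show ?thesis by auto
qed

lemma mod_self_iff [simp]: "(a :: nat) mod 2 ^ w = a \<longleftrightarrow> a < 2 ^ w"
  by (simp add: mod_eq_self_iff_div_eq_0 div_eq_0_iff)

lemma sub_mod [simp]: "b \<le> a \<Longrightarrow> a < 2 ^ w \<Longrightarrow> (a + 2 ^ w - b) mod 2 ^ w = (a :: nat) - b"
proof -
  assume "b \<le> a" "a < 2 ^ w"
  then have eq: "a + 2 ^ w - b = (a - b) + 2 ^ w" and less: "a - b < 2 ^ w" by auto
  show ?thesis unfolding eq using less by (simp only: mod_add_self2 mod_less)
qed

section \<open>The meeting of two climbs in a tree\<close>

context weighted_graph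
begin

text \<open>\<open>xs\<close> and \<open>ys\<close> are the vertices passed on the way up from
  \<open>u\<close> and \<open>v\<close>, and \<open>x\<close>, \<open>y\<close> the current
  positions. The deeper one moves, the left one in case of a tie. This asymmetry shows in the depth
  conditions, which are strict for \<open>ys\<close> but not for \<open>xs\<close>; they keep the
  two traces disjoint, so that no vertex is reported twice.\<close>

definition climb :: "nat set \<Rightarrow> (nat \<Rightarrow> nat) \<Rightarrow> (nat \<Rightarrow> nat) \<Rightarrow> nat \<Rightarrow> nat \<Rightarrow>
    nat list \<Rightarrow> nat list \<Rightarrow> nat \<Rightarrow> nat \<Rightarrow> bool" where
  "climb X dp rt u v xs ys x y \<longleftrightarrow> x \<in> X \<and> y \<in> X \<and> rt x = rt y \<and>
     hd (xs @ [x]) = u \<and> hd (ys @ [y]) = v \<and>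
     successively (\<lambda>a b. b \<in> nbr a) (xs @ [x]) \<and> successively (\<lambda>a b. b \<in> nbr a) (ys @ [y]) \<and>
     set xs \<union> set ys \<subseteq> X \<and> distinct xs \<and> distinct ys \<and> set xs \<inter> set ys = {} \<and>
     (\<forall>z\<in>set xs. dp x < dp z \<and> dp y \<le> dp z \<and> z \<noteq> y) \<and>
     (\<forall>z\<in>set ys. dp y < dp z \<and> dp x < dp z) \<and>
     length xs + dp x = dp u \<and> length ys + dp y = dp v"

lemma climb_init: "u \<in> X \<Longrightarrow> v \<in> X \<Longrightarrow> rt u = rt v \<Longrightarrow> climb X dp rt u v [] [] u v"
  by (simp add: climb_def)

lemma hd_snoc_eq: "hd (xs @ [x, y]) = hd (xs @ [x])"
  by (cases xs) auto

lemma successively_snoc_snoc: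
  "successively P (xs @ [x, y]) \<longleftrightarrow> successively P (xs @ [x]) \<and> P x y"
  by (auto simp: successively_append_iff)

text \<open>The left vertex can move: at depth zero, \<open>y\<close> would have depth zero as well,
  both would be the root of the same tree, and they would have met.\<close>

lemma climb_left:
  assumes tree: "\<forall>x\<in>X. tree_node X R dp pr rt x" and "climb X dp rt u v xs ys x y"
    and "x \<noteq> y" "\<not> dp x < dp y"
  shows "0 < dp x \<and> pr x \<in> X \<and> Suc (dp (pr x)) = dp x \<and> climb X dp rt u v (xs @ [x]) ys (pr x) y"
proof -
  have x: "x \<in> X" "y \<in> X" "rt x = rt y" using assms(2) by (auto simp: climb_def)
  have pos: "0 < dp x"
  proof (rule ccontr)
    assume "\<not> 0 < dp x"
    then have "rt x = x" "rt y = y" using assms x by (auto simp: tree_node_def)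
    then show False using assms x by simp
  qed
  then have p: "pr x \<in> X" "rt (pr x) = rt x" "Suc (dp (pr x)) = dp x" "pr x \<in> nbr x"
    using tree x by (auto simp: tree_node_def)
  then have "climb X dp rt u v (xs @ [x]) ys (pr x) y"
    using assms(2-4) x unfolding climb_def
    by (auto simp: hd_snoc_eq successively_snoc_snoc)
  then show ?thesis using p pos by simp
qed

lemma climb_right:
  assumes tree: "\<forall>x\<in>X. tree_node X R dp pr rt x" and "climb X dp rt u v xs ys x y"
    and "dp x < dp y"
  shows "pr y \<in> X \<and> Suc (dp (pr y)) = dp y \<and> climb X dp rt u v xs (ys @ [y]) x (pr y)"
proof -
  have x: "y \<in> X" using assms(2) by (auto simp: climb_def)
  then have p: "pr y \<in> X" "rt (pr y) = rt y" "Suc (dp (pr y)) = dp y" "pr y \<in> nbr y"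
    using tree assms(3) by (auto simp: tree_node_def)
  have "climb X dp rt u v xs (ys @ [y]) x (pr y)"
    using assms(2,3) x p unfolding climb_def
    by (auto simp: hd_snoc_eq successively_snoc_snoc)
  then show ?thesis using p by simp
qed

lemma climb_end:
  assumes "climb X dp rt u v xs ys x x" and E: "\<And>x y. y \<in> nbr x \<longleftrightarrow> {x, y} \<in> E"
  shows "is_path E u (xs @ x # rev ys) v"
proof -
  have 1: "successively (\<lambda>a b. {a, b} \<in> E) (xs @ [x])" "successively (\<lambda>a b. {a, b} \<in> E) (ys @ [x])"
    using assms(1) unfolding climb_def by (auto simp: E)
  then have "successively (\<lambda>a b. {a, b} \<in> E) (rev (ys @ [x]))"
    unfolding successively_rev by (simp add: insert_commute)
  then have "successively (\<lambda>a b. {a, b} \<in> E) (xs @ x # rev ys)"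
    using 1(1) by (auto simp: successively_append_iff)
  moreover have "hd (xs @ x # rev ys) = u" "last (xs @ x # rev ys) = v"
    using assms(1) unfolding climb_def by (cases xs; cases ys; auto simp: last_rev)+
  moreover have "distinct (xs @ x # rev ys)"
    using assms(1) unfolding climb_def by auto
  ultimately show ?thesis by (simp add: is_path_def)
qed

lemma walk_of_path:
  assumes E: "\<And>x y. y \<in> nbr x \<longleftrightarrow> {x, y} \<in> E"
  shows "P \<noteq> [] \<Longrightarrow> successively (\<lambda>a b. {a, b} \<in> E) P \<Longrightarrow> walk (length P - 1) (hd P) (last P)"
proof (induction P rule: rev_induct)
  case (snoc y P)
  show ?case
  proof (cases "P = []")
    case False
    then obtain l where l: "length P = Suc l" by (cases P) auto
    then show ?thesis using snoc False by (auto simp: successively_append_iff E)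
  qed simp
qed simp

end

section \<open>Programs of the query\<close>

text \<open>Asks at the scale in register 6 whether the second vertex lies in the home tree of the
  first and answers in register 9. The home round is compared with the last round of the second
  vertex before its record is read, as there is no record beyond. Registers 7, 8, 10 and 11 keep the
  base, the round and the two record addresses for the climb.\<close>

definition test_com :: com where
  "test_com =
     Asgn 7 (Rd 0 (Lit 2 \<oplus> Reg 6)) ;;
     Asgn 12 (Reg 7 \<oplus> Lit 3 \<otimes> Reg 4) ;; Asgn 13 (Reg 7 \<oplus> Lit 3 \<otimes> Reg 5) ;;
     Asgn 8 (Rd 0 (Reg 12 \<oplus> Lit 1)) ;; Asgn 9 (Lit 0) ;;
     Cond (Reg 8) (Rd 0 (Reg 13 \<oplus> Lit 2) \<oplus> Lit 1)
       (Asgn 10 (Rd 0 (Reg 12) \<oplus> Lit 3 \<otimes> Reg 8) ;; Asgn 11 (Rd 0 (Reg 13) \<oplus> Lit 3 \<otimes> Reg 8) ;;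
        If_eq (Rd 0 (Reg 10)) (Rd 0 (Reg 11)) (Asgn 9 (Lit 1)) Skip)
       Skip"

lemma test_com_frame [simp]:
  "assigned test_com = {7, 8, 9, 10, 11, 12, 13}" "written test_com = {}" "silent test_com"
  by (auto simp: test_com_def)

text \<open>Parents are stored as vertices, not as addresses; the record of a parent in the round of
  register 8 is found in constant time through its index and its table.\<close>

abbreviation record_of :: "nat \<Rightarrow> aexp" where
  "record_of x \<equiv> Rd 0 (Reg 7 \<oplus> Lit 3 \<otimes> Rd 0 (Lit 2 \<oplus> Reg 3 \<oplus> Reg x)) \<oplus> Lit 3 \<otimes> Reg 8"

text \<open>The left trace is emitted at once. The right one has to appear in reverse and is kept on
  a stack in array 1; with \<open>W\<close> the length of the structure, that array begins right
  behind it, and the structure in array 0 stays intact.\<close>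

definition climb_com :: com where
  "climb_com =
     Asgn 14 (Rd 0 (Reg 10 \<oplus> Lit 2)) ;; Asgn 15 (Rd 0 (Reg 11 \<oplus> Lit 2)) ;;
     Asgn 12 (Reg 0) ;; Asgn 13 (Reg 1) ;; Asgn 16 (Lit 0) ;;
     While (Lit 0) (Bin Bxor (Reg 12) (Reg 13))
       (Cond (Reg 14) (Reg 15)
          (Wr 1 (Reg 16) (Reg 13) ;; Asgn 16 (Reg 16 \<oplus> Lit 1) ;; Asgn 13 (Rd 0 (Reg 11 \<oplus> Lit 1)) ;;
           Asgn 11 (record_of 13) ;; Asgn 15 (Rd 0 (Reg 11 \<oplus> Lit 2)))
          (Out (Reg 12) ;; Asgn 12 (Rd 0 (Reg 10 \<oplus> Lit 1)) ;;
           Asgn 10 (record_of 12) ;; Asgn 14 (Rd 0 (Reg 10 \<oplus> Lit 2)))) ;;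
     Out (Reg 12) ;;
     While (Lit 0) (Reg 16) (Asgn 16 (Reg 16 \<ominus> Lit 1) ;; Out (Rd 1 (Reg 16)))"

text \<open>Index 0 marks an isolated vertex. The scale \<open>K - 1\<close> is asked before the
  search because its radius is at least \<open>n\<close>: a miss there proves that no path exists,
  and the query stops after constantly many steps, while a hit guarantees that the upward search
  ends.\<close>

definition query_com :: com where
  "query_com =
     If_eq (Reg 0) (Reg 1) (Out (Reg 0))
       (Asgn 3 (Rd 0 (Lit 1)) ;;
        Asgn 4 (Rd 0 (Lit 2 \<oplus> Reg 3 \<oplus> Reg 0)) ;; Asgn 5 (Rd 0 (Lit 2 \<oplus> Reg 3 \<oplus> Reg 1)) ;;
        Cond (Lit 0) (Reg 4) (Cond (Lit 0) (Reg 5)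
          (Asgn 6 (Reg 3 \<ominus> Lit 1) ;; test_com ;;
           Cond (Lit 0) (Reg 9)
             (Asgn 6 (Lit 0) ;; test_com ;;
              While (Reg 9) (Lit 1) (Asgn 6 (Reg 6 \<oplus> Lit 1) ;; test_com) ;;
              climb_com)
             Skip) Skip) Skip)"

text \<open>
  The stored words are the length, \<open>K\<close>, a base address for every scale, one plus the index of every vertex
  among the non-isolated ones (or 0), and for every scale an array of entries followed by tables.
  The entry of a vertex consists of the address of its table and of its home and last
  round; the table lists root, parent and depth of the vertex in the rounds up to the last.
\<close>

definition entry :: "nat \<Rightarrow> (nat \<Rightarrow> nat) \<Rightarrow> nat \<Rightarrow> nat \<Rightarrow> nat" where
  "entry K D i x = D (2 + i) + 3 * D (2 + K + x)"

definition encodes :: "nat \<Rightarrow> nat set \<Rightarrow> nat \<Rightarrow> (nat \<Rightarrow> nat) \<Rightarrow> nat \<Rightarrow> (nat \<Rightarrow> nat) \<Rightarrow> (nat \<Rightarrow> nat) \<Rightarrow>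
    (nat \<Rightarrow> nat \<Rightarrow> nat) \<Rightarrow> (nat \<Rightarrow> nat \<Rightarrow> nat) \<Rightarrow> (nat \<Rightarrow> nat \<Rightarrow> nat) \<Rightarrow> bool" where
  "encodes len V K D i S H dp pr rt \<longleftrightarrow>
     (\<forall>x\<in>V. entry K D i x + 2 < len \<and> D (entry K D i x + 1) = H x \<and> D (entry K D i x + 2) = S x \<and>
        (\<forall>j\<le>S x. D (entry K D i x) + 3 * j + 2 < len \<and>
           D (D (entry K D i x) + 3 * j) = rt j x \<and> D (D (entry K D i x) + 3 * j + 1) = pr j x \<and>
           D (D (entry K D i x) + 3 * j + 2) = dp j x))"

section \<open>Correctness, time and stretch of a query\<close>

text \<open>\<open>W\<close> is now the length of the structure and \<open>D\<close> its contents.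
  By \<open>top\<close> the radius of the last scale is at least \<open>n\<close>, more than the
  length of any path.\<close>

locale stored_oracle = machine w W + weighted_graph V nbr wt
  for w W :: nat and V nbr wt +
  fixes n K b B :: nat and E :: "nat set set" and D :: "nat \<Rightarrow> nat"
    and S H :: "nat \<Rightarrow> nat \<Rightarrow> nat" and dp pr rt :: "nat \<Rightarrow> nat \<Rightarrow> nat \<Rightarrow> nat"
  assumes V_less: "V \<subseteq> {..<n}"
    and nbr_iff: "y \<in> nbr x \<longleftrightarrow> {x, y} \<in> E"
    and E_V: "{x, y} \<in> E \<Longrightarrow> x \<in> V"
    and D1: "D 1 = K" and K_pos: "0 < K" and header: "2 + K + n \<le> W"
    and index: "x < n \<Longrightarrow> 0 < D (2 + K + x) \<longleftrightarrow> x \<in> V"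
    and encoded: "i < K \<Longrightarrow> encodes W V K D i (S i) (H i) (dp i) (pr i) (rt i)"
    and good: "i < K \<Longrightarrow> scale_ok (2 ^ (b * i)) (B * 2 ^ (b * i)) (S i) (H i) (dp i) (pr i) (rt i)"
    and b_pos: "0 < b"
    and top: "n \<le> 2 ^ (b * (K - 1))"
begin

definition hit :: "nat \<Rightarrow> nat \<Rightarrow> nat \<Rightarrow> bool" where
  "hit i u v \<longleftrightarrow> H i u \<le> S i v \<and> rt i (H i u) u = rt i (H i u) v"

definition record_at :: "nat \<Rightarrow> nat \<Rightarrow> nat \<Rightarrow> nat" where
  "record_at i j x = D (entry K D i x) + 3 * j"

lemma entry_facts:
  assumes "i < K" "x \<in> V"
  shows "entry K D i x + 2 < W" "D (Suc (entry K D i x)) = H i x" "D (Suc (Suc (entry K D i x))) = S i x"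
    "H i x \<le> S i x" "x < n"
  using encoded[OF assms(1)] assms(2) good[OF assms(1)] V_less
  by (auto simp: encodes_def scale_ok_def)

lemma record_facts:
  assumes "i < K" "x \<in> V" "j \<le> S i x"
  shows "record_at i j x + 2 < W" "D (record_at i j x) = rt i j x"
    "D (Suc (record_at i j x)) = pr i j x" "D (Suc (Suc (record_at i j x))) = dp i j x"
  using encoded[OF assms(1)] assms(2,3) by (auto simp: encodes_def record_at_def)

lemma test_wp:
  assumes s: "\<And>x. x < W \<Longrightarrow> ar s 0 x = D x" "vr s 4 = D (2 + K + u)" "vr s 5 = D (2 + K + v)"
    and i: "vr s 6 < K" "i = vr s 6" and uv: "u \<in> V" "v \<in> V"
    and Q: "\<And>s'. frame test_com s s' \<Longrightarrow> vr s' 9 = (if hit i u v then 1 else 0) \<Longrightarrow>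
      (hit i u v \<Longrightarrow> vr s' 7 = D (2 + i) \<and> vr s' 8 = H i u \<and> vr s' 10 = record_at i (H i u) u \<and>
         vr s' 11 = record_at i (H i u) v) \<Longrightarrow> Q s' T"
  shows "wp test_com Q s T"
proof -
  note eu = entry_facts[OF i(1) uv(1)] and ev = entry_facts[OF i(1) uv(2)]
  have hu: "H (vr s 6) u \<le> S (vr s 6) u" by (rule eu(4))
  note ru = record_facts[OF i(1) uv(1) hu]
  have rv: "record_at (vr s 6) (H (vr s 6) u) v + 2 < W"
    "D (record_at (vr s 6) (H (vr s 6) u) v) = rt (vr s 6) (H (vr s 6) u) v"
    if "H (vr s 6) u < Suc (S (vr s 6) v)"
    using record_facts[OF i(1) uv(2), of "H (vr s 6) u"] that by auto
  let ?R = "\<lambda>s' T'. T' = T \<and> vr s' 9 = (if hit i u v then 1 else 0) \<and>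
      (hit i u v \<longrightarrow> vr s' 7 = D (2 + i) \<and> vr s' 8 = H i u \<and> vr s' 10 = record_at i (H i u) u \<and>
         vr s' 11 = record_at i (H i u) v)"
  have len: "3 * D (2 + K + u) < W" "3 * D (2 + K + v) < W" "D (2 + vr s 6) < W" "2 + vr s 6 < W"
    using eu(1) ev(1) header i unfolding entry_def by auto
  \<comment> \<open>The program compares with the last round plus one, which has to be a word; the
    number of that round is bounded by the address of its record.\<close>
  have S_less: "S (vr s 6) v + 1 < 2 ^ w"
  proof -
    have "record_at (vr s 6) (S (vr s 6) v) v + 2 < W" by (rule record_facts(1)[OF i(1) uv(2)]) simp
    then show ?thesis using space unfolding record_at_def by linarith
  qed
  have "wp test_com ?R s T"
    using s len eu ev ru rv S_less space i unfolding test_com_def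
    by (auto simp: hit_def entry_def record_at_def)
  then show ?thesis by (rule wp_frame) (use Q in auto)
qed

text \<open>A vertex of the left trace costs one iteration and one of the right trace two, for
  pushing and popping. This gives the budget \<open>dp i j u + 2 * dp i j v\<close> and the
  guarantee that at most twice the length of the output is spent.\<close>

lemma climb_wp:
  assumes i: "i < K" and uv: "u \<in> V" "v \<in> V" and hit: "hit i u v" and j: "j = H i u"
    and s: "\<And>x. x < W \<Longrightarrow> ar s 0 x = D x" "vr s 0 = u" "vr s 1 = v" "vr s 3 = K" "vr s 7 = D (2 + i)"
      "vr s 8 = j" "vr s 10 = record_at i j u" "vr s 11 = record_at i j v" "ou s = []"
    and T: "dp i j u + 2 * dp i j v \<le> T"
  shows "wp climb_com (\<lambda>s' T'. is_path E u (ou s') v \<and> path_length (ou s') \<le> dp i j u + dp i j v \<and>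
    T \<le> T' + 2 * path_length (ou s')) s T"
proof -
  let ?X = "{z \<in> V. j \<le> S i z}"
  let ?d = "dp i j"
  have X: "u \<in> ?X" "v \<in> ?X" "rt i j u = rt i j v"
    using hit uv entry_facts(4)[OF i uv(1)] by (auto simp: hit_def j)
  have tree: "\<forall>x\<in>?X. tree_node ?X (B * 2 ^ (b * i)) ?d (pr i j) (rt i j) x"
    using good[OF i] unfolding scale_ok_def row_ok_def by blast
  have rec: "record_at i j x + 2 < W" "D (record_at i j x) = rt i j x"
    "D (Suc (record_at i j x)) = pr i j x" "D (Suc (Suc (record_at i j x))) = ?d x"
    "entry K D i x + 2 < W" "x < n" if "x \<in> ?X" for x
    using record_facts[OF i, of x j] entry_facts[OF i, of x] that by auto
  \<comment> \<open>The stack holds distinct vertices other than the current one, hence fewer than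
    \<open>n\<close>, and fits into an array.\<close>
  have card_X: "length ys < n" if "climb ?X ?d (rt i j) u v xs ys x y" for xs ys x y
  proof -
    have "y \<in> ?X" "y \<notin> set ys" "distinct ys" "set ys \<subseteq> ?X" using that unfolding climb_def by auto
    then have "distinct (y # ys)" "set (y # ys) \<subseteq> {..<n}" using V_less by auto
    then show ?thesis using card_mono[of "{..<n}" "set (y # ys)"] distinct_card[of "y # ys"] by auto
  qed
  define I where "I = (\<lambda>(s' :: st) T'. \<exists>xs ys. climb ?X ?d (rt i j) u v xs ys (vr s' 12) (vr s' 13) \<and>
      vr s' 10 = record_at i j (vr s' 12) \<and> vr s' 11 = record_at i j (vr s' 13) \<and>
      vr s' 14 = ?d (vr s' 12) \<and> vr s' 15 = ?d (vr s' 13) \<and> ou s' = xs \<and> vr s' 16 = length ys \<and>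
      (\<forall>q<length ys. ar s' 1 q = ys ! q) \<and> T' + length xs + length ys = T)"
  have I_I: "I s' T'" if "climb ?X ?d (rt i j) u v xs ys x y" "vr s' 12 = x" "vr s' 13 = y"
      "vr s' 10 = record_at i j x" "vr s' 11 = record_at i j y"
      "vr s' 14 = ?d x" "vr s' 15 = ?d y" "ou s' = xs" "vr s' 16 = length ys"
      "\<forall>q<length ys. ar s' 1 q = ys ! q" "T' + length xs + length ys = T" for s' T' xs ys x y
    using that unfolding I_def by blast
  let ?w1 = "While (Lit 0) (Bin Bxor (Reg 12) (Reg 13))
       (Cond (Reg 14) (Reg 15)
          (Wr 1 (Reg 16) (Reg 13) ;; Asgn 16 (Reg 16 \<oplus> Lit 1) ;; Asgn 13 (Rd 0 (Reg 11 \<oplus> Lit 1)) ;;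
           Asgn 11 (record_of 13) ;; Asgn 15 (Rd 0 (Reg 11 \<oplus> Lit 2)))
          (Out (Reg 12) ;; Asgn 12 (Rd 0 (Reg 10 \<oplus> Lit 1)) ;;
           Asgn 10 (record_of 12) ;; Asgn 14 (Rd 0 (Reg 10 \<oplus> Lit 2))))"
  let ?w2 = "While (Lit 0) (Reg 16) (Asgn 16 (Reg 16 \<ominus> Lit 1) ;; Out (Rd 1 (Reg 16)))"
  have W1: "1 < (2 :: nat) ^ w" "2 < (2 :: nat) ^ w" "3 < (2 :: nat) ^ w" using rec(1)[OF X(1)] space by auto
  have j3: "3 * j < 2 ^ w" using rec(1)[OF X(1)] space unfolding record_at_def by linarith
  have w1: "wp ?w1 (\<lambda>s' T'. I s' T' \<and> vr s' 12 = vr s' 13) s\<^sub>1 T"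
    if s1: "I s\<^sub>1 T" "\<And>x. x < W \<Longrightarrow> ar s\<^sub>1 0 x = D x" "vr s\<^sub>1 3 = K" "vr s\<^sub>1 7 = D (2 + i)" "vr s\<^sub>1 8 = j"
    for s\<^sub>1
  proof (rule wp_While[where I = I, OF s1(1)], goal_cases)
    case (1 s' T')
    then obtain xs ys where c: "climb ?X ?d (rt i j) u v xs ys (vr s' 12) (vr s' 13)"
      and r: "vr s' 10 = record_at i j (vr s' 12)" "vr s' 11 = record_at i j (vr s' 13)"
        "vr s' 14 = ?d (vr s' 12)" "vr s' 15 = ?d (vr s' 13)" "ou s' = xs" "vr s' 16 = length ys"
        "\<forall>q<length ys. ar s' 1 q = ys ! q" "T' + length xs + length ys = T" unfolding I_def by blast
    have fr: "vr s' 3 = K" "vr s' 7 = D (Suc (Suc i))" "vr s' 8 = j" "x < W \<Longrightarrow> ar s' 0 x = D x" for x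
      using 1(2) s1 by (auto simp: frame_def)
    have cX: "vr s' 12 \<in> ?X" "vr s' 13 \<in> ?X" "length xs + ?d (vr s' 12) = ?d u"
      "length ys + ?d (vr s' 13) = ?d v" using c unfolding climb_def by auto
    note lys = card_X[OF c]
    have step: "0 < T' \<and> wp (Cond (Reg 14) (Reg 15)
          (Wr 1 (Reg 16) (Reg 13) ;; Asgn 16 (Reg 16 \<oplus> Lit 1) ;; Asgn 13 (Rd 0 (Reg 11 \<oplus> Lit 1)) ;;
           Asgn 11 (record_of 13) ;; Asgn 15 (Rd 0 (Reg 11 \<oplus> Lit 2)))
          (Out (Reg 12) ;; Asgn 12 (Rd 0 (Reg 10 \<oplus> Lit 1)) ;;
           Asgn 10 (record_of 12) ;; Asgn 14 (Rd 0 (Reg 10 \<oplus> Lit 2)))) I s' (T' - 1)"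
      if ne: "vr s' 12 \<noteq> vr s' 13"
    proof (cases "?d (vr s' 12) < ?d (vr s' 13)")
      case True
      let ?p = "pr i j (vr s' 13)"
      have p: "?p \<in> ?X" "climb ?X ?d (rt i j) u v xs (ys @ [vr s' 13]) (vr s' 12) ?p"
        using climb_right[OF tree c True] by auto
      have T': "0 < T'" using True cX T r(8) by linarith
      note rx = rec[OF cX(2)] and rp = rec[OF p(1)]
      have e: "D (Suc (Suc i)) + 3 * D (Suc (Suc (K + ?p))) < W" using rp(5) unfolding entry_def by simp
      have e': "D (D (Suc (Suc i)) + 3 * D (Suc (Suc (K + ?p)))) + 3 * j = record_at i j ?p"
        unfolding record_at_def entry_def by simp
      show ?thesis
        using True T' rx(1,6) rp(1,6) e lys header W1 space r(8) j3
        by (simp add: fr r(1-7) rx(2-4) rp(2-4) e')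
          (rule I_I[OF p(2)]; simp add: nth_append less_Suc_eq r(1-7) r(7)[unfolded One_nat_def])
    next
      case False
      let ?p = "pr i j (vr s' 12)"
      have p: "?p \<in> ?X" "0 < ?d (vr s' 12)" "climb ?X ?d (rt i j) u v (xs @ [vr s' 12]) ys ?p (vr s' 13)"
        using climb_left[OF tree c ne False] by auto
      have T': "0 < T'" using p(2) cX T r(8) by linarith
      note rx = rec[OF cX(1)] and rp = rec[OF p(1)]
      have e: "D (Suc (Suc i)) + 3 * D (Suc (Suc (K + ?p))) < W" using rp(5) unfolding entry_def by simp
      have e': "D (D (Suc (Suc i)) + 3 * D (Suc (Suc (K + ?p)))) + 3 * j = record_at i j ?p"
        unfolding record_at_def entry_def by simp
      show ?thesis
        using False T' rx(1,6) rp(1,6) e header W1 space r(8) j3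
        by (simp add: fr r(1-7) rx(2-4) rp(2-4) e') (rule I_I[OF p(3)]; simp add: r(1-7) r(7)[unfolded One_nat_def])
    qed
    have "ok (Lit 0) s'" "ok (Bin Bxor (Reg 12) (Reg 13)) s'"
      "aval (Lit 0) s' < aval (Bin Bxor (Reg 12) (Reg 13)) s' \<longleftrightarrow> vr s' 12 \<noteq> vr s' 13" by simp_all
    then show ?case using step by blast
  next
    case (2 s' T')
    then show ?case by simp
  qed
  have w2: "wp ?w2 (\<lambda>s' T'. ou s' = xs @ rev ys \<and> T' + length ys = T\<^sub>2) s\<^sub>2 T\<^sub>2"
    if s2: "vr s\<^sub>2 16 = length ys" "\<forall>q<length ys. ar s\<^sub>2 1 q = ys ! q" "ou s\<^sub>2 = xs" "length ys \<le> T\<^sub>2"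
      "length ys < n" for s\<^sub>2 T\<^sub>2 xs ys
  proof (rule wp_While[where I = "\<lambda>s' T'. vr s' 16 \<le> length ys \<and> ou s' = xs @ rev (drop (vr s' 16) ys) \<and>
        T' + length ys = T\<^sub>2 + vr s' 16"], goal_cases)
    case 1
    then show ?case using s2 by simp
  next
    case (2 s' T')
    have ar: "ar s' 1 = ar s\<^sub>2 1" using 2(2) by (simp add: frame_def)
    show ?case
    proof (cases "vr s' 16")
      case (Suc m)
      then have "drop m ys = ys ! m # drop (Suc m) ys" using 2 by (simp add: Cons_nth_drop_Suc)
      then show ?thesis using 2(1) Suc ar s2 W1 header space by auto
    qed (use 2 W1 in auto)
  next
    case (3 s' T')
    then show ?case by auto
  qed
  note eu = rec[OF X(1)] and ev = rec[OF X(2)]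
  have "wp (?w1 ;; Out (Reg 12) ;; ?w2) (\<lambda>s' T'. is_path E u (ou s') v \<and>
      path_length (ou s') \<le> ?d u + ?d v \<and> T \<le> T' + 2 * path_length (ou s')) s\<^sub>1 T"
    if s1: "I s\<^sub>1 T" "\<And>x. x < W \<Longrightarrow> ar s\<^sub>1 0 x = D x" "vr s\<^sub>1 3 = K" "vr s\<^sub>1 7 = D (2 + i)" "vr s\<^sub>1 8 = j"
    for s\<^sub>1
    unfolding wp_Seq
  proof (rule wp_mono[OF w1[OF s1]])
    fix s' T' assume "I s' T' \<and> vr s' 12 = vr s' 13"
    then have inv: "I s' T'" and eq: "vr s' 13 = vr s' 12" by auto
    from inv obtain xs ys where c0: "climb ?X ?d (rt i j) u v xs ys (vr s' 12) (vr s' 13)"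
      and r: "ou s' = xs" "vr s' 16 = length ys"
        "\<forall>q<length ys. ar s' 1 q = ys ! q" "T' + length xs + length ys = T" unfolding I_def by blast
    note c = c0[unfolded eq]
    have len: "length xs + ?d (vr s' 12) = ?d u" "length ys + ?d (vr s' 12) = ?d v"
      using c unfolding climb_def by auto
    have "length ys \<le> T'" using len T r(4) by linarith
    then have "wp ?w2 (\<lambda>s'' T''. ou s'' = (xs @ [vr s' 12]) @ rev ys \<and> T'' + length ys = T')
        (s'\<lparr>ou := ou s' @ [vr s' 12]\<rparr>) T'"
      by (intro w2) (use r card_X[OF c] in auto)
    then have "wp ?w2 (\<lambda>s' T'. is_path E u (ou s') v \<and>
      path_length (ou s') \<le> ?d u + ?d v \<and> T \<le> T' + 2 * path_length (ou s'))
        (s'\<lparr>ou := ou s' @ [vr s' 12]\<rparr>) T'"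
      by (rule wp_mono) (use climb_end[OF c nbr_iff] r len in \<open>auto simp: path_length_def\<close>)
    then show "wp (Out (Reg 12)) (wp ?w2 (\<lambda>s' T'. is_path E u (ou s') v \<and>
      path_length (ou s') \<le> ?d u + ?d v \<and> T \<le> T' + 2 * path_length (ou s'))) s' T'" by simp
  qed
  note main = this
  show ?thesis
    unfolding climb_com_def wp_Seq wp_Asgn
    by (intro conjI main[unfolded wp_Seq])
      (use s eu ev W1 space I_I[OF climb_init[OF X]] in simp_all)
qed

lemma path_subset_V:
  "successively (\<lambda>a b. {a, b} \<in> E) P \<Longrightarrow> P \<noteq> [] \<Longrightarrow> hd P \<in> V \<Longrightarrow> set P \<subseteq> V"
proof (induction P)
  case (Cons x P)
  show ?case
  proof (cases P)
    case (Cons y Q)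
    then have "{y, x} \<in> E" using Cons.prems by (simp add: insert_commute)
    then show ?thesis using Cons.IH Cons.prems E_V Cons by auto
  qed (use Cons.prems in simp)
qed simp

lemma path_facts:
  assumes "is_path E u P v" "u \<noteq> v"
  shows "u \<in> V" "v \<in> V" "0 < path_length P" "path_length P < n"
proof -
  obtain x y Q where P: "P = x # y # Q"
    using assms unfolding is_path_def by (cases P rule: list.exhaust[case_product list.exhaust]; cases "tl P") auto
  then show u: "u \<in> V" using assms E_V unfolding is_path_def by auto
  then have sub: "set P \<subseteq> V" using assms path_subset_V unfolding is_path_def by blast
  then show "v \<in> V" using assms unfolding is_path_def by auto
  show "0 < path_length P" by (simp add: P path_length_def)
  have "set P \<subseteq> {..<n}" using sub V_less by blast
  then have "card (set P) \<le> n" using card_mono[of "{..<n}" "set P"] by simp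
  then show "path_length P < n"
    using assms distinct_card[of P] unfolding is_path_def P path_length_def by auto
qed

text \<open>The path is a walk, so \<open>v\<close> lies in the ball around \<open>u\<close> with
  the radius of the scale, and this ball lies in the home tree of \<open>u\<close>. It is used in
  the contrapositive: a miss bounds the length of every path between the two vertices from
  below.\<close>

lemma hit_of_path:
  assumes "is_path E u P v" "path_length P \<le> 2 ^ (b * i)" "i < K" "u \<in> V"
  shows "hit i u v"
proof -
  have "walk (path_length P) u v"
    using assms(1) walk_of_path[OF nbr_iff, of P] unfolding is_path_def path_length_def by auto
  then have "v \<in> ball (2 ^ (b * i)) u" using assms(2) by (auto simp: ball_def)
  then have "H i u \<le> S i v" "rt i (H i u) v = rt i (H i u) u"
    using good[OF assms(3)] assms(4) unfolding scale_ok_def by blast+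
  then show ?thesis by (simp add: hit_def)
qed

lemma graph_dist_path:
  "is_path E u P v \<Longrightarrow> \<exists>Q. is_path E u Q v \<and> path_length Q = graph_dist E u v"
  unfolding graph_dist_def by (rule LeastI_ex) blast

text \<open>The number \<open>l\<close> of missed scales is kept apart from the cost of the climb;
  only the caller charges it to the path length, through the meaning of a miss.\<close>

lemma query_search:
  assumes uv: "u \<in> V" "v \<in> V" "u \<noteq> v" and l: "l = (LEAST i. hit i u v)" "hit (K - 1) u v"
    and s: "\<And>x. x < W \<Longrightarrow> ar s 0 x = D x" "vr s 0 = u" "vr s 1 = v" "vr s 3 = K"
      "vr s 4 = D (2 + K + u)" "vr s 5 = D (2 + K + v)" "ou s = []"
    and T: "T = l + (dp l (H l u) u + 2 * dp l (H l u) v)"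
  shows "wp (Asgn 6 (Lit 0) ;; test_com ;; While (Reg 9) (Lit 1) (Asgn 6 (Reg 6 \<oplus> Lit 1) ;; test_com) ;;
      climb_com)
    (\<lambda>s' T'. is_path E u (ou s') v \<and> path_length (ou s') \<le> dp l (H l u) u + dp l (H l u) v \<and>
      T \<le> T' + l + 2 * path_length (ou s')) s T"
proof -
  have hit_l: "hit l u v" unfolding l(1) by (rule LeastI[of "\<lambda>i. hit i u v" "K - 1", OF l(2)])
  have l_le: "l \<le> i" if "hit i u v" for i unfolding l(1) by (rule Least_le[of "\<lambda>i. hit i u v", OF that])
  have lK: "l < K" using l_le[OF l(2)] K_pos by simp
  define I where "I = (\<lambda>(s' :: st) T'. vr s' 6 \<le> l \<and> T' + vr s' 6 = T \<and>
      vr s' 9 = (if hit (vr s' 6) u v then 1 else 0) \<and>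
      (hit (vr s' 6) u v \<longrightarrow> vr s' 7 = D (2 + vr s' 6) \<and> vr s' 8 = H (vr s' 6) u \<and>
         vr s' 10 = record_at (vr s' 6) (H (vr s' 6) u) u \<and>
         vr s' 11 = record_at (vr s' 6) (H (vr s' 6) u) v))"
  define F where "F = (\<lambda>s' :: st. (\<forall>x<W. ar s' 0 x = D x) \<and> vr s' 0 = u \<and> vr s' 1 = v \<and> vr s' 3 = K \<and>
      vr s' 4 = D (2 + K + u) \<and> vr s' 5 = D (2 + K + v) \<and> ou s' = [])"
  have F_frame: "F s''" if "F s'" "frame test_com s' s''" for s' s''
    using that by (auto simp: F_def frame_def)
  have test: "wp test_com (\<lambda>s' T'. I s' T' \<and> F s') s' T'"
    if "F s'" "vr s' 6 \<le> l" "T' + vr s' 6 = T" for s' T'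
    by (rule test_wp[of s' u v "vr s' 6"])
      (use that F_frame lK uv in \<open>auto simp: I_def F_def frame_def\<close>)
  have W1: "1 < (2 :: nat) ^ w" "K < 2 ^ w" using header space K_pos by auto
  have loop: "wp (While (Reg 9) (Lit 1) (Asgn 6 (Reg 6 \<oplus> Lit 1) ;; test_com))
      (\<lambda>s' T'. I s' T' \<and> F s' \<and> vr s' 6 = l) s' T'" if "I s' T'" "F s'" for s' T'
  proof (rule wp_While[where I = "\<lambda>s' T'. I s' T' \<and> F s'"], goal_cases)
    case 1
    then show ?case using that by simp
  next
    case (2 s' T')
    then have I: "I s' T'" and F: "F s'" by auto
    have "0 < T' \<and> wp (Asgn 6 (Reg 6 \<oplus> Lit 1) ;; test_com) (\<lambda>s' T'. I s' T' \<and> F s') s' (T' - 1)"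
      if "vr s' 9 < 1"
    proof -
      have "\<not> hit (vr s' 6) u v" using I that unfolding I_def by auto
      then have lt: "vr s' 6 < l" using I hit_l unfolding I_def by (metis le_less)
      then have T': "0 < T'" "T' - 1 + (vr s' 6 + 1) = T" using I T unfolding I_def by auto
      have "wp test_com (\<lambda>s' T'. I s' T' \<and> F s') (s'\<lparr>vr := (vr s')(6 := vr s' 6 + 1)\<rparr>) (T' - 1)"
        by (rule test) (use F lt T' in \<open>auto simp: F_def\<close>)
      then show ?thesis using T' lt lK W1 by (simp del: One_nat_def)
    qed
    then show ?case using W1 by simp
  next
    case (3 s' T')
    then have "hit (vr s' 6) u v" "vr s' 6 \<le> l" unfolding I_def by (auto split: if_splits)
    then show ?case using 3(1) l_le[of "vr s' 6"] by auto
  qed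
  have climb: "wp climb_com (\<lambda>s' T'. is_path E u (ou s') v \<and>
      path_length (ou s') \<le> dp l (H l u) u + dp l (H l u) v \<and>
      T \<le> T' + l + 2 * path_length (ou s')) s' T'" if "I s' T' \<and> F s' \<and> vr s' 6 = l" for s' T'
  proof -
    have "wp climb_com (\<lambda>s' T''. is_path E u (ou s') v \<and>
        path_length (ou s') \<le> dp l (H l u) u + dp l (H l u) v \<and>
        T' \<le> T'' + 2 * path_length (ou s')) s' T'"
      by (rule climb_wp[OF lK uv(1,2) hit_l refl])
        (use that hit_l T in \<open>auto simp: I_def F_def\<close>)
    then show ?thesis by (rule wp_mono) (use that in \<open>auto simp: I_def\<close>)
  qed
  have "wp test_com (wp (While (Reg 9) (Lit 1) (Asgn 6 (Reg 6 \<oplus> Lit 1) ;; test_com))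
      (wp climb_com (\<lambda>s' T'. is_path E u (ou s') v \<and>
        path_length (ou s') \<le> dp l (H l u) u + dp l (H l u) v \<and>
        T \<le> T' + l + 2 * path_length (ou s')))) (s\<lparr>vr := (vr s)(6 := 0)\<rparr>) T"
  proof (rule wp_mono[OF test])
    show "F (s\<lparr>vr := (vr s)(6 := 0)\<rparr>)" using s unfolding F_def by simp
    fix s' T' assume "I s' T' \<and> F s'"
    then show "wp (While (Reg 9) (Lit 1) (Asgn 6 (Reg 6 \<oplus> Lit 1) ;; test_com))
      (wp climb_com (\<lambda>s' T'. is_path E u (ou s') v \<and>
        path_length (ou s') \<le> dp l (H l u) u + dp l (H l u) v \<and>
        T \<le> T' + l + 2 * path_length (ou s'))) s' T'"
      by (intro wp_mono[OF loop climb]) auto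
  qed simp_all
  then show ?thesis unfolding wp_Seq wp_Asgn by simp
qed

text \<open>If \<open>l\<close> is the first scale with a hit, the output has at most
  \<open>2 * B * 2 ^ (b * l)\<close> edges, while the miss at \<open>l - 1\<close> makes every path
  longer than \<open>2 ^ (b * (l - 1))\<close>; the quotient is the stretch. Applied to the output
  itself, the same miss bounds \<open>l\<close> by its length, so that search and climb together
  take at most three iterations per edge.\<close>

lemma query_exec:
  assumes uv: "u < n" "v < n"
    and s: "\<And>x. x < W \<Longrightarrow> ar s 0 x = D x" "vr s 0 = u" "vr s 1 = v" "ou s = []"
  shows "\<exists>t s'. exec query_com s t s' \<and> t \<le> 3 * path_length (ou s') \<and>
    (if \<exists>P. is_path E u P v
     then is_path E u (ou s') v \<and> path_length (ou s') \<le> 2 ^ b * (2 * B) * graph_dist E u v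
     else ou s' = [])"
proof -
  let ?post = "\<lambda>s' t. t \<le> 3 * path_length (ou s') \<and>
    (if \<exists>P. is_path E u P v
     then is_path E u (ou s') v \<and> path_length (ou s') \<le> 2 ^ b * (2 * B) * graph_dist E u v
     else ou s' = [])"
  have W1: "1 < (2 :: nat) ^ w" "K < 2 ^ w" "3 < (2 :: nat) ^ w" using header space K_pos by auto
  have "\<exists>T. wp query_com (\<lambda>s' T'. ?post s' (T - T')) s T"
  proof (cases "u = v")
    case True
    have "is_path E v [v] v" by (simp add: is_path_def)
    then have "wp query_com (\<lambda>s' T'. ?post s' (0 - T')) s 0"
      unfolding query_com_def using True s W1 by (auto simp: path_length_def)
    then show ?thesis by blast
  next
    case False
    let ?s = "s\<lparr>vr := (vr s)(3 := K, 4 := D (2 + K + u), 5 := D (2 + K + v))\<rparr>"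
    let ?search = "Asgn 6 (Lit 0) ;; test_com ;;
      While (Reg 9) (Lit 1) (Asgn 6 (Reg 6 \<oplus> Lit 1) ;; test_com) ;; climb_com"
    let ?main = "Asgn 6 (Reg 3 \<ominus> Lit 1) ;; test_com ;; Cond (Lit 0) (Reg 9) ?search Skip"
    have addr: "2 + K + u < W" "2 + K + v < W" "1 < W" using uv header by auto
    have "wp (If_eq (Reg 0) (Reg 1) (Out (Reg 0))
       (Asgn 3 (Rd 0 (Lit 1)) ;;
        Asgn 4 (Rd 0 (Lit 2 \<oplus> Reg 3 \<oplus> Reg 0)) ;; Asgn 5 (Rd 0 (Lit 2 \<oplus> Reg 3 \<oplus> Reg 1)) ;;
        Cond (Lit 0) (Reg 4) (Cond (Lit 0) (Reg 5) c Skip) Skip)) Q s T \<longleftrightarrow>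
        (if u \<in> V \<and> v \<in> V then wp c Q ?s T else Q ?s T)" for c Q T
    proof -
      have D: "D (Suc 0) = K" "0 < D (Suc (Suc (K + u))) \<longleftrightarrow> u \<in> V" "0 < D (Suc (Suc (K + v))) \<longleftrightarrow> v \<in> V"
        using D1 index[OF uv(1)] index[OF uv(2)] by simp_all
      show ?thesis using False addr space W1 by (simp add: s D s(3)[unfolded One_nat_def])
    qed
    note start = this[of ?main, folded query_com_def]
    show ?thesis
    proof (cases "u \<in> V \<and> v \<in> V")
      case nV: False
      then have "\<not> (\<exists>P. is_path E u P v)" using path_facts False by blast
      then have "wp query_com (\<lambda>s' T'. ?post s' (0 - T')) s 0"
        unfolding start if_not_P[OF nV] using s by simp
      then show ?thesis by blast
    next
      case V: True
      let ?l = "LEAST i. hit i u v"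
      let ?T = "?l + (dp ?l (H ?l u) u + 2 * dp ?l (H ?l u) v)"
      have after: "wp (Cond (Lit 0) (Reg 9) ?search Skip) (\<lambda>s' T'. ?post s' (?T - T')) s' ?T"
        if fr: "frame test_com (?s\<lparr>vr := (vr ?s)(6 := K - 1)\<rparr>) s'"
          and found: "vr s' 9 = (if hit (K - 1) u v then 1 else 0)" for s'
      proof (cases "hit (K - 1) u v")
        case nhit: False
        \<comment> \<open>A path would be shorter than \<open>n\<close>, hence within the radius of
          the last scale.\<close>
        have "\<not> is_path E u P v" for P
        proof
          assume P: "is_path E u P v"
          then have "path_length P \<le> 2 ^ (b * (K - 1))" using path_facts(4)[OF P False] top by linarith
          then show False using hit_of_path[OF P] nhit K_pos V by simp
        qed
        then show ?thesis using found nhit W1 fr s by (simp add: frame_def)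
      next
        case hit: True
        have lK: "?l < K" using Least_le[of "\<lambda>i. hit i u v", OF hit] K_pos by linarith
        have search: "wp ?search (\<lambda>s' T'. is_path E u (ou s') v \<and>
            path_length (ou s') \<le> dp ?l (H ?l u) u + dp ?l (H ?l u) v \<and>
            ?T \<le> T' + ?l + 2 * path_length (ou s')) s' ?T"
          by (rule query_search) (use V False hit fr s in \<open>auto simp: frame_def\<close>)
        have step: "?post s'' (?T - T'')"
          if P: "is_path E u (ou s'') v" and len: "path_length (ou s'') \<le> dp ?l (H ?l u) u + dp ?l (H ?l u) v"
            and T: "?T \<le> T'' + ?l + 2 * path_length (ou s'')" for s'' T''
        proof -
          have far: "2 ^ (b * (?l - 1)) < path_length Q" if Q: "is_path E u Q v" and "0 < ?l" for Q
          proof (rule ccontr)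
            assume "\<not> 2 ^ (b * (?l - 1)) < path_length Q"
            then have "hit (?l - 1) u v" using hit_of_path[OF Q, of "?l - 1"] lK V by simp
            then have "?l \<le> ?l - 1" by (rule Least_le)
            then show False using \<open>0 < ?l\<close> by linarith
          qed
          have "?l \<le> path_length (ou s'')"
          proof (cases "0 < ?l")
            case True
            have "?l - 1 < 2 ^ (?l - 1)" by (rule less_exp)
            also have "\<dots> \<le> (2 :: nat) ^ (b * (?l - 1))" using b_pos by (intro power_increasing) auto
            finally show ?thesis using far[OF P True] by linarith
          qed simp
          then have t: "?T - T'' \<le> 3 * path_length (ou s'')" using T by linarith
          obtain Q where Q: "is_path E u Q v" "path_length Q = graph_dist E u v"
            using graph_dist_path[OF P] by blast
          have hit_l: "hit ?l u v" by (rule LeastI[of "\<lambda>i. hit i u v" "K - 1", OF hit])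
          have row: "row_ok (S ?l) (B * 2 ^ (b * ?l)) (dp ?l) (pr ?l) (rt ?l) (H ?l u)"
            using good[OF lK] unfolding scale_ok_def by blast
          have "dp ?l (H ?l u) u \<le> B * 2 ^ (b * ?l)" "dp ?l (H ?l u) v \<le> B * 2 ^ (b * ?l)"
            using row V hit_l entry_facts(4)[OF lK, of u] unfolding row_ok_def tree_node_def hit_def by auto
          then have "path_length (ou s'') \<le> 2 * B * 2 ^ (b * ?l)" using len by linarith
          also have "\<dots> \<le> 2 * B * (2 ^ b * graph_dist E u v)"
          proof (intro mult_left_mono)
            show "2 ^ (b * ?l) \<le> 2 ^ b * graph_dist E u v"
            proof (cases "0 < ?l")
              case True
              then have "(2 :: nat) ^ (b * ?l) = 2 ^ b * 2 ^ (b * (?l - 1))"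
                by (simp flip: power_add mult_Suc_right)
              then show ?thesis using far[OF Q(1) True] Q(2) by simp
            next
              \<comment> \<open>At the lowest scale there is no earlier miss to appeal to; its
                radius 1 is at most the distance, as the two vertices differ.\<close>
              case z: False
              have "0 < graph_dist E u v" using path_facts(3)[OF Q(1) False] Q(2) by simp
              then have "1 * 1 \<le> 2 ^ b * graph_dist E u v" by (intro mult_le_mono) auto
              then show ?thesis using z by simp
            qed
          qed simp
          finally have "path_length (ou s'') \<le> 2 ^ b * (2 * B) * graph_dist E u v" by (simp add: ac_simps)
          then show ?thesis using t P by auto
        qed
        have "wp ?search (\<lambda>s' T'. ?post s' (?T - T')) s' ?T"
          by (rule wp_mono[OF search]) (elim conjE, rule step)
        then show ?thesis using found hit W1 unfolding wp_Cond by simp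
      qed
      have "wp test_com (wp (Cond (Lit 0) (Reg 9) ?search Skip) (\<lambda>s' T'. ?post s' (?T - T')))
          (?s\<lparr>vr := (vr ?s)(6 := K - 1)\<rparr>) ?T"
      proof (rule test_wp[where u = u and v = v and i = "K - 1"])
        fix s' assume "frame test_com (?s\<lparr>vr := (vr ?s)(6 := K - 1)\<rparr>) s'"
          "vr s' 9 = (if hit (K - 1) u v then 1 else 0)"
        then show "wp (Cond (Lit 0) (Reg 9) ?search Skip) (\<lambda>s' T'. ?post s' (?T - T')) s' ?T"
          by (rule after)
      qed (use s V K_pos in auto)
      then have "wp query_com (\<lambda>s' T'. ?post s' (?T - T')) s ?T"
        unfolding start using V K_pos W1 by (simp del: wp_Cond)
      then show ?thesis by blast
    qed
  qed
  then obtain T t s' where "exec query_com s t s'" "t \<le> T" "?post s' (T - (T - t))"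
    unfolding wp_def by blast
  then show ?thesis by (intro exI[of _ t] exI[of _ s']) simp
qed

end

section \<open>The construction program\<close>

text \<open>
  Registers: 10 is \<open>n\<close>, 15 is \<open>K\<close>, 16 the number of non-isolated vertices, 17 the length of the structure
  so far, 19 the scale \<open>i\<close>, 20 the width \<open>r\<close>, 21 the round \<open>j\<close>, 22 and 23 the number of vertices in this
  and the next round, 24 a position in a list, 25 the centre of the ball, 26 and 27 head and tail of the
  queue, 28 and 29 the weights inside and including the current annulus, 30 and 31 its radii, 37 the
  average degree, 39 is \<open>j n\<close>.

  Arrays: 0 is the input, 1 the structure, 2 the list of non-isolated vertices, 3 the state of a
  vertex (0 carved, 1 waiting, 2 reached), 4 and 5 its last and home round, 6 the lists of the
  vertices of each round, 7 the queue, and 8, 9, 10 contain depths, parents and roots, those of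
  round \<open>j\<close> starting at \<open>j n\<close>.
\<close>

abbreviation weight_of :: "nat \<Rightarrow> aexp" where
  "weight_of x \<equiv> (Rd 0 (Lit 6 \<oplus> Reg x) \<ominus> Rd 0 (Lit 5 \<oplus> Reg x)) \<oplus> Reg 37"

definition visit_com :: com where
  "visit_com =
     Asgn 35 (Rd 0 (Lit 6 \<oplus> Reg 10 \<oplus> Reg 34)) ;;
     If_eq (Rd 3 (Reg 35)) (Lit 1)
       (Wr 3 (Reg 35) (Lit 2) ;; Wr 8 (Reg 39 \<oplus> Reg 35) (Reg 33 \<oplus> Lit 1) ;;
        Wr 9 (Reg 39 \<oplus> Reg 35) (Reg 18) ;; Wr 10 (Reg 39 \<oplus> Reg 35) (Reg 25) ;;
        Wr 7 (Reg 27) (Reg 35) ;; Asgn 27 (Reg 27 \<oplus> Lit 1) ;; Asgn 29 (Reg 29 \<oplus> weight_of 35))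
       Skip ;;
     Asgn 34 (Reg 34 \<oplus> Lit 1)"

definition scan_com :: com where
  "scan_com = While (Reg 34) (Reg 36) visit_com"

definition expand_com :: com where
  "expand_com =
     Asgn 18 (Rd 7 (Reg 26)) ;; Asgn 34 (Rd 0 (Lit 5 \<oplus> Reg 18)) ;; Asgn 36 (Rd 0 (Lit 6 \<oplus> Reg 18)) ;;
     scan_com ;; Asgn 26 (Reg 26 \<oplus> Lit 1)"

text \<open>The ball keeps growing while the annulus adds more than half of the weight inside; in
  integers, three times the inner weight is less than twice the whole. Otherwise register 32 ends
  the growth.\<close>

definition layer_com :: com where
  "layer_com =
     Cond (Lit 3 \<otimes> Reg 28) (Lit 2 \<otimes> Reg 29)
       (Asgn 28 (Reg 29) ;; Asgn 30 (Reg 31) ;; Asgn 31 (Reg 31 \<oplus> Lit 4 \<otimes> Reg 20))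
       (Asgn 32 (Lit 0))"

text \<open>Expanding a vertex and closing an annulus share one loop. An exhausted queue is treated
  as if its head had the outer radius as depth, so that it also leads to the test on the
  annulus.\<close>

definition grow_com :: com where
  "grow_com = While (Lit 0) (Reg 32)
     (Cond (Reg 26) (Reg 27) (Asgn 33 (Rd 8 (Reg 39 \<oplus> Rd 7 (Reg 26)))) (Asgn 33 (Reg 31)) ;;
      Cond (Reg 33) (Reg 31) expand_com layer_com)"

definition seed_com :: com where
  "seed_com =
     Wr 3 (Reg 25) (Lit 2) ;; Wr 8 (Reg 39 \<oplus> Reg 25) (Lit 0) ;; Wr 9 (Reg 39 \<oplus> Reg 25) (Reg 25) ;;
     Wr 10 (Reg 39 \<oplus> Reg 25) (Reg 25) ;; Wr 7 (Lit 0) (Reg 25) ;; Asgn 26 (Lit 0) ;; Asgn 27 (Lit 1) ;;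
     Asgn 29 (weight_of 25) ;; Asgn 28 (Reg 29) ;; Asgn 30 (Lit 0) ;; Asgn 31 (Lit 4 \<otimes> Reg 20) ;;
     Asgn 32 (Lit 1)"

text \<open>A vertex outside the cut returns to waiting and may be reached by several balls of the
  round; the comparison of its last round with the current one keeps it from being listed
  twice.\<close>

definition settle_com :: com where
  "settle_com =
     Asgn 18 (Rd 7 (Reg 40)) ;; Asgn 33 (Rd 8 (Reg 39 \<oplus> Reg 18)) ;;
     Cond (Reg 30 \<oplus> Lit 2 \<otimes> Reg 20) (Reg 33) (Wr 3 (Reg 18) (Lit 1)) (Wr 3 (Reg 18) (Lit 0)) ;;
     Cond (Reg 30) (Reg 33)
       (If_eq (Rd 4 (Reg 18)) (Reg 21)
          (Wr 4 (Reg 18) (Reg 21 \<oplus> Lit 1) ;; Wr 6 (Reg 39 \<oplus> Reg 10 \<oplus> Reg 23) (Reg 18) ;;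
           Asgn 23 (Reg 23 \<oplus> Lit 1))
          Skip)
       Skip ;;
     Cond (Reg 30 \<oplus> Reg 20) (Reg 33)
       (Cond (Reg 30 \<oplus> Lit 3 \<otimes> Reg 20) (Reg 33) Skip
          (If_eq (Rd 5 (Reg 18)) (Reg 21) (Wr 5 (Reg 18) (Reg 21 \<oplus> Lit 1)) Skip))
       Skip ;;
     Asgn 40 (Reg 40 \<oplus> Lit 1)"

definition carve_com :: com where
  "carve_com = seed_com ;; grow_com ;; Asgn 40 (Lit 0) ;; While (Reg 40) (Reg 27) settle_com"

lemma carve_frames [simp]:
  "assigned visit_com = {27, 29, 34, 35}" "written visit_com = {3, 7, 8, 9, 10}" "silent visit_com"
  "assigned scan_com = {27, 29, 34, 35}" "written scan_com = {3, 7, 8, 9, 10}" "silent scan_com"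
  "assigned expand_com = {18, 26, 27, 29, 34, 35, 36}" "written expand_com = {3, 7, 8, 9, 10}" "silent expand_com"
  "assigned layer_com = {28, 30, 31, 32}" "written layer_com = {}" "silent layer_com"
  "assigned grow_com = {18, 26, 27, 28, 29, 30, 31, 32, 33, 34, 35, 36}"
  "written grow_com = {3, 7, 8, 9, 10}" "silent grow_com"
  "assigned seed_com = {26, 27, 28, 29, 30, 31, 32}" "written seed_com = {3, 7, 8, 9, 10}" "silent seed_com"
  "assigned settle_com = {18, 23, 33, 40}" "written settle_com = {3, 4, 5, 6}" "silent settle_com"
  "assigned carve_com = {18, 23, 26, 27, 28, 29, 30, 31, 32, 33, 34, 35, 36, 40}"
  "written carve_com = {3, 4, 5, 6, 7, 8, 9, 10}" "silent carve_com"
  by (auto simp: visit_com_def scan_com_def expand_com_def layer_com_def grow_com_def seed_com_def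
      settle_com_def carve_com_def)

section \<open>Growing and carving one ball\<close>

text \<open>\<open>off\<close> and \<open>nb\<close> are the offsets and the concatenated adjacency
  lists, \<open>tot\<close> is the sum of the degrees, \<open>nv\<close> the number of vertices with
  a neighbour and \<open>D\<close> the average degree rounded down. Rounding costs at most a factor
  of two, recorded in \<open>tot_D\<close>. The arrays are at least quadratic in \<open>n\<close>
  because the records of up to \<open>4 * nv\<close> rounds are kept in rows of length
  \<open>n\<close>.\<close>

locale construction = machine w W + weighted_graph V nbr wt
  for w W :: nat and V nbr wt +
  fixes n tot nv D :: nat and off nb :: "nat \<Rightarrow> nat"
  assumes V_eq: "V = {x. x < n \<and> off x < off (Suc x)}"
    and off_mono: "x < n \<Longrightarrow> off x \<le> off (Suc x)"
    and off_tot: "x \<le> n \<Longrightarrow> off x \<le> tot"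
    and nbr_eq: "x \<in> V \<Longrightarrow> nbr x = nb ` {off x..<off (Suc x)}"
    and wt_eq: "x < n \<Longrightarrow> wt x = off (Suc x) - off x + D"
    and card_V: "card V = nv"
    and D_pos: "0 < nv \<Longrightarrow> 0 < D"
    and nv_D: "nv * D \<le> tot" and tot_D: "tot \<le> 2 * (nv * D)"
    and wt_V: "sum wt V \<le> tot + nv * D"
    and tot_n: "tot \<le> n * n" and n_pos: "0 < n"
    and W_large: "64 * (n + 1) ^ 2 \<le> W"
begin

lemma V_less: "x \<in> V \<Longrightarrow> x < n" "V \<subseteq> {..<n}"
  by (auto simp: V_eq)

lemma wt_pos: "x \<in> V \<Longrightarrow> Suc (off (Suc x) - off x) \<le> wt x" "x \<in> V \<Longrightarrow> D \<le> wt x"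
proof -
  assume x: "x \<in> V"
  then have "0 < nv" using card_V finite_V by (auto simp: card_gt_0_iff)
  then show "Suc (off (Suc x) - off x) \<le> wt x" "D \<le> wt x" using D_pos wt_eq V_less(1)[OF x] by auto
qed

lemma nv_le: "nv \<le> n"
  using card_mono[OF finite_lessThan V_less(2)] card_V by simp

lemma distinct_length_le: "distinct xs \<Longrightarrow> set xs \<subseteq> V \<Longrightarrow> length xs \<le> nv"
  using card_mono[OF finite_V, of "set xs"] by (simp add: distinct_card card_V)

lemma size_bounds: "n < W" "n * n < W" "4 * (n * n) + 10 * n + 10 < W" "sum wt V \<le> 2 * tot" "2 * tot < W"
    "8 * tot < 2 ^ w" "1 < (2 :: nat) ^ w" "x < 64 \<Longrightarrow> x < (2 :: nat) ^ w"
proof -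
  have sq: "(n + 1) ^ 2 = n * n + 2 * n + 1" by (simp add: power2_eq_square)
  have W: "64 * (n * n) + 128 * n + 64 \<le> W" using W_large unfolding sq by simp
  then show 1: "n < W" "n * n < W" "4 * (n * n) + 10 * n + 10 < W" by linarith+
  show "sum wt V \<le> 2 * tot" using wt_V nv_D by linarith
  show "2 * tot < W" "8 * tot < 2 ^ w" using tot_n W space by linarith+
  show "1 < (2 :: nat) ^ w" "x < 64 \<Longrightarrow> x < (2 :: nat) ^ w" using W space by linarith+
qed

lemma sum_wt_le: "X \<subseteq> V \<Longrightarrow> sum wt X \<le> sum wt V"
  using finite_V by (rule sum_mono2) auto

definition env :: "st \<Rightarrow> bool" where
  "env s \<longleftrightarrow> (\<forall>x\<le>n. ar s 0 (5 + x) = off x) \<and> (\<forall>x<n. ar s 0 (6 + x) = off (Suc x)) \<and>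
     (\<forall>a<tot. ar s 0 (6 + n + a) = nb a) \<and> vr s 10 = n \<and> vr s 37 = D"

lemma envD: "env s \<Longrightarrow> x \<le> n \<Longrightarrow> ar s 0 (5 + x) = off x" "env s \<Longrightarrow> x < n \<Longrightarrow> ar s 0 (6 + x) = off (Suc x)"
    "env s \<Longrightarrow> a < tot \<Longrightarrow> ar s 0 (6 + n + a) = nb a" "env s \<Longrightarrow> vr s 10 = n" "env s \<Longrightarrow> vr s 37 = D"
  by (simp_all add: env_def)

lemma env_frame: "env s \<Longrightarrow> frame c s s' \<Longrightarrow> 0 \<notin> written c \<Longrightarrow> {10, 37} \<inter> assigned c = {} \<Longrightarrow> env s'"
  by (auto simp: env_def frame_def)

text \<open>What the search overwrites is compared with the state \<open>s\<^sub>0\<close> before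
  it, so that the rows of earlier rounds and the trees of earlier balls are seen to persist.\<close>

definition queue :: "st \<Rightarrow> nat list \<Rightarrow> st \<Rightarrow> bool" where
  "queue s\<^sub>0 qs s \<longleftrightarrow> vr s 27 = length qs \<and> (\<forall>i<length qs. ar s 7 i = qs ! i) \<and>
     (\<forall>x. ar s 3 x = (if x \<in> set qs then 2 else ar s\<^sub>0 3 x)) \<and> vr s 29 = sum wt (set qs) \<and>
     (\<forall>x\<in>set qs. ar s 10 (vr s 39 + x) = vr s 25) \<and>
     (\<forall>z. z \<notin> (+) (vr s 39) ` set qs \<longrightarrow> ar s 8 z = ar s\<^sub>0 8 z \<and> ar s 9 z = ar s\<^sub>0 9 z \<and> ar s 10 z = ar s\<^sub>0 10 z)"

abbreviation depth :: "st \<Rightarrow> nat \<Rightarrow> nat" where "depth s x \<equiv> ar s 8 (vr s 39 + x)"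
abbreviation parent :: "st \<Rightarrow> nat \<Rightarrow> nat" where "parent s x \<equiv> ar s 9 (vr s 39 + x)"

text \<open>Each entry of the adjacency list takes one iteration, hence exactly the degree is spent.
  New vertices are deeper than \<open>x\<close>, whose depth is at least \<open>lm\<close>;
  therefore the weight within depth \<open>lm\<close> is unchanged.\<close>

lemma scan_wp:
  assumes env: "env s" and A: "A \<subseteq> V" "\<And>x. x \<in> V \<Longrightarrow> ar s\<^sub>0 3 x = 1 \<longleftrightarrow> x \<in> A"
    and q: "queue s\<^sub>0 qs s" and b: "bfs A c lm thr qs h (depth s) (parent s)"
    and h: "h < length qs" "x = qs ! h" "vr s 18 = x" "vr s 33 = depth s x" "depth s x < thr"
    and e: "vr s 34 = off x" "vr s 36 = off (Suc x)" "vr s 39 + n < W" "thr < 2 ^ w"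
    and T: "off (Suc x) - off x \<le> T"
  shows "wp scan_com (\<lambda>s' T'. \<exists>ys. queue s\<^sub>0 (qs @ ys) s' \<and> bfs A c lm thr (qs @ ys) h (depth s') (parent s') \<and>
     nbr x \<inter> A \<subseteq> set (qs @ ys) \<and> T' + (off (Suc x) - off x) = T \<and>
     sum wt {y \<in> set (qs @ ys). depth s' y \<le> lm} = sum wt {y \<in> set qs. depth s y \<le> lm}) s T"
proof -
  have "x \<in> set qs" using h by simp
  then have xV: "x \<in> V" using b A unfolding bfs_def by blast
  note xn = V_less(1)[OF xV]
  define I where "I = (\<lambda>(s' :: st) T'. \<exists>ys. queue s\<^sub>0 (qs @ ys) s' \<and>
      bfs A c lm thr (qs @ ys) h (depth s') (parent s') \<and>
      depth s' x = depth s x \<and> off x \<le> vr s' 34 \<and> vr s' 34 \<le> off (Suc x) \<and>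
      (\<forall>a. off x \<le> a \<and> a < vr s' 34 \<and> nb a \<in> A \<longrightarrow> nb a \<in> set (qs @ ys)) \<and> T' + (vr s' 34 - off x) = T \<and>
     sum wt {y \<in> set (qs @ ys). depth s' y \<le> lm} = sum wt {y \<in> set qs. depth s y \<le> lm})"
  have off_x: "off x < off (Suc x)" "off (Suc x) \<le> tot" using xV off_tot[of "Suc x"] by (auto simp: V_eq)
  show ?thesis unfolding scan_com_def
  proof (rule wp_While[where I = I], goal_cases)
    case 1
    show ?case unfolding I_def by (rule exI[of _ "[]"]) (use q b e T off_x in auto)
  next
    case (2 s' T')
    then obtain ys where q': "queue s\<^sub>0 (qs @ ys) s'" and b': "bfs A c lm thr (qs @ ys) h (depth s') (parent s')"
      and i: "depth s' x = depth s x" "off x \<le> vr s' 34" "vr s' 34 \<le> off (Suc x)"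
        "\<forall>a. off x \<le> a \<and> a < vr s' 34 \<and> nb a \<in> A \<longrightarrow> nb a \<in> set (qs @ ys)" "T' + (vr s' 34 - off x) = T"
        "sum wt {y \<in> set (qs @ ys). depth s' y \<le> lm} = sum wt {y \<in> set qs. depth s y \<le> lm}"
      unfolding I_def by blast
    have fr: "vr s' 10 = n" "vr s' 18 = x" "vr s' 25 = vr s 25" "vr s' 33 = depth s x" "vr s' 36 = off (Suc x)"
      "vr s' 37 = D" "vr s' 39 = vr s 39" "ar s' 0 = ar s 0"
      using 2(2) h e envD(4,5)[OF env] by (auto simp: frame_def)
    let ?y = "nb (vr s' 34)"
    have step: "0 < T' \<and> wp visit_com I s' (T' - 1)" if lt: "vr s' 34 < off (Suc x)"
    proof -
      have T': "0 < T'" "T' - 1 + (vr s' 34 + 1 - off x) = T" using lt i T by auto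
      have yn: "?y \<in> nbr x" using nbr_eq[OF xV] lt i(2) by auto
      then have yV: "?y \<in> V" using nbr_subset xV by blast
      note y_less = V_less(1)[OF yV]
      have a_tot: "vr s' 34 < tot" using lt off_x by simp
      have addr: "6 + n + vr s' 34 < W" "vr s 39 + ?y < W" "?y < W" "6 + ?y < W"
        using a_tot tot_n size_bounds(3) y_less e(3) by linarith+
      have rd: "ar s 0 (6 + n + vr s' 34) = ?y" "ar s 0 (5 + ?y) = off ?y" "ar s 0 (6 + ?y) = off (Suc ?y)"
        using envD(1-3)[OF env] a_tot y_less by auto
      have sub: "set (qs @ ys) \<subseteq> A" and dist: "distinct (qs @ ys)" using b' unfolding bfs_def by auto
      have mark: "ar s' 3 ?y = 1 \<longleftrightarrow> ?y \<in> A \<and> ?y \<notin> set (qs @ ys)"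
        using q' A(2)[OF yV] sub unfolding queue_def by auto
      have mu: "sum wt (set (qs @ ys)) + wt ?y \<le> 2 * tot" if "?y \<notin> set (qs @ ys)"
      proof -
        have "sum wt (set (qs @ ys)) + wt ?y = sum wt (insert ?y (set (qs @ ys)))" using that by simp
        also have "\<dots> \<le> sum wt V" by (rule sum_wt_le) (use sub A yV in auto)
        finally show ?thesis using size_bounds(4) by linarith
      qed
      have len: "length (qs @ ys) \<le> n"
        by (rule le_trans[OF distinct_length_le nv_le]) (use dist sub A in auto)
      show ?thesis
      proof (cases "?y \<in> A \<and> ?y \<notin> set (qs @ ys)")
        case True
        let ?s = "s'\<lparr>ar := (ar s')(3 := (ar s' 3)(?y := 2), 8 := (ar s' 8)(vr s 39 + ?y := Suc (depth s x)),
            9 := (ar s' 9)(vr s 39 + ?y := x), 10 := (ar s' 10)(vr s 39 + ?y := vr s 25),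
            7 := (ar s' 7)(length (qs @ ys) := ?y)),
          vr := (vr s')(35 := ?y, 27 := Suc (length (qs @ ys)), 29 := sum wt (set (qs @ ys)) + wt ?y,
            34 := Suc (vr s' 34))\<rparr>"
        have q27: "vr s' 27 = length (qs @ ys)" and q29: "vr s' 29 = sum wt (set (qs @ ys))"
          using q' unfolding queue_def by auto
        have num: "off ?y \<le> off (Suc ?y)" "off (Suc ?y) < 2 ^ w" "off (Suc ?y) - off ?y + D < 2 ^ w"
            "sum wt (set (qs @ ys)) + (off (Suc ?y) - off ?y + D) < 2 ^ w"
          using off_mono[OF y_less] off_tot[of "Suc ?y"] mu True wt_eq[OF y_less] y_less size_bounds(6)
          by (linarith | auto)+
        have num': "length (qs @ ys) < W" "Suc (depth s x) < 2 ^ w" "Suc (vr s' 34) < 2 ^ w"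
          "6 + n + vr s' 34 < 2 ^ w" "vr s 39 + ?y < 2 ^ w" "6 + ?y < 2 ^ w" "Suc (length (qs @ ys)) < 2 ^ w"
          using len size_bounds(1) h(5) e(4) addr space by linarith+
        have hx: "(qs @ ys) ! h = x" using h by (simp add: nth_append)
        have dp: "depth ?s = (depth s')(?y := Suc (depth s' x))" "parent ?s = (parent s')(?y := x)"
          using fr i(1) by auto
        have "bfs A c lm thr ((qs @ ys) @ [?y]) h (depth ?s) (parent ?s)"
          unfolding dp using bfs_push[OF b', of ?y] True yn h i(1) hx by simp
        moreover have "queue s\<^sub>0 ((qs @ ys) @ [?y]) ?s"
          using q' True fr unfolding queue_def by (auto simp: nth_append less_Suc_eq)
        moreover have "{y \<in> set ((qs @ ys) @ [?y]). depth ?s y \<le> lm} = {y \<in> set (qs @ ys). depth s' y \<le> lm}"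
        proof -
          have "lm \<le> depth s' x" using b' hx h(1) unfolding bfs_def by force
          then have "lm \<le> depth s x" using i(1) by simp
          then show ?thesis using True by (auto simp: fr)
        qed
        moreover have "x \<noteq> ?y" using True \<open>x \<in> set qs\<close> by auto
        then have "depth ?s x = depth s x" using i(1) by (simp add: fr)
        moreover have "\<forall>a. off x \<le> a \<and> a < vr ?s 34 \<and> nb a \<in> A \<longrightarrow> nb a \<in> set ((qs @ ys) @ [?y])"
          using i(4) by (auto simp: less_Suc_eq)
        ultimately have "I ?s (T' - 1)"
          unfolding I_def using i T' lt by (intro exI[of _ "ys @ [?y]"]) auto
        moreover have "wp visit_com I s' (T' - 1) \<longleftrightarrow> I ?s (T' - 1)"
          using True mark addr num num' size_bounds(7) wt_eq[OF y_less]
          by (simp add: visit_com_def fr rd q27 q29 size_bounds(8))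
        ultimately show ?thesis using T' by simp
      next
        case False
        let ?s = "s'\<lparr>vr := (vr s')(35 := ?y, 34 := Suc (vr s' 34))\<rparr>"
        have "I ?s (T' - 1)"
          unfolding I_def using i q' b' T' lt False fr
          by (intro exI[of _ ys]) (auto simp: queue_def less_Suc_eq)
        moreover have "6 + n + vr s' 34 < 2 ^ w" "Suc (vr s' 34) < 2 ^ w" using addr space by linarith+
        then have "wp visit_com I s' (T' - 1) \<longleftrightarrow> I ?s (T' - 1)"
          using False mark addr size_bounds(7)
          by (simp add: visit_com_def fr rd size_bounds(8))
        ultimately show ?thesis using T' by simp
      qed
    qed
    then show ?case using fr by simp
  next
    case (3 s' T')
    then obtain ys where r: "queue s\<^sub>0 (qs @ ys) s'" "bfs A c lm thr (qs @ ys) h (depth s') (parent s')"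
        "depth s' x = depth s x" "off x \<le> vr s' 34" "vr s' 34 \<le> off (Suc x)"
        "\<forall>a. off x \<le> a \<and> a < vr s' 34 \<and> nb a \<in> A \<longrightarrow> nb a \<in> set (qs @ ys)" "T' + (vr s' 34 - off x) = T"
        "sum wt {y \<in> set (qs @ ys). depth s' y \<le> lm} = sum wt {y \<in> set qs. depth s y \<le> lm}"
      unfolding I_def by blast
    have eq: "vr s' 34 = off (Suc x)" using 3 r(5) e by (simp add: frame_def)
    then have "nbr x \<inter> A \<subseteq> set (qs @ ys)" using r(6) nbr_eq[OF xV] by auto
    then show ?case using r eq by auto
  qed
qed

text \<open>Expanding a vertex is paid for by its weight, closing an annulus by \<open>g\<close>,
  the number of annuli so far; and \<open>g\<close> itself is at most the inner weight, as every
  annulus adds some. The inequality with \<open>3 ^ g\<close> and \<open>2 ^ g\<close> is growth by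
  half per annulus, starting from a weight of at least \<open>D\<close>.\<close>

definition growing :: "nat \<Rightarrow> nat \<Rightarrow> nat set \<Rightarrow> nat \<Rightarrow> nat \<Rightarrow> st \<Rightarrow> nat list \<Rightarrow> nat \<Rightarrow> st \<Rightarrow> nat \<Rightarrow> bool" where
  "growing T\<^sub>0 r A c jj s\<^sub>0 qs g s T \<longleftrightarrow> queue s\<^sub>0 qs s \<and>
     bfs A c (vr s 30) (vr s 31) qs (vr s 26) (depth s) (parent s) \<and> vr s 31 = vr s 30 + 4 * r \<and>
     vr s 28 = sum wt {y \<in> set qs. depth s y \<le> vr s 30} \<and> vr s 30 = 4 * r * g \<and>
     3 ^ g * D \<le> 2 ^ g * vr s 28 \<and> g \<le> vr s 28 \<and> vr s 32 \<le> 1 \<and>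
     (vr s 32 = 0 \<longrightarrow> (vr s 26 < length qs \<longrightarrow> vr s 31 \<le> depth s (qs ! vr s 26)) \<and>
        2 * sum wt (set qs) \<le> 3 * vr s 28) \<and>
     T\<^sub>0 + vr s 32 \<le> T + sum wt (set (take (vr s 26) qs)) + g + 1 \<and>
     vr s 20 = r \<and> vr s 25 = c \<and> vr s 39 = jj \<and> env s"

lemma growingD:
  assumes "growing T\<^sub>0 r A c jj s\<^sub>0 qs g s T"
  shows "queue s\<^sub>0 qs s" "bfs A c (vr s 30) (vr s 31) qs (vr s 26) (depth s) (parent s)"
    "vr s 31 = vr s 30 + 4 * r" "vr s 28 = sum wt {y \<in> set qs. depth s y \<le> vr s 30}" "vr s 30 = 4 * r * g"
    "3 ^ g * D \<le> 2 ^ g * vr s 28" "g \<le> vr s 28" "vr s 32 \<le> 1"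
    "vr s 32 = 0 \<Longrightarrow> vr s 26 < length qs \<Longrightarrow> vr s 31 \<le> depth s (qs ! vr s 26)"
    "vr s 32 = 0 \<Longrightarrow> 2 * sum wt (set qs) \<le> 3 * vr s 28"
    "T\<^sub>0 + vr s 32 \<le> T + sum wt (set (take (vr s 26) qs)) + g + 1"
    "vr s 20 = r" "vr s 25 = c" "vr s 39 = jj" "env s"
  using assms unfolding growing_def by blast+

lemma growingI:
  assumes "queue s\<^sub>0 qs s" "bfs A c (vr s 30) (vr s 31) qs (vr s 26) (depth s) (parent s)"
    "vr s 31 = vr s 30 + 4 * r" "vr s 28 = sum wt {y \<in> set qs. depth s y \<le> vr s 30}" "vr s 30 = 4 * r * g"
    "3 ^ g * D \<le> 2 ^ g * vr s 28" "g \<le> vr s 28" "vr s 32 \<le> 1"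
    "vr s 32 = 0 \<Longrightarrow> vr s 26 < length qs \<Longrightarrow> vr s 31 \<le> depth s (qs ! vr s 26)"
    "vr s 32 = 0 \<Longrightarrow> 2 * sum wt (set qs) \<le> 3 * vr s 28"
    "T\<^sub>0 + vr s 32 \<le> T + sum wt (set (take (vr s 26) qs)) + g + 1"
    "vr s 20 = r" "vr s 25 = c" "vr s 39 = jj" "env s"
  shows "growing T\<^sub>0 r A c jj s\<^sub>0 qs g s T"
  unfolding growing_def using assms by blast

text \<open>The inner weight is at most that of all vertices, hence at most
  \<open>3 * n * D\<close>, so growth by half bounds the number of annuli by \<open>G\<close> and
  the inner radius by \<open>4 * r * G\<close>. Expansions and annuli are each charged once to the
  searched weight, which explains the factor 2.\<close>

lemma grow_wp:
  assumes s: "growing T\<^sub>0 r A c jj s\<^sub>0 qs\<^sub>0 0 s T\<^sub>0"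
    and A: "A \<subseteq> V" "\<And>x. x \<in> V \<Longrightarrow> ar s\<^sub>0 3 x = 1 \<longleftrightarrow> x \<in> A" and jj: "jj + n < W"
    and G: "\<And>g. 3 ^ g \<le> 2 ^ g * (3 * n) \<Longrightarrow> g \<le> G" "4 * r * (G + 3) < 2 ^ w"
    and T: "2 * sum wt A < T\<^sub>0"
  shows "wp grow_com (\<lambda>s' T'. \<exists>qs h. queue s\<^sub>0 qs s' \<and>
     bfs A c (vr s' 30) (vr s' 30 + 4 * r) qs h (depth s') (parent s') \<and>
     (h < length qs \<longrightarrow> vr s' 30 + 4 * r \<le> depth s' (qs ! h)) \<and>
     2 * sum wt (set qs) \<le> 3 * sum wt {y \<in> set qs. depth s' y \<le> vr s' 30} \<and> vr s' 30 \<le> 4 * r * G \<and>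
     T\<^sub>0 \<le> T' + 2 * sum wt (set qs) + 1) s T\<^sub>0"
proof -
  define J where "J = (\<lambda>s T. \<exists>qs g. growing T\<^sub>0 r A c jj s\<^sub>0 qs g s T)"
  have facts: "distinct qs" "set qs \<subseteq> A" "vr s 28 \<le> sum wt (set qs)" "sum wt (set qs) \<le> sum wt A"
      "sum wt (set qs) \<le> 2 * tot" "sum wt (set (take (vr s 26) qs)) \<le> sum wt (set qs)" "g \<le> G"
      "length qs \<le> n" "vr s 26 \<le> length qs" "vr s 27 = length qs" "vr s 29 = sum wt (set qs)"
      "\<And>i. i < length qs \<Longrightarrow> ar s 7 i = qs ! i" "\<And>x. x \<in> set qs \<Longrightarrow> depth s x \<le> vr s 31"
    if g: "growing T\<^sub>0 r A c jj s\<^sub>0 qs g s T" for qs g s T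
  proof -
    note q = growingD(1)[OF g] and b = growingD(2)[OF g]
    show 1: "distinct qs" "set qs \<subseteq> A" and "vr s 26 \<le> length qs"
      and "\<And>x. x \<in> set qs \<Longrightarrow> depth s x \<le> vr s 31" using b unfolding bfs_def by auto
    have fA: "finite A" using A finite_V by (auto intro: finite_subset)
    show 2: "vr s 28 \<le> sum wt (set qs)" unfolding growingD(4)[OF g] by (auto intro!: sum_mono2)
    show 3: "sum wt (set qs) \<le> sum wt A" using 1 fA by (intro sum_mono2) auto
    show "sum wt (set qs) \<le> 2 * tot" using 3 sum_wt_le[OF A(1)] size_bounds(4) by linarith
    show "sum wt (set (take (vr s 26) qs)) \<le> sum wt (set qs)"
      by (intro sum_mono2) (auto dest: in_set_takeD)
    have "3 ^ g * D \<le> 2 ^ g * vr s 28" by (rule growingD(6)[OF g])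
    also have "\<dots> \<le> 2 ^ g * (3 * n * D)"
    proof (rule mult_left_mono)
      have "vr s 28 \<le> tot + nv * D" using 2 3 sum_wt_le[OF A(1)] wt_V by linarith
      also have "\<dots> \<le> 3 * (nv * D)" using tot_D by linarith
      also have "\<dots> \<le> 3 * (n * D)" using nv_le by simp
      finally show "vr s 28 \<le> 3 * n * D" by simp
    qed simp
    finally have "3 ^ g * D \<le> 2 ^ g * (3 * n) * D" by (simp add: ac_simps)
    moreover have "0 < D"
    proof -
      have "c \<in> V" using b A unfolding bfs_def by auto
      then have "0 < nv" using card_V finite_V by (auto simp: card_gt_0_iff)
      then show ?thesis by (rule D_pos)
    qed
    ultimately show "g \<le> G" using G(1) by simp
    show "length qs \<le> n" by (rule le_trans[OF distinct_length_le nv_le]) (use 1 A in auto)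
    show "vr s 27 = length qs" "vr s 29 = sum wt (set qs)"
      "\<And>i. i < length qs \<Longrightarrow> ar s 7 i = qs ! i" using q unfolding queue_def by auto
  qed
  have thr_less: "4 * r * g + 4 * r < 2 ^ w" if "g \<le> G + 1" for g
  proof -
    have "4 * r * g + 4 * r = 4 * r * (g + 1)" by (simp add: algebra_simps)
    also have "\<dots> \<le> 4 * r * (G + 3)" using that by (intro mult_left_mono) auto
    finally show ?thesis using G(2) by linarith
  qed
  have layer: "wp layer_com J s (T - 1)"
    if g: "growing T\<^sub>0 r A c jj s\<^sub>0 qs g s T" and go: "vr s 32 = 1" and T: "0 < T"
      and full: "vr s 26 < length qs \<longrightarrow> vr s 31 \<le> depth s (qs ! vr s 26)" for qs g s T
  proof -
    note f = facts[OF g]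
    note g' = growingD[OF g]
    have num: "3 * vr s 28 < 2 ^ w" "2 * vr s 29 < 2 ^ w" "4 * r < 2 ^ w" "vr s 31 + 4 * r < 2 ^ w"
      using f(3,5,7,11) size_bounds(6) thr_less[of 0] thr_less[of "g + 1"] g'(3,5)
      by (auto simp: algebra_simps)
    show ?thesis
    proof (cases "3 * vr s 28 < 2 * vr s 29")
      case True
      let ?s = "s\<lparr>vr := (vr s)(28 := vr s 29, 30 := vr s 31, 31 := vr s 31 + 4 * r)\<rparr>"
      have "bfs A c (vr s 31) (vr s 31 + 4 * r) qs (vr s 26) (depth s) (parent s)"
        by (rule bfs_layer[OF g'(2) full]) simp
      moreover have "{y \<in> set qs. depth s y \<le> vr s 31} = set qs" using f(13) by auto
      moreover have "3 ^ Suc g * D \<le> 2 ^ Suc g * vr s 29"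
      proof -
        have "3 ^ Suc g * D \<le> 3 * (2 ^ g * vr s 28)" using g'(6) by simp
        also have "\<dots> = 2 ^ g * (3 * vr s 28)" by simp
        also have "\<dots> \<le> 2 ^ g * (2 * vr s 29)" using True by (intro mult_left_mono) auto
        finally show ?thesis by simp
      qed
      moreover have "Suc g \<le> vr s 29" using g'(7) True by linarith
      moreover have "queue s\<^sub>0 qs ?s" using g'(1) by (simp add: queue_def)
      moreover have "env ?s" using g'(15) by (simp add: env_def)
      ultimately have "growing T\<^sub>0 r A c jj s\<^sub>0 qs (Suc g) ?s (T - 1)"
        using g'(3,5,8,11-14) go T f(11) by (intro growingI) (simp_all add: algebra_simps)
      then have "J ?s (T - 1)" unfolding J_def by blast
      then show ?thesis using True num size_bounds(8) g'(12) unfolding layer_com_def by simp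
    next
      case False
      let ?s = "s\<lparr>vr := (vr s)(32 := 0)\<rparr>"
      have "queue s\<^sub>0 qs ?s" "env ?s" using g'(1,15) by (simp_all add: queue_def env_def)
      moreover have "T\<^sub>0 \<le> T - 1 + sum wt (set (take (vr s 26) qs)) + g + 1" using g'(11) go T by linarith
      ultimately have "growing T\<^sub>0 r A c jj s\<^sub>0 qs g ?s (T - 1)"
        using g'(2-7,12-14) f(11) full False by (intro growingI) simp_all
      then have "J ?s (T - 1)" unfolding J_def by blast
      then show ?thesis using False num size_bounds(8) unfolding layer_com_def by simp
    qed
  qed
  have expand: "wp expand_com J s (T - 1)"
    if g: "growing T\<^sub>0 r A c jj s\<^sub>0 qs g s T" and go: "vr s 32 = 1"
      and h: "vr s 26 < length qs" "vr s 33 = depth s (qs ! vr s 26)" "vr s 33 < vr s 31" for qs g s T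
  proof -
    note f = facts[OF g]
    note g' = growingD[OF g]
    let ?x = "qs ! vr s 26"
    have xq: "?x \<in> set qs" using h by simp
    then have xV: "?x \<in> V" using f(2) A by blast
    note xn = V_less(1)[OF xV]
    let ?s = "s\<lparr>vr := (vr s)(18 := ?x, 34 := off ?x, 36 := off (Suc ?x))\<rparr>"
    have take: "set (take (Suc (vr s 26)) qs) = insert ?x (set (take (vr s 26) qs))"
      using h(1) by (simp add: take_Suc_conv_app_nth)
    have "?x \<notin> set (take (vr s 26) qs)"
      using f(1) h(1) by (auto simp: in_set_conv_nth nth_eq_iff_index_eq)
    then have take_wt: "sum wt (set (take (Suc (vr s 26)) qs)) = wt ?x + sum wt (set (take (vr s 26) qs))"
      unfolding take by simp
    have take_le: "sum wt (set (take (Suc (vr s 26)) qs)) \<le> sum wt (set qs)"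
      by (intro sum_mono2) (auto dest: in_set_takeD)
    have cr: "T\<^sub>0 + 1 \<le> T + sum wt (set (take (vr s 26) qs)) + g + 1" "g \<le> vr s 28" using g'(7,11) go by auto
    \<comment> \<open>The weight of the vertex to be expanded is at least one more than its degree,
      which covers the scan and the iteration of the outer loop.\<close>
    have T: "off (Suc ?x) - off ?x \<le> T - 1" "0 < T"
      using wt_pos(1)[OF xV] take_wt take_le cr f(3,4) \<open>2 * sum wt A < T\<^sub>0\<close> by linarith+
    have thr: "vr s 31 < 2 ^ w" using g'(3,5) thr_less[of g] f(7) by simp
    have "wp scan_com (\<lambda>s' T'. \<exists>ys. queue s\<^sub>0 (qs @ ys) s' \<and>
        bfs A c (vr s 30) (vr s 31) (qs @ ys) (vr s 26) (depth s') (parent s') \<and>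
        nbr ?x \<inter> A \<subseteq> set (qs @ ys) \<and> T' + (off (Suc ?x) - off ?x) = T - 1 \<and>
        sum wt {y \<in> set (qs @ ys). depth s' y \<le> vr s 30} = sum wt {y \<in> set qs. depth ?s y \<le> vr s 30}) ?s (T - 1)"
      by (rule scan_wp[OF _ A]) (use g'(1,2,14,15) h T thr jj in \<open>simp_all add: env_def queue_def\<close>)
    then have "wp scan_com (wp (Asgn 26 (Reg 26 \<oplus> Lit 1)) J) ?s (T - 1)"
    proof (rule wp_frame, elim exE conjE)
      fix s' T' ys
      assume fr: "frame scan_com ?s s'" and q: "queue s\<^sub>0 (qs @ ys) s'"
        and b: "bfs A c (vr s 30) (vr s 31) (qs @ ys) (vr s 26) (depth s') (parent s')"
        and nb: "nbr ?x \<inter> A \<subseteq> set (qs @ ys)" and T': "T' + (off (Suc ?x) - off ?x) = T - 1"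
        and mu: "sum wt {y \<in> set (qs @ ys). depth s' y \<le> vr s 30} = sum wt {y \<in> set qs. depth ?s y \<le> vr s 30}"
      have vs: "vr s' v = vr s v" if "v \<in> {20, 25, 26, 28, 30, 31, 32, 39}" for v
        using fr that by (auto simp: frame_def)
      have env': "env s'" by (rule env_frame[OF _ fr]) (use g'(15) in \<open>simp_all add: env_def\<close>)
      let ?t = "s'\<lparr>vr := (vr s')(26 := Suc (vr s 26))\<rparr>"
      have "bfs A c (vr s 30) (vr s 31) (qs @ ys) (Suc (vr s 26)) (depth s') (parent s')"
        by (rule bfs_advance[OF b]) (use h nb in \<open>auto simp: nth_append\<close>)
      moreover have tk: "take (Suc (vr s 26)) (qs @ ys) = take (Suc (vr s 26)) qs" using h by simp
      have "T\<^sub>0 + 1 \<le> T' + sum wt (set (take (Suc (vr s 26)) (qs @ ys))) + g + 1"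
        unfolding tk take_wt using cr T' T wt_pos(1)[OF xV] by linarith
      moreover have "queue s\<^sub>0 (qs @ ys) ?t" "env ?t" using q env' by (simp_all add: queue_def env_def)
      ultimately have "growing T\<^sub>0 r A c jj s\<^sub>0 (qs @ ys) g ?t T'"
        using g'(3-8,12-14) mu go by (intro growingI) (simp_all add: vs)
      then have "J ?t T'" unfolding J_def by blast
      then show "wp (Asgn 26 (Reg 26 \<oplus> Lit 1)) J s' T'"
        using h(1) f(8) size_bounds(1,7) space by (simp add: vs)
    qed
    moreover have "ar s 0 (5 + ?x) = off ?x" "ar s 0 (6 + ?x) = off (Suc ?x)" "ar s 7 (vr s 26) = ?x"
      using envD(1,2)[OF g'(15)] f(12) h xn by auto
    moreover have "vr s 26 < W" "5 + ?x < W" "6 + ?x < W" "5 + ?x < 2 ^ w" "6 + ?x < 2 ^ w"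
      using h f(8) xn size_bounds(1,3) space by linarith+
    ultimately show ?thesis using size_bounds(8) unfolding expand_com_def by simp
  qed
  show ?thesis unfolding grow_com_def
  proof (rule wp_While[where I = J], goal_cases)
    case 1
    show ?case unfolding J_def using s by blast
  next
    case (2 s T)
    then obtain qs g where g: "growing T\<^sub>0 r A c jj s\<^sub>0 qs g s T" unfolding J_def by blast
    note f = facts[OF g]
    note g' = growingD[OF g]
    let ?body = "Cond (Reg 26) (Reg 27) (Asgn 33 (Rd 8 (Reg 39 \<oplus> Rd 7 (Reg 26)))) (Asgn 33 (Reg 31)) ;;
      Cond (Reg 33) (Reg 31) expand_com layer_com"
    have "0 < T \<and> wp ?body J s (T - 1)" if "0 < vr s 32"
    proof -
      have go: "vr s 32 = 1" using that g'(8) by simp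
      have T: "0 < T"
        using g'(7,11) go f(3,4,6) \<open>2 * sum wt A < T\<^sub>0\<close> by linarith
      define d where "d = (if vr s 26 < length qs then depth s (qs ! vr s 26) else vr s 31)"
      let ?s = "s\<lparr>vr := (vr s)(33 := d)\<rparr>"
      have gs: "growing T\<^sub>0 r A c jj s\<^sub>0 qs g ?s T"
        using g' by (intro growingI) (simp_all add: queue_def env_def)
      have "wp (Cond (Reg 33) (Reg 31) expand_com layer_com) J ?s (T - 1)"
      proof (cases "d < vr s 31")
        case True
        then have "vr s 26 < length qs" by (auto simp: d_def split: if_splits)
        then show ?thesis using expand[OF gs] go True by (simp add: d_def)
      next
        case False
        then have "vr s 26 < length qs \<longrightarrow> vr s 31 \<le> depth s (qs ! vr s 26)"
          by (auto simp: d_def split: if_splits)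
        then show ?thesis using layer[OF gs _ T] go False by simp
      qed
      moreover have "vr s 26 < W" "jj + qs ! vr s 26 < W" "jj + qs ! vr s 26 < 2 ^ w" if "vr s 26 < length qs"
      proof -
        have "qs ! vr s 26 < n" using f(2) A V_less(1) that nth_mem by blast
        then show "vr s 26 < W" "jj + qs ! vr s 26 < W" "jj + qs ! vr s 26 < 2 ^ w"
          using jj f(8) that size_bounds(1) space by linarith+
      qed
      ultimately have "wp ?body J s (T - 1)"
        using f(10,12) g'(14) by (cases "vr s 26 < length qs") (simp_all add: d_def)
      then show ?thesis using T by blast
    qed
    note body = this
    show ?case
    proof (intro conjI impI)
      assume "aval (Lit 0) s < aval (Reg 32) s"
      then have "0 < vr s 32" by simp
      then show "0 < T" "wp ?body J s (T - 1)" using body by blast+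
    qed (use size_bounds(8) in simp_all)
  next
    case (3 s T)
    then obtain qs g where g: "growing T\<^sub>0 r A c jj s\<^sub>0 qs g s T" unfolding J_def by blast
    note f = facts[OF g]
    note g' = growingD[OF g]
    have z: "vr s 32 = 0" using 3 by simp
    have gG: "4 * r * g \<le> 4 * r * G" using f(7) by (intro mult_left_mono) auto
    have c6: "T\<^sub>0 \<le> T + 2 * sum wt (set qs) + 1" using g'(7,11) z f(3,6) by linarith
    have c2: "bfs A c (vr s 30) (vr s 30 + 4 * r) qs (vr s 26) (depth s) (parent s)"
      using g'(2) unfolding g'(3) .
    have c3: "vr s 26 < length qs \<longrightarrow> vr s 30 + 4 * r \<le> depth s (qs ! vr s 26)"
      using g'(9)[OF z] unfolding g'(3) by blast
    have c4: "2 * sum wt (set qs) \<le> 3 * sum wt {y \<in> set qs. depth s y \<le> vr s 30}"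
      using g'(10)[OF z] unfolding g'(4) .
    have c5: "vr s 30 \<le> 4 * r * G" using gG unfolding g'(5) .
    show ?case by (intro exI[of _ qs] exI[of _ "vr s 26"] conjI g'(1) c2 c3 c4 c5 c6)
  qed
qed

end

context construction
begin

text \<open>All new values can be given in terms of the state before the loop: a vertex occurs once
  in the queue, so its own entries are still the old ones when it is reached.\<close>

lemma settle_wp:
  assumes q: "vr s 27 = length qs" "\<And>i. i < length qs \<Longrightarrow> ar s 7 i = qs ! i" "distinct qs" "set qs \<subseteq> V"
    and v: "vr s 10 = n" "vr s 20 = r" "vr s 21 = j" "vr s 30 = lm" "vr s 39 = jj" "vr s 23 = length nl" "vr s 40 = 0"
    and nl: "\<And>i. i < length nl \<Longrightarrow> ar s 6 (jj + n + i) = nl ! i"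
    and num: "jj + 4 * n < W" "length nl \<le> n" "lm + 4 * r < 2 ^ w" "j + 1 < 2 ^ w"
    and T: "length qs \<le> T"
  shows "wp (While (Reg 40) (Reg 27) settle_com) (\<lambda>s' T'.
     ar s' 3 = (\<lambda>x. if x \<in> set qs then (if lm + 2 * r < depth s x then 1 else 0) else ar s 3 x) \<and>
     ar s' 4 = (\<lambda>x. if x \<in> set qs \<and> lm < depth s x \<and> ar s 4 x = j then Suc j else ar s 4 x) \<and>
     ar s' 5 = (\<lambda>x. if x \<in> set qs \<and> lm + r < depth s x \<and> depth s x \<le> lm + 3 * r \<and> ar s 5 x = j
       then Suc j else ar s 5 x) \<and>
     (\<exists>ys. ys = filter (\<lambda>x. lm < depth s x \<and> ar s 4 x = j) qs \<and> vr s' 23 = length (nl @ ys) \<and>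
       (\<forall>i<length (nl @ ys). ar s' 6 (jj + n + i) = (nl @ ys) ! i)) \<and>
     (\<forall>z<jj + n. ar s' 6 z = ar s 6 z) \<and> T' + length qs = T) s T"
proof -
  define I where "I = (\<lambda>(s' :: st) T'. vr s' 40 \<le> length qs \<and>
     ar s' 3 = (\<lambda>x. if x \<in> set (take (vr s' 40) qs) then (if lm + 2 * r < depth s x then 1 else 0) else ar s 3 x) \<and>
     ar s' 4 = (\<lambda>x. if x \<in> set (take (vr s' 40) qs) \<and> lm < depth s x \<and> ar s 4 x = j then Suc j else ar s 4 x) \<and>
     ar s' 5 = (\<lambda>x. if x \<in> set (take (vr s' 40) qs) \<and> lm + r < depth s x \<and> depth s x \<le> lm + 3 * r \<and> ar s 5 x = j
       then Suc j else ar s 5 x) \<and>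
     (\<exists>ys. ys = filter (\<lambda>x. lm < depth s x \<and> ar s 4 x = j) (take (vr s' 40) qs) \<and> vr s' 23 = length (nl @ ys) \<and>
       (\<forall>i<length (nl @ ys). ar s' 6 (jj + n + i) = (nl @ ys) ! i)) \<and>
     (\<forall>z<jj + n. ar s' 6 z = ar s 6 z) \<and> T' + vr s' 40 = T)"
  have lqs: "length qs \<le> n" by (rule le_trans[OF distinct_length_le nv_le]) (use q in auto)
  show ?thesis
  proof (rule wp_While[where I = I], goal_cases)
    case 1
    show ?case unfolding I_def using v nl by simp
  next
    case (2 s' T')
    note I = 2(1)[unfolded I_def]
    let ?p = "vr s' 40" and ?ys = "filter (\<lambda>x. lm < depth s x \<and> ar s 4 x = j) (take (vr s' 40) qs)"
    have i1: "?p \<le> length qs"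
      and i3: "ar s' 3 = (\<lambda>x. if x \<in> set (take ?p qs) then (if lm + 2 * r < depth s x then 1 else 0) else ar s 3 x)"
      and i4: "ar s' 4 = (\<lambda>x. if x \<in> set (take ?p qs) \<and> lm < depth s x \<and> ar s 4 x = j then Suc j else ar s 4 x)"
      and i5: "ar s' 5 = (\<lambda>x. if x \<in> set (take ?p qs) \<and> lm + r < depth s x \<and> depth s x \<le> lm + 3 * r \<and> ar s 5 x = j
         then Suc j else ar s 5 x)"
      and i6: "vr s' 23 = length (nl @ ?ys)" "\<forall>i<length (nl @ ?ys). ar s' 6 (jj + n + i) = (nl @ ?ys) ! i"
        "\<forall>z<jj + n. ar s' 6 z = ar s 6 z" and iT: "T' + ?p = T" using I by blast+
    have fr: "vr s' 10 = n" "vr s' 20 = r" "vr s' 21 = j" "vr s' 27 = length qs" "vr s' 30 = lm" "vr s' 39 = jj"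
      "ar s' 7 = ar s 7" "ar s' 8 = ar s 8"
      using 2(2) q v by (auto simp: frame_def)
    have "0 < T' \<and> wp settle_com I s' (T' - 1)" if lt: "?p < length qs"
    proof -
      let ?x = "qs ! ?p"
      let ?d = "ar s 8 (jj + ?x)"
      have T': "0 < T'" "T' - 1 + Suc ?p = T" using iT lt T by auto
      have "?x \<in> set qs" using lt by simp
      then have xn: "?x < n" using q(4) V_less(1) by blast
      have new: "?x \<notin> set (take ?p qs)"
        using q(3) lt by (auto simp: in_set_conv_nth nth_eq_iff_index_eq)
      have take: "take (Suc ?p) qs = take ?p qs @ [?x]" using lt by (simp add: take_Suc_conv_app_nth)
      have lys: "length (nl @ ?ys) \<le> 2 * n"
        using length_filter_le[of "\<lambda>x. lm < depth s x \<and> ar s 4 x = j" "take ?p qs"] lqs num(2) by simp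
      have addr: "?p < W" "?x < W" "jj + ?x < W" "jj + n + vr s' 23 < W" "jj + ?x < 2 ^ w" "jj + n < 2 ^ w"
        "jj + n + vr s' 23 < 2 ^ w" "Suc ?p < 2 ^ w" "Suc (vr s' 23) < 2 ^ w" "Suc j < 2 ^ w"
        "lm + 2 * r < 2 ^ w" "2 * r < 2 ^ w" "lm + r < 2 ^ w" "3 * r < 2 ^ w" "lm + 3 * r < 2 ^ w"
        using lt lqs xn num lys i6(1) size_bounds(1) space by linarith+
      define ys' where "ys' = (if lm < ?d \<and> ar s 4 ?x = j then ?ys @ [?x] else ?ys)"
      let ?t = "s'\<lparr>vr := (vr s')(18 := ?x, 33 := ?d, 23 := length (nl @ ys'), 40 := Suc ?p),
         ar := (ar s')(3 := (ar s' 3)(?x := if lm + 2 * r < ?d then 1 else 0),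
           4 := (ar s' 4)(?x := if lm < ?d \<and> ar s 4 ?x = j then Suc j else ar s 4 ?x),
           6 := (if lm < ?d \<and> ar s 4 ?x = j then (ar s' 6)(jj + n + vr s' 23 := ?x) else ar s' 6),
           5 := (ar s' 5)(?x := if lm + r < ?d \<and> ?d \<le> lm + 3 * r \<and> ar s 5 ?x = j then Suc j else ar s 5 ?x))\<rparr>"
      have ys': "ys' = filter (\<lambda>x. lm < depth s x \<and> ar s 4 x = j) (take (Suc ?p) qs)"
        unfolding take ys'_def by (simp add: v)
      have old: "ar s' 4 ?x = ar s 4 ?x" "ar s' 5 ?x = ar s 5 ?x" using new i4 i5 by simp_all
      have It: "I t (T' - Suc 0)"
        if t: "vr t 40 = Suc ?p" "vr t 23 = length (nl @ ys')" "ar t 3 ?x = ar ?t 3 ?x" "ar t 4 ?x = ar ?t 4 ?x"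
          "ar t 5 ?x = ar ?t 5 ?x" "ar t 6 = ar ?t 6"
          "\<And>z. z \<noteq> ?x \<Longrightarrow> ar t 3 z = ar s' 3 z \<and> ar t 4 z = ar s' 4 z \<and> ar t 5 z = ar s' 5 z" for t
      proof -
        have u: "ar t 3 z = ar ?t 3 z" "ar t 4 z = ar ?t 4 z" "ar t 5 z = ar ?t 5 z" for z
          using t(3-5,7) by (cases "z = ?x"; simp)+
        have "ar t 3 = (\<lambda>x. if x \<in> set (take (Suc ?p) qs) then (if lm + 2 * r < depth s x then 1 else 0) else ar s 3 x)"
          unfolding take by (rule ext) (simp add: u(1) i3 v)
        moreover have "ar t 4 = (\<lambda>x. if x \<in> set (take (Suc ?p) qs) \<and> lm < depth s x \<and> ar s 4 x = j then Suc j else ar s 4 x)"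
          unfolding take by (rule ext) (simp add: u(2) i4 v)
        moreover have "ar t 5 = (\<lambda>x. if x \<in> set (take (Suc ?p) qs) \<and> lm + r < depth s x \<and> depth s x \<le> lm + 3 * r \<and> ar s 5 x = j
         then Suc j else ar s 5 x)"
          unfolding take by (rule ext) (simp add: u(3) i5 v)
        moreover have "\<forall>i<length (nl @ ys'). ar t 6 (jj + n + i) = (nl @ ys') ! i"
          using i6 by (auto simp: t(6) ys'_def nth_append less_Suc_eq)
        moreover have "\<forall>z<jj + n. ar t 6 z = ar s 6 z" using i6(3) by (simp add: t(6))
        ultimately show ?thesis unfolding I_def t(1) using t(2) ys' T' lt by (auto simp: Suc_le_eq)
      qed
      \<comment> \<open>The three conditionals are executed one by one through the intermediate
        states \<open>s2\<close>, \<open>s3\<close> and \<open>s4\<close>; their cases would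
        multiply otherwise.\<close>
      define b2 where "b2 \<longleftrightarrow> lm < ?d \<and> ar s 4 ?x = j"
      define b3 where "b3 \<longleftrightarrow> lm + r < ?d \<and> ?d \<le> lm + 3 * r \<and> ar s 5 ?x = j"
      define s2 where "s2 = s'\<lparr>vr := (vr s')(18 := ?x, 33 := ?d),
        ar := (ar s')(3 := (ar s' 3)(?x := if lm + 2 * r < ?d then 1 else 0))\<rparr>"
      define s3 where "s3 = (if b2 then s2\<lparr>ar := (ar s2)(4 := (ar s' 4)(?x := Suc j), 6 := (ar s' 6)(jj + n + vr s' 23 := ?x)),
        vr := (vr s2)(23 := Suc (vr s' 23))\<rparr> else s2)"
      define s4 where "s4 = (if b3 then s3\<lparr>ar := (ar s3)(5 := (ar s' 5)(?x := Suc j))\<rparr> else s3)"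
      have v2: "vr s2 10 = n" "vr s2 18 = ?x" "vr s2 20 = r" "vr s2 21 = j" "vr s2 23 = vr s' 23" "vr s2 30 = lm"
        "vr s2 33 = ?d" "vr s2 39 = jj" "vr s2 40 = ?p" "ar s2 4 = ar s' 4" "ar s2 5 = ar s' 5" "ar s2 6 = ar s' 6"
        "ar s2 3 = (ar s' 3)(?x := if lm + 2 * r < ?d then 1 else 0)"
        by (simp_all add: s2_def fr)
      have v3: "vr s3 18 = ?x" "vr s3 20 = r" "vr s3 21 = j" "vr s3 30 = lm"
        "vr s3 33 = ?d" "vr s3 40 = ?p" "ar s3 5 = ar s' 5" "ar s3 3 = ar s2 3"
        "vr s3 23 = (if b2 then Suc (vr s' 23) else vr s' 23)"
        "ar s3 4 = (if b2 then (ar s' 4)(?x := Suc j) else ar s' 4)"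
        "ar s3 6 = (if b2 then (ar s' 6)(jj + n + vr s' 23 := ?x) else ar s' 6)"
        by (simp_all add: s3_def v2)
      have v4: "vr s4 = vr s3" "ar s4 3 = ar s3 3" "ar s4 4 = ar s3 4" "ar s4 6 = ar s3 6"
        "ar s4 5 = (if b3 then (ar s' 5)(?x := Suc j) else ar s' 5)"
        by (simp_all add: s4_def v3)
      have c1: "wp (Asgn 18 (Rd 7 (Reg 40)) ;; Asgn 33 (Rd 8 (Reg 39 \<oplus> Reg 18)) ;;
          Cond (Reg 30 \<oplus> Lit 2 \<otimes> Reg 20) (Reg 33) (Wr 3 (Reg 18) (Lit 1)) (Wr 3 (Reg 18) (Lit 0))) Q s' U \<longleftrightarrow>
          Q s2 U" for Q U
        using addr size_bounds(7) q(2)[OF lt] by (simp add: s2_def fr size_bounds(8))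
      have c2: "wp (Cond (Reg 30) (Reg 33)
         (If_eq (Rd 4 (Reg 18)) (Reg 21)
            (Wr 4 (Reg 18) (Reg 21 \<oplus> Lit 1) ;; Wr 6 (Reg 39 \<oplus> Reg 10 \<oplus> Reg 23) (Reg 18) ;;
             Asgn 23 (Reg 23 \<oplus> Lit 1))
            Skip)
         Skip) Q s2 U \<longleftrightarrow> Q s3 U" for Q U
        using addr size_bounds(7) by (cases b2) (auto simp: s3_def v2 size_bounds(8) old b2_def)
      have c3: "wp (Cond (Reg 30 \<oplus> Reg 20) (Reg 33)
        (Cond (Reg 30 \<oplus> Lit 3 \<otimes> Reg 20) (Reg 33) Skip
          (If_eq (Rd 5 (Reg 18)) (Reg 21) (Wr 5 (Reg 18) (Reg 21 \<oplus> Lit 1)) Skip))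
        Skip) Q s3 U \<longleftrightarrow> Q s4 U" for Q U
        using addr size_bounds(7) by (cases b3) (auto simp: s4_def v3 size_bounds(8) old b3_def)
      have "I (s4\<lparr>vr := (vr s4)(40 := Suc ?p)\<rparr>) (T' - Suc 0)"
        by (rule It) (simp_all add: v4 v3 v2 i6(1) ys'_def old flip: b2_def b3_def)
      then have "wp settle_com I s' (T' - 1)"
        using addr size_bounds(7)
        unfolding settle_com_def wp_Seq c1[unfolded wp_Seq] c2 c3 by (simp add: v4 v3)
      then show ?thesis using T' by blast
    qed
    then show ?case using fr by simp
  next
    case (3 s' T')
    then have "vr s' 40 = length qs" using q unfolding I_def by (auto simp: frame_def)
    then show ?case using 3(1) unfolding I_def by simp
  qed
qed

definition carving :: "nat \<Rightarrow> nat \<Rightarrow> nat \<Rightarrow> nat \<Rightarrow> (nat \<Rightarrow> nat) \<Rightarrow> (nat \<Rightarrow> nat) \<Rightarrow> nat set \<Rightarrow> nat list \<Rightarrow> st \<Rightarrow> bool" where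
  "carving r R j jj S\<^sub>0 H\<^sub>0 A nl s \<longleftrightarrow>
     (\<forall>x\<in>V. ar s 3 x = (if x \<in> A then 1 else 0)) \<and> distinct nl \<and> vr s 23 = length nl \<and>
     (\<forall>i<length nl. ar s 6 (jj + n + i) = nl ! i) \<and>
     (\<forall>x\<in>V. ar s 4 x = (if x \<in> set nl then Suc j else S\<^sub>0 x)) \<and>
     round_inv r R j H\<^sub>0 {x \<in> V. S\<^sub>0 x = j} A (set nl) (ar s 5)
       (\<lambda>x. ar s 8 (jj + x)) (\<lambda>x. ar s 9 (jj + x)) (\<lambda>x. ar s 10 (jj + x))"

text \<open>For searched weight \<open>q\<close>, growing costs at most \<open>2 * q + 1\<close>
  iterations and settling at most \<open>q\<close>, together at most \<open>4 * q\<close>. The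
  searched weight is at most three halves of the carved weight, so a credit of 8 per unit of waiting
  weight is ample.\<close>

lemma carve_wp:
  assumes env: "env s" and v: "vr s 20 = r" "vr s 21 = j" "vr s 25 = c" "vr s 39 = jj"
    and car: "carving r R j jj S\<^sub>0 H\<^sub>0 A nl s" and c: "c \<in> A"
    and num: "jj + 4 * n < W" "j + 1 < 2 ^ w"
    and G: "\<And>g. 3 ^ g \<le> 2 ^ g * (3 * n) \<Longrightarrow> g \<le> G" "4 * r * (G + 3) < 2 ^ w" "4 * r * G + 2 * r \<le> R"
    and T: "T\<^sub>1 + 8 * sum wt A \<le> T"
  shows "wp carve_com (\<lambda>s' T'. \<exists>A' nl'. carving r R j jj S\<^sub>0 H\<^sub>0 A' nl' s' \<and> A' \<subseteq> A \<and> c \<notin> A' \<and>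
     (\<forall>z<jj + n. ar s' 6 z = ar s 6 z) \<and>
     (\<forall>z. z < jj \<longrightarrow> ar s' 8 z = ar s 8 z \<and> ar s' 9 z = ar s 9 z \<and> ar s' 10 z = ar s 10 z) \<and>
     T\<^sub>1 + 8 * sum wt A' \<le> T') s T"
proof -
  note car' = car[unfolded carving_def]
  let ?M = "{x \<in> V. S\<^sub>0 x = j}"
  have ri: "round_inv r R j H\<^sub>0 ?M A (set nl) (ar s 5) (depth s) (parent s) (\<lambda>x. ar s 10 (jj + x))"
    using car' v by simp
  then have A: "A \<subseteq> V" "A \<subseteq> ?M" "set nl \<subseteq> ?M" unfolding round_inv_def by auto
  have nl: "distinct nl" "vr s 23 = length nl" "\<And>i. i < length nl \<Longrightarrow> ar s 6 (jj + n + i) = nl ! i"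
    "\<And>x. x \<in> V \<Longrightarrow> ar s 4 x = (if x \<in> set nl then Suc j else S\<^sub>0 x)"
    "\<And>x. x \<in> V \<Longrightarrow> ar s 3 x = (if x \<in> A then 1 else 0)"
    using car' by blast+
  have lnl: "length nl \<le> n" by (rule le_trans[OF distinct_length_le nv_le]) (use nl A in auto)
  have mark: "\<And>x. x \<in> V \<Longrightarrow> ar s 3 x = 1 \<longleftrightarrow> x \<in> A" using nl(5) by simp
  have cV: "c \<in> V" using c A by blast
  note cn = V_less(1)[OF cV]
  have fA: "finite A" using A finite_V by (auto intro: finite_subset)
  have wc: "wt c = off (Suc c) - off c + D" by (rule wt_eq[OF cn])
  have wc_le: "wt c \<le> sum wt A" using c fA by (simp add: member_le_sum)
  have D_le: "D \<le> wt c" "0 < wt c" using wt_pos[OF cV] by simp_all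
  let ?s = "s\<lparr>ar := (ar s)(3 := (ar s 3)(c := 2), 8 := (ar s 8)(jj + c := 0), 9 := (ar s 9)(jj + c := c),
      10 := (ar s 10)(jj + c := c), 7 := (ar s 7)(0 := c)),
    vr := (vr s)(26 := 0, 27 := 1, 29 := wt c, 28 := wt c, 30 := 0, 31 := 4 * r, 32 := 1)\<rparr>"
  have seed: "wp seed_com Q s T' \<longleftrightarrow> Q ?s T'" for Q T'
  proof -
    have "c < W" "6 + c < W" "jj + c < W" "jj + c < 2 ^ w" "6 + c < 2 ^ w" "5 + c < 2 ^ w" "0 < W"
      using cn num size_bounds(1,3) space by linarith+
    moreover have "off c \<le> off (Suc c)" "off (Suc c) < 2 ^ w" "off (Suc c) - off c + D < 2 ^ w"
      using off_mono[OF cn] off_tot[of "Suc c"] cn size_bounds(4,6) wc wc_le sum_wt_le[OF A(1)] by (linarith | auto)+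
    moreover have "4 * r < 2 ^ w"
    proof -
      have "4 * r * 1 \<le> 4 * r * (G + 3)" by (intro mult_left_mono) auto
      then show ?thesis using G(2) by linarith
    qed
    ultimately show ?thesis
      by (simp add: seed_com_def v size_bounds(8) envD[OF env] cn less_imp_le wc)
  qed
  have "growing (T) r A c jj s [c] 0 ?s T"
  proof (rule growingI)
    show "bfs A c (vr ?s 30) (vr ?s 31) [c] (vr ?s 26) (depth ?s) (parent ?s)"
      by (simp add: bfs_def c v)
    show "queue s [c] ?s" by (auto simp: queue_def v)
    show "vr ?s 28 = sum wt {y \<in> set [c]. depth ?s y \<le> vr ?s 30}"
    proof -
      have "{y \<in> set [c]. depth ?s y \<le> vr ?s 30} = {c}" by (auto simp: v)
      then show ?thesis by simp
    qed
    show "env ?s" using env by (simp add: env_def)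
  qed (use D_le v in simp_all)
  then have grown: "wp grow_com (\<lambda>s' T'. \<exists>qs h. queue s qs s' \<and>
     bfs A c (vr s' 30) (vr s' 30 + 4 * r) qs h (depth s') (parent s') \<and>
     (h < length qs \<longrightarrow> vr s' 30 + 4 * r \<le> depth s' (qs ! h)) \<and>
     2 * sum wt (set qs) \<le> 3 * sum wt {y \<in> set qs. depth s' y \<le> vr s' 30} \<and> vr s' 30 \<le> 4 * r * G \<and>
     T \<le> T' + 2 * sum wt (set qs) + 1) ?s T"
    by (rule grow_wp[OF _ A(1) mark _ G(1,2)]) (use num T D_le wc_le in auto)
  show ?thesis unfolding carve_com_def wp_Seq[of seed_com] seed unfolding wp_Seq
  proof (rule wp_frame[OF grown], elim exE conjE)
    fix s' T' qs h
    assume q: "queue s qs s'" and b: "bfs A c (vr s' 30) (vr s' 30 + 4 * r) qs h (depth s') (parent s')"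
      "h < length qs \<longrightarrow> vr s' 30 + 4 * r \<le> depth s' (qs ! h)"
      and slow: "2 * sum wt (set qs) \<le> 3 * sum wt {y \<in> set qs. depth s' y \<le> vr s' 30}"
      and lm: "vr s' 30 \<le> 4 * r * G" and T': "T \<le> T' + 2 * sum wt (set qs) + 1"
      and fr: "frame grow_com ?s s'"
    have vs: "vr s' 10 = n" "vr s' 20 = r" "vr s' 21 = j" "vr s' 39 = jj" "vr s' 25 = c" "vr s' 23 = length nl"
      "ar s' 4 = ar s 4" "ar s' 5 = ar s 5" "ar s' 6 = ar s 6"
      using fr v nl(2) envD(4)[OF env] by (auto simp: frame_def)
    have qsA: "distinct qs" "set qs \<subseteq> A" "c \<in> set qs" "depth s' c = 0" using b(1) unfolding bfs_def by auto
    have lqs: "length qs \<le> sum wt (set qs)"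
    proof -
      have "length qs = (\<Sum>x\<in>set qs. 1)" using distinct_card[OF qsA(1)] by simp
      also have "\<dots> \<le> sum wt (set qs)" using wt_pos(1) qsA(2) A(1) by (intro sum_mono) force
      finally show ?thesis .
    qed
    have wq: "sum wt (set qs) \<le> sum wt A" by (rule sum_mono2) (use fA qsA in auto)
    have "0 < length qs" using qsA(3) by (auto simp: length_pos_if_in_set)
    let ?lm = "vr s' 30"
    let ?t = "s'\<lparr>vr := (vr s')(40 := 0)\<rparr>"
    have lm4: "?lm + 4 * r < 2 ^ w" using lm G(2) by (simp add: algebra_simps)
    have "wp (While (Reg 40) (Reg 27) settle_com) (\<lambda>s'' T''.
     ar s'' 3 = (\<lambda>x. if x \<in> set qs then (if ?lm + 2 * r < depth ?t x then 1 else 0) else ar ?t 3 x) \<and>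
     ar s'' 4 = (\<lambda>x. if x \<in> set qs \<and> ?lm < depth ?t x \<and> ar ?t 4 x = j then Suc j else ar ?t 4 x) \<and>
     ar s'' 5 = (\<lambda>x. if x \<in> set qs \<and> ?lm + r < depth ?t x \<and> depth ?t x \<le> ?lm + 3 * r \<and> ar ?t 5 x = j
       then Suc j else ar ?t 5 x) \<and>
     (\<exists>ys. ys = filter (\<lambda>x. ?lm < depth ?t x \<and> ar ?t 4 x = j) qs \<and> vr s'' 23 = length (nl @ ys) \<and>
       (\<forall>i<length (nl @ ys). ar s'' 6 (jj + n + i) = (nl @ ys) ! i)) \<and>
     (\<forall>z<jj + n. ar s'' 6 z = ar ?t 6 z) \<and> T'' + length qs = T') ?t T'"
      by (rule settle_wp) (use q qsA A vs nl(3) num lnl lm4 T T' lqs wq \<open>0 < length qs\<close> in \<open>auto simp: queue_def\<close>)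
    then show "wp (Asgn 40 (Lit 0)) (wp (While (Reg 40) (Reg 27) settle_com) (\<lambda>s' T'. \<exists>A' nl'.
       carving r R j jj S\<^sub>0 H\<^sub>0 A' nl' s' \<and> A' \<subseteq> A \<and> c \<notin> A' \<and> (\<forall>z<jj + n. ar s' 6 z = ar s 6 z) \<and>
     (\<forall>z. z < jj \<longrightarrow> ar s' 8 z = ar s 8 z \<and> ar s' 9 z = ar s 9 z \<and> ar s' 10 z = ar s 10 z) \<and>
     T\<^sub>1 + 8 * sum wt A' \<le> T')) s' T'"
      unfolding wp_Asgn
    proof (intro conjI, goal_cases)
      case 4
      show ?case unfolding aval.simps
      proof (rule wp_frame[OF 4], elim exE conjE)
        fix s'' T'' ys
        assume a3: "ar s'' 3 = (\<lambda>x. if x \<in> set qs then (if ?lm + 2 * r < depth ?t x then 1 else 0) else ar ?t 3 x)"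
          and a4: "ar s'' 4 = (\<lambda>x. if x \<in> set qs \<and> ?lm < depth ?t x \<and> ar ?t 4 x = j then Suc j else ar ?t 4 x)"
          and a5: "ar s'' 5 = (\<lambda>x. if x \<in> set qs \<and> ?lm + r < depth ?t x \<and> depth ?t x \<le> ?lm + 3 * r \<and> ar ?t 5 x = j
            then Suc j else ar ?t 5 x)"
          and ys: "ys = filter (\<lambda>x. ?lm < depth ?t x \<and> ar ?t 4 x = j) qs" "vr s'' 23 = length (nl @ ys)"
            "\<forall>i<length (nl @ ys). ar s'' 6 (jj + n + i) = (nl @ ys) ! i"
          and a6: "\<forall>z<jj + n. ar s'' 6 z = ar ?t 6 z" and T'': "T'' + length qs = T'"
          and fr': "frame (While (Reg 40) (Reg 27) settle_com) ?t s''"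
        have ar: "ar s'' 8 = ar s' 8" "ar s'' 9 = ar s' 9" "ar s'' 10 = ar s' 10"
          using fr' by (auto simp: frame_def)
        let ?C = "{x \<in> set qs. depth s' x \<le> ?lm + 2 * r}"
        let ?A' = "A - ?C"
        have S_Q: "ar s 4 x = j \<or> x \<in> set nl" if "x \<in> set qs" for x
          using nl(4)[of x] qsA(2) A that by (cases "x \<in> set nl") auto
        have j_nl: "x \<notin> set nl" if "ar s 4 x = j" "x \<in> V" for x using nl(4)[OF that(2)] that(1) by auto
        have set_ys: "set (nl @ ys) = set nl \<union> {x \<in> set qs. ?lm < depth s' x}"
          using S_Q unfolding ys(1) by (auto simp: vs)
        have same: "depth s' x = ar s 8 (jj + x) \<and> parent s' x = ar s 9 (jj + x) \<and>
            ar s' 10 (jj + x) = ar s 10 (jj + x)" if "x \<notin> set qs" for x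
        proof -
          have "jj + x \<notin> (+) jj ` set qs" using that by auto
          then show ?thesis using q unfolding queue_def vs by blast
        qed
        have carve: "round_inv r R j H\<^sub>0 ?M ?A' (set (nl @ ys)) (ar s'' 5) (depth s') (parent s') (\<lambda>x. ar s' 10 (jj + x))"
          "sum wt (set qs) + sum wt (set qs) \<le> 3 * sum wt (A - ?A')"
        proof (rule_tac [!] carve_step[where dp = "depth s'" and pr = "parent s'" and rt = "\<lambda>x. ar s' 10 (jj + x)"
              and c = c and X = "set nl" and X' = "set (nl @ ys)" and H = "ar s 5" and H' = "ar s'' 5" and lm = ?lm
              and qs = qs and r = r and j = j and H\<^sub>0 = H\<^sub>0 and M = ?M and h = h and R = R
              and dp\<^sub>0 = "depth s" and pr\<^sub>0 = "parent s" and rt\<^sub>0 = "\<lambda>x. ar s 10 (jj + x)"])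
        qed (use ri b slow lm G(3) same q set_ys in \<open>auto simp: vs v a5 queue_def\<close>)
        have car'': "carving r R j jj S\<^sub>0 H\<^sub>0 ?A' (nl @ ys) s''"
          unfolding carving_def
        proof (intro conjI ballI)
          fix x assume x: "x \<in> V"
          show "ar s'' 3 x = (if x \<in> ?A' then 1 else 0)"
            using q nl(5)[OF x] qsA(2) unfolding a3 queue_def by (auto simp: vs)
          show "ar s'' 4 x = (if x \<in> set (nl @ ys) then Suc j else S\<^sub>0 x)"
            using nl(4)[OF x] S_Q[of x] unfolding a4 set_ys by (auto simp: vs)
        next
          show "distinct (nl @ ys)" using nl(1) qsA(1,2) A(1) j_nl unfolding ys(1) by (auto simp: vs)
        qed (use ys(2,3) carve(1) in \<open>simp_all add: vs ar\<close>)
        have "sum wt ?A' + sum wt ?C = sum wt A"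
          using qsA(2) fA by (subst sum.union_disjoint[symmetric]) (auto intro!: sum.cong)
        moreover have "A - ?A' = ?C" using qsA(2) by blast
        ultimately have C: "sum wt (set qs) + sum wt (set qs) \<le> 3 * sum wt ?C" "sum wt ?A' + sum wt ?C = sum wt A"
          using carve(2) by metis+
        have "T\<^sub>1 + 8 * sum wt ?A' \<le> T''"
          using T T' T'' C lqs \<open>0 < length qs\<close> by linarith
        moreover have "ar s'' 8 z = ar s 8 z \<and> ar s'' 9 z = ar s 9 z \<and> ar s'' 10 z = ar s 10 z" if "z < jj" for z
        proof -
          have "z \<notin> (+) jj ` set qs" using that by auto
          then show ?thesis using q unfolding queue_def vs ar by blast
        qed
        ultimately show "\<exists>A' nl'. carving r R j jj S\<^sub>0 H\<^sub>0 A' nl' s'' \<and> A' \<subseteq> A \<and> c \<notin> A' \<and>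
             (\<forall>z<jj + n. ar s'' 6 z = ar s 6 z) \<and>
             (\<forall>z. z < jj \<longrightarrow> ar s'' 8 z = ar s 8 z \<and> ar s'' 9 z = ar s 9 z \<and> ar s'' 10 z = ar s 10 z) \<and>
             T\<^sub>1 + 8 * sum wt A' \<le> T''"
          using car'' a6 qsA
          by (intro exI[of _ ?A'] exI[of _ "nl @ ys"]) (auto simp: vs)
      qed
    qed (use size_bounds(8) in simp_all)
  qed
qed

end

section \<open>Execution of the rounds of one scale\<close>

definition mark_com :: com where
  "mark_com = While (Reg 24) (Reg 22) (Wr 3 (Rd 6 (Reg 39 \<oplus> Reg 24)) (Lit 1) ;; Asgn 24 (Reg 24 \<oplus> Lit 1))"

definition sweep_com :: com where
  "sweep_com = While (Reg 24) (Reg 22)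
     (Asgn 25 (Rd 6 (Reg 39 \<oplus> Reg 24)) ;; Cond (Lit 0) (Rd 3 (Reg 25)) carve_com Skip ;;
      Asgn 24 (Reg 24 \<oplus> Lit 1))"

definition round_com :: com where
  "round_com = Asgn 24 (Lit 0) ;; mark_com ;; Asgn 23 (Lit 0) ;; Asgn 24 (Lit 0) ;; sweep_com ;;
     Asgn 21 (Reg 21 \<oplus> Lit 1) ;; Asgn 39 (Reg 39 \<oplus> Reg 10) ;; Asgn 22 (Reg 23)"

definition rounds_com :: com where
  "rounds_com = While (Lit 0) (Reg 22) round_com"

lemma round_frames [simp]:
  "assigned mark_com = {24}" "written mark_com = {3}" "silent mark_com"
  "assigned sweep_com = {18, 23, 24, 25, 26, 27, 28, 29, 30, 31, 32, 33, 34, 35, 36, 40}"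
  "written sweep_com = {3, 4, 5, 6, 7, 8, 9, 10}" "silent sweep_com"
  "assigned round_com = {18, 21, 22, 23, 24, 25, 26, 27, 28, 29, 30, 31, 32, 33, 34, 35, 36, 39, 40}"
  "written round_com = {3, 4, 5, 6, 7, 8, 9, 10}" "silent round_com"
  "assigned rounds_com = {18, 21, 22, 23, 24, 25, 26, 27, 28, 29, 30, 31, 32, 33, 34, 35, 36, 39, 40}"
  "written rounds_com = {3, 4, 5, 6, 7, 8, 9, 10}" "silent rounds_com"
  by (auto simp: mark_com_def sweep_com_def round_com_def rounds_com_def)

context construction
begin

abbreviation rows :: "st \<Rightarrow> nat \<Rightarrow> nat \<Rightarrow> nat \<Rightarrow> nat" where
  "rows s a \<equiv> (\<lambda>j x. ar s a (j * n + x))"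

definition round_state :: "nat \<Rightarrow> nat \<Rightarrow> nat \<Rightarrow> nat list \<Rightarrow> st \<Rightarrow> bool" where
  "round_state r R j ml s \<longleftrightarrow> vr s 20 = r \<and> vr s 21 = j \<and> vr s 39 = j * n \<and> vr s 22 = length ml \<and>
     distinct ml \<and> set ml = {x \<in> V. ar s 4 x = j} \<and> (\<forall>i<length ml. ar s 6 (j * n + i) = ml ! i) \<and>
     (\<forall>x\<in>V. ar s 3 x = 0) \<and> scale_inv r R D j (ar s 4) (ar s 5) (rows s 8) (rows s 9) (rows s 10) \<and> env s"

text \<open>The potential bounds \<open>D\<close> times the number of records by
  \<open>D * nv\<close> plus the total weight, and the latter is at most \<open>3 * nv * D\<close>;
  then \<open>D\<close> cancels.\<close>

lemma scale_inv_bound: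
  assumes "scale_inv r R D j S H dp pr rt" shows "(\<Sum>x\<in>V. Suc (S x)) \<le> 4 * nv"
proof (cases "nv = 0")
  case True
  then have "V = {}" using card_V finite_V by auto
  then show ?thesis by simp
next
  case False
  have "D * (\<Sum>x\<in>V. Suc (S x)) \<le> D * card V + sum wt V" using assms unfolding scale_inv_def by linarith
  also have "\<dots> \<le> D * nv + (tot + nv * D)" using wt_V card_V by simp
  also have "\<dots> \<le> D * (4 * nv)" using tot_D by (simp add: mult.commute)
  finally show ?thesis using D_pos False by simp
qed

lemma scale_inv_less:
  assumes "scale_inv r R D j S H dp pr rt" "x \<in> V" shows "S x < 4 * nv"
proof -
  have "Suc (S x) \<le> (\<Sum>x\<in>V. Suc (S x))" using finite_V assms(2) by (intro member_le_sum) auto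
  then show ?thesis using scale_inv_bound[OF assms(1)] by simp
qed

text \<open>A round on weight \<open>m\<close> takes at most \<open>11 * m\<close> iterations:
  \<open>8 * m\<close> for carving, twice the number of vertices for marking and sweeping, and one
  for itself. As the next round has weight at most \<open>m / 2\<close>, a credit of
  \<open>22 * m\<close> covers this and leaves the credit for the next round.\<close>

lemma round_wp:
  assumes st: "round_state r R j ml s" and ne: "ml \<noteq> []"
    and G: "\<And>g. 3 ^ g \<le> 2 ^ g * (3 * n) \<Longrightarrow> g \<le> G" "4 * r * (G + 3) < 2 ^ w" "4 * r * G + 2 * r \<le> R"
    and T: "T\<^sub>1 + 22 * sum wt {x \<in> V. ar s 4 x = j} \<le> T"
  shows "0 < T \<and> wp round_com (\<lambda>s' T'. \<exists>ml'. round_state r R (Suc j) ml' s' \<and>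
      T\<^sub>1 + 22 * sum wt {x \<in> V. ar s' 4 x = Suc j} \<le> T') s (T - 1)"
proof -
  note st' = st[unfolded round_state_def]
  let ?M = "{x \<in> V. ar s 4 x = j}"
  have v: "vr s 20 = r" "vr s 21 = j" "vr s 39 = j * n" "vr s 22 = length ml" "distinct ml" "set ml = ?M"
    "\<And>i. i < length ml \<Longrightarrow> ar s 6 (j * n + i) = ml ! i" "\<And>x. x \<in> V \<Longrightarrow> ar s 3 x = 0" "env s"
    and sc: "scale_inv r R D j (ar s 4) (ar s 5) (rows s 8) (rows s 9) (rows s 10)"
    using st' by blast+
  have lml: "length ml \<le> n" by (rule le_trans[OF distinct_length_le nv_le]) (use v in auto)
  have mlV: "ml ! i \<in> V" "ml ! i < n" "ml ! i \<in> ?M" if "i < length ml" for i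
    using nth_mem[OF that] v(6) V_less(1) by auto
  \<comment> \<open>Some vertex takes part in round \<open>j\<close>, so the bound on the number of
    records also bounds the round, and with it the addresses of the rows.\<close>
  have "j < 4 * nv" using scale_inv_less[OF sc mlV(1)[of 0]] mlV(3)[of 0] ne by auto
  then have j4: "Suc j \<le> 4 * n" using nv_le by linarith
  have "Suc j * n \<le> 4 * n * n" using j4 by (intro mult_right_mono) auto
  then have jn: "j * n + n \<le> 4 * (n * n)" by simp
  have num: "j * n + 4 * n < W" "j * n + n < 2 ^ w" "j + 1 < 2 ^ w" "Suc j < 2 ^ w" "Suc (length ml) < 2 ^ w"
    using jn j4 lml size_bounds(1,3) space by linarith+
  have len_M: "length ml \<le> sum wt ?M"
  proof -
    have "length ml = (\<Sum>x\<in>?M. 1)" using distinct_card[OF v(5)] v(6) by simp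
    also have "\<dots> \<le> sum wt ?M" using wt_pos(1) by (intro sum_mono) force
    finally show ?thesis .
  qed
  have pos: "0 < length ml" using ne by simp
  have T0: "0 < T" using T len_M pos by linarith
  have addr: "j * n + q < W" "j * n + q < 2 ^ w" "q < 2 ^ w" "Suc q < 2 ^ w" if "q < length ml" for q
    using that lml num space by linarith+
  let ?s0 = "s\<lparr>vr := (vr s)(24 := 0)\<rparr>"
  have mark: "wp mark_com (\<lambda>s' T'. (\<forall>x\<in>V. ar s' 3 x = (if x \<in> ?M then 1 else 0)) \<and> T' + length ml = T - 1) ?s0 (T - 1)"
    unfolding mark_com_def
  proof (rule wp_While[where I = "\<lambda>s' T'. vr s' 24 \<le> length ml \<and>
      (\<forall>x\<in>V. ar s' 3 x = (if x \<in> set (take (vr s' 24) ml) then 1 else 0)) \<and> T' + vr s' 24 = T - 1"], goal_cases)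
    case 1
    show ?case using v(8) by simp
  next
    case (2 s' T')
    have fr: "vr s' 39 = j * n" "vr s' 22 = length ml" "ar s' 6 = ar s 6" using 2(2) v by (auto simp: frame_def)
    show ?case
    proof (cases "vr s' 24 < length ml")
      case True
      have "take (Suc (vr s' 24)) ml = take (vr s' 24) ml @ [ml ! vr s' 24]" using True by (simp add: take_Suc_conv_app_nth)
      then show ?thesis using 2(1) True fr addr[OF True] v(7)[OF True] mlV(2)[OF True] size_bounds(1,7) T len_M pos
        by auto
    qed (use fr in simp)
  next
    case (3 s' T')
    then have "vr s' 24 = length ml" using v(4) by (auto simp: frame_def)
    then show ?case using 3(1) v(6) by simp
  qed
  have "wp mark_com (wp (Asgn 23 (Lit 0) ;; Asgn 24 (Lit 0) ;; sweep_com ;;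
     Asgn 21 (Reg 21 \<oplus> Lit 1) ;; Asgn 39 (Reg 39 \<oplus> Reg 10) ;; Asgn 22 (Reg 23))
      (\<lambda>s' T'. \<exists>ml'. round_state r R (Suc j) ml' s' \<and>
      T\<^sub>1 + 22 * sum wt {x \<in> V. ar s' 4 x = Suc j} \<le> T')) ?s0 (T - 1)"
  proof (rule wp_frame[OF mark], elim conjE)
    fix s\<^sub>1 T\<^sub>2 assume m: "\<forall>x\<in>V. ar s\<^sub>1 3 x = (if x \<in> ?M then 1 else 0)" and T2: "T\<^sub>2 + length ml = T - 1"
      and fr1: "frame mark_com ?s0 s\<^sub>1"
    let ?s1 = "s\<^sub>1\<lparr>vr := (vr s\<^sub>1)(23 := 0, 24 := 0)\<rparr>"
    have a1: "ar s\<^sub>1 a = ar s a" if "a \<noteq> 3" for a using fr1 that by (auto simp: frame_def)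
    have v1: "vr s\<^sub>1 x = vr s x" if "x \<noteq> 24" for x using fr1 that by (auto simp: frame_def)
    have env1: "env ?s1" using v(9) a1 v1 by (simp add: env_def)
    define T\<^sub>3 where "T\<^sub>3 = T\<^sub>1 + 11 * sum wt ?M"
    define I where "I = (\<lambda>(s' :: st) T'. vr s' 24 \<le> length ml \<and> (\<exists>A nl. carving r R j (j * n) (ar s 4) (ar s 5) A nl s' \<and>
      (\<forall>i<vr s' 24. ml ! i \<notin> A) \<and> (\<forall>z<j * n + n. ar s' 6 z = ar s 6 z) \<and>
      (\<forall>z<j * n. ar s' 8 z = ar s 8 z \<and> ar s' 9 z = ar s 9 z \<and> ar s' 10 z = ar s 10 z) \<and>
      T\<^sub>3 + 8 * sum wt A + (length ml - vr s' 24) \<le> T'))"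
    have sweep: "wp sweep_com (\<lambda>s' T'. I s' T' \<and> vr s' 24 = length ml) ?s1 T\<^sub>2"
      unfolding sweep_com_def
    proof (rule wp_While[where I = I], goal_cases)
      case 1
      have "carving r R j (j * n) (ar s 4) (ar s 5) ?M [] ?s1"
        using m round_start[OF sc refl] by (simp add: carving_def a1)
      moreover have "T\<^sub>3 + 8 * sum wt ?M + length ml \<le> T\<^sub>2" using T T2 len_M pos unfolding T\<^sub>3_def by linarith
      ultimately show ?case unfolding I_def using a1 by (intro conjI exI[of _ ?M] exI[of _ "[]"]) auto
    next
      case (2 s' T')
      then obtain A nl where car: "carving r R j (j * n) (ar s 4) (ar s 5) A nl s'"
        and i: "vr s' 24 \<le> length ml" "\<forall>i<vr s' 24. ml ! i \<notin> A" "\<forall>z<j * n + n. ar s' 6 z = ar s 6 z"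
          "\<forall>z<j * n. ar s' 8 z = ar s 8 z \<and> ar s' 9 z = ar s 9 z \<and> ar s' 10 z = ar s 10 z"
          "T\<^sub>3 + 8 * sum wt A + (length ml - vr s' 24) \<le> T'" unfolding I_def by blast
      have fr: "vr s' 20 = r" "vr s' 21 = j" "vr s' 22 = length ml" "vr s' 39 = j * n"
        using 2(2) v1 v by (auto simp: frame_def)
      have env': "env s'" by (rule env_frame[OF env1 2(2)]) auto
      have step: "0 < T' \<and> wp (Asgn 25 (Rd 6 (Reg 39 \<oplus> Reg 24)) ;; Cond (Lit 0) (Rd 3 (Reg 25)) carve_com Skip ;;
          Asgn 24 (Reg 24 \<oplus> Lit 1)) I s' (T' - 1)" if lt: "vr s' 24 < length ml"
      proof -
        let ?c = "ml ! vr s' 24"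
        let ?t = "s'\<lparr>vr := (vr s')(25 := ?c)\<rparr>"
        have "j * n + vr s' 24 < j * n + n" using lt lml by simp
        then have rd: "ar s' 6 (j * n + vr s' 24) = ?c" using i(3) v(7)[OF lt] by simp
        have T': "T\<^sub>3 + (length ml - Suc (vr s' 24)) + 8 * sum wt A \<le> T' - 1" "0 < T'" using i(5) lt by linarith+
        have cW: "?c < W" using mlV(2)[OF lt] size_bounds(1) by simp
        have mark: "ar s' 3 ?c = (if ?c \<in> A then 1 else 0)" using car mlV(1)[OF lt] unfolding carving_def by blast
        have "wp (Cond (Lit 0) (Rd 3 (Reg 25)) carve_com Skip) (wp (Asgn 24 (Reg 24 \<oplus> Lit 1)) I) ?t (T' - 1)"
        proof (cases "?c \<in> A")
          case True
          have "wp carve_com (\<lambda>s'' T''. \<exists>A' nl'. carving r R j (j * n) (ar s 4) (ar s 5) A' nl' s'' \<and> A' \<subseteq> A \<and> ?c \<notin> A' \<and>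
             (\<forall>z<j * n + n. ar s'' 6 z = ar ?t 6 z) \<and>
             (\<forall>z. z < j * n \<longrightarrow> ar s'' 8 z = ar ?t 8 z \<and> ar s'' 9 z = ar ?t 9 z \<and> ar s'' 10 z = ar ?t 10 z) \<and>
             (T\<^sub>3 + (length ml - Suc (vr s' 24))) + 8 * sum wt A' \<le> T'') ?t (T' - 1)"
            by (rule carve_wp[OF _ _ _ _ _ _ True num(1,3) G T'(1)])
              (use env' fr car in \<open>auto simp: env_def carving_def\<close>)
          then have "wp carve_com (wp (Asgn 24 (Reg 24 \<oplus> Lit 1)) I) ?t (T' - 1)"
          proof (rule wp_frame, elim exE conjE)
            fix s'' T'' A' nl'
            assume c: "carving r R j (j * n) (ar s 4) (ar s 5) A' nl' s''" "A' \<subseteq> A" "?c \<notin> A'"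
              and o: "\<forall>z<j * n + n. ar s'' 6 z = ar ?t 6 z"
                "\<forall>z. z < j * n \<longrightarrow> ar s'' 8 z = ar ?t 8 z \<and> ar s'' 9 z = ar ?t 9 z \<and> ar s'' 10 z = ar ?t 10 z"
                "(T\<^sub>3 + (length ml - Suc (vr s' 24))) + 8 * sum wt A' \<le> T''"
              and fr'': "frame carve_com ?t s''"
            have 24: "vr s'' 24 = vr s' 24" using fr'' by (auto simp: frame_def)
            let ?u = "s''\<lparr>vr := (vr s'')(24 := Suc (vr s' 24))\<rparr>"
            have "carving r R j (j * n) (ar s 4) (ar s 5) A' nl' ?u" using c(1) by (simp add: carving_def)
            moreover have "\<forall>i<Suc (vr s' 24). ml ! i \<notin> A'" using i(2) c by (auto simp: less_Suc_eq)
            ultimately have "I ?u T''"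
              unfolding I_def using i o lt by (intro conjI exI[of _ A'] exI[of _ nl']) auto
            then show "wp (Asgn 24 (Reg 24 \<oplus> Lit 1)) I s'' T''" using addr[OF lt] size_bounds(7) by (simp add: 24)
          qed
          then show ?thesis using True mark cW size_bounds(8) by simp
        next
          case False
          let ?u = "s'\<lparr>vr := (vr s')(25 := ?c, 24 := Suc (vr s' 24))\<rparr>"
          have "carving r R j (j * n) (ar s 4) (ar s 5) A nl ?u" using car by (simp add: carving_def)
          moreover have "\<forall>i<Suc (vr s' 24). ml ! i \<notin> A" using i(2) False by (auto simp: less_Suc_eq)
          moreover have "T\<^sub>3 + 8 * sum wt A + (length ml - Suc (vr s' 24)) \<le> T' - 1" using T' by linarith
          ultimately have "I ?u (T' - 1)"
            unfolding I_def using i lt by (intro conjI exI[of _ A] exI[of _ nl]) auto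
          then show ?thesis using False mark cW size_bounds(8) addr[OF lt] by simp
        qed
        then show ?thesis unfolding wp_Seq wp_Asgn[of 25]
          using T' addr[OF lt] fr rd by (simp del: wp_Cond wp_Asgn)
      qed
      show ?case
      proof (intro conjI impI)
        assume "aval (Reg 24) s' < aval (Reg 22) s'"
        then have "vr s' 24 < length ml" using fr by simp
        then show "0 < T'" "wp (Asgn 25 (Rd 6 (Reg 39 \<oplus> Reg 24)) ;; Cond (Lit 0) (Rd 3 (Reg 25)) carve_com Skip ;;
          Asgn 24 (Reg 24 \<oplus> Lit 1)) I s' (T' - 1)" using step by blast+
      qed simp_all
    next
      case (3 s' T')
      then show ?case using v1 v(4) unfolding I_def by (auto simp: frame_def)
    qed
    show "wp (Asgn 23 (Lit 0) ;; Asgn 24 (Lit 0) ;; sweep_com ;;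
       Asgn 21 (Reg 21 \<oplus> Lit 1) ;; Asgn 39 (Reg 39 \<oplus> Reg 10) ;; Asgn 22 (Reg 23))
      (\<lambda>s' T'. \<exists>ml'. round_state r R (Suc j) ml' s' \<and> T\<^sub>1 + 22 * sum wt {x \<in> V. ar s' 4 x = Suc j} \<le> T') s\<^sub>1 T\<^sub>2"
    proof -
      have "wp sweep_com (wp (Asgn 21 (Reg 21 \<oplus> Lit 1) ;; Asgn 39 (Reg 39 \<oplus> Reg 10) ;; Asgn 22 (Reg 23))
        (\<lambda>s' T'. \<exists>ml'. round_state r R (Suc j) ml' s' \<and> T\<^sub>1 + 22 * sum wt {x \<in> V. ar s' 4 x = Suc j} \<le> T')) ?s1 T\<^sub>2"
      proof (rule wp_frame[OF sweep], elim conjE)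
        fix s' T' assume I: "I s' T'" and 24: "vr s' 24 = length ml" and fr: "frame sweep_com ?s1 s'"
        obtain A nl where car: "carving r R j (j * n) (ar s 4) (ar s 5) A nl s'"
          and i: "\<forall>i<length ml. ml ! i \<notin> A"
            "\<forall>z<j * n. ar s' 8 z = ar s 8 z \<and> ar s' 9 z = ar s 9 z \<and> ar s' 10 z = ar s 10 z"
            "T\<^sub>3 + 8 * sum wt A \<le> T'" using I 24 unfolding I_def by auto
        note c = car[unfolded carving_def]
        have ri: "round_inv r R j (ar s 5) ?M A (set nl) (ar s' 5) (\<lambda>x. rows s' 8 j x) (\<lambda>x. rows s' 9 j x) (\<lambda>x. rows s' 10 j x)"
          using c by blast
        then have sub: "A \<subseteq> ?M" "set nl \<subseteq> ?M" unfolding round_inv_def by blast+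
        have "x \<notin> A" if "x \<in> ?M" for x
        proof -
          have "x \<in> set ml" using that unfolding v(6) .
          then show ?thesis using i(1) unfolding in_set_conv_nth by blast
        qed
        then have A: "A = {}" using sub(1) by blast
        have S': "ar s' 4 x = (if x \<in> set nl then Suc j else ar s 4 x)" if "x \<in> V" for x using c that by blast
        let ?u = "s'\<lparr>vr := (vr s')(21 := Suc j, 39 := j * n + n, 22 := length nl)\<rparr>"
        have sc': "scale_inv r R D (Suc j) (ar s' 4) (ar s' 5) (rows s' 8) (rows s' 9) (rows s' 10)"
        proof (rule round_end[where S = "ar s 4" and H = "ar s 5" and X = "set nl" and dp = "rows s 8" and
              pr = "rows s 9" and rt = "rows s 10" and S' = "ar s' 4" and H' = "ar s' 5" and
              dp' = "rows s' 8" and pr' = "rows s' 9" and rt' = "rows s' 10" and j = j, OF sc])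
          show "round_inv r R j (ar s 5) ?M {} (set nl) (ar s' 5) (rows s' 8 j) (rows s' 9 j) (rows s' 10 j)"
            using ri unfolding A .
          show "x \<in> V \<Longrightarrow> D \<le> wt x" for x by (rule wt_pos(2))
          show "x \<in> V \<Longrightarrow> ar s' 4 x = (if x \<in> set nl then Suc j else ar s 4 x)" for x by (rule S')
          fix i x assume ij: "i < j" and x: "x \<in> V"
          have "i * n + x < Suc i * n" using V_less(1)[OF x] by simp
          also have "\<dots> \<le> j * n" using ij by (intro mult_right_mono) auto
          finally show "rows s' 8 i x = rows s 8 i x \<and> rows s' 9 i x = rows s 9 i x \<and> rows s' 10 i x = rows s 10 i x"
            using i(2) by simp
        qed
        have nlset: "set nl = {x \<in> V. ar s' 4 x = Suc j}"
        proof -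
          have "ar s 4 x \<le> j" if "x \<in> V" for x using sc that unfolding scale_inv_def by blast
          then show ?thesis using S' sub(2) by (fastforce split: if_splits)
        qed
        have fr': "vr s' 10 = n" "vr s' 20 = r" "vr s' 21 = j" "vr s' 39 = j * n" "vr s' 23 = length nl"
          using fr v1 v envD(4)[OF v(9)] c by (auto simp: frame_def)
        have "env s'" by (rule env_frame[OF env1 fr]) auto
        then have "env ?u" by (simp add: env_def)
        then have "round_state r R (Suc j) nl ?u"
          unfolding round_state_def using sc' nlset c A fr' by (simp add: add.commute add.left_commute)
        moreover have "2 * sum wt (set nl) \<le> sum wt ?M" using ri unfolding round_inv_def A by simp
        then have "T\<^sub>1 + 22 * sum wt {x \<in> V. ar s' 4 x = Suc j} \<le> T'"
          using i(3) unfolding nlset[symmetric] T\<^sub>3_def A by simp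
        ultimately show "wp (Asgn 21 (Reg 21 \<oplus> Lit 1) ;; Asgn 39 (Reg 39 \<oplus> Reg 10) ;; Asgn 22 (Reg 23))
          (\<lambda>s' T'. \<exists>ml'. round_state r R (Suc j) ml' s' \<and> T\<^sub>1 + 22 * sum wt {x \<in> V. ar s' 4 x = Suc j} \<le> T') s' T'"
          using num size_bounds(7) by (auto simp: fr')
      qed
      then show ?thesis using size_bounds(8) by simp
    qed
  qed
  then show ?thesis using T0 size_bounds(8) unfolding round_com_def by simp
qed

lemma rounds_wp:
  assumes st: "round_state r R 0 ml s"
    and G: "\<And>g. 3 ^ g \<le> 2 ^ g * (3 * n) \<Longrightarrow> g \<le> G" "4 * r * (G + 3) < 2 ^ w" "4 * r * G + 2 * r \<le> R"
    and T: "T\<^sub>1 + 22 * sum wt V \<le> T"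
  shows "wp rounds_com (\<lambda>s' T'. scale_ok r R (ar s' 4) (ar s' 5) (rows s' 8) (rows s' 9) (rows s' 10) \<and>
     (\<Sum>x\<in>V. Suc (ar s' 4 x)) \<le> 4 * nv \<and> (\<forall>x\<in>V. ar s' 3 x = 0) \<and> env s' \<and> T\<^sub>1 \<le> T') s T"
  unfolding rounds_com_def
proof (rule wp_While[where I = "\<lambda>s' T'. \<exists>j ml. round_state r R j ml s' \<and>
    T\<^sub>1 + 22 * sum wt {x \<in> V. ar s' 4 x = j} \<le> T'"], goal_cases)
  case 1
  have "sum wt {x \<in> V. ar s 4 x = 0} \<le> sum wt V" by (rule sum_wt_le) auto
  then have "T\<^sub>1 + 22 * sum wt {x \<in> V. ar s 4 x = 0} \<le> T" using T by linarith
  then show ?case using st by blast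
next
  case (2 s' T')
  then obtain j ml where j: "round_state r R j ml s'" "T\<^sub>1 + 22 * sum wt {x \<in> V. ar s' 4 x = j} \<le> T'" by blast
  have 22: "vr s' 22 = length ml" using j(1) by (simp add: round_state_def)
  show ?case
  proof (intro conjI impI)
    assume "aval (Lit 0) s' < aval (Reg 22) s'"
    then have "ml \<noteq> []" using 22 by auto
    from round_wp[OF j(1) this G j(2)] have a: "0 < T'" and b: "wp round_com (\<lambda>s'' T''. \<exists>ml'. round_state r R (Suc j) ml' s'' \<and>
      T\<^sub>1 + 22 * sum wt {x \<in> V. ar s'' 4 x = Suc j} \<le> T'') s' (T' - 1)" by blast+
    show "0 < T'" by (rule a)
    show "wp round_com (\<lambda>s' T'. \<exists>j ml. round_state r R j ml s' \<and>
      T\<^sub>1 + 22 * sum wt {x \<in> V. ar s' 4 x = j} \<le> T') s' (T' - 1)" by (rule wp_mono[OF b]) blast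
  qed (use size_bounds(8) in simp_all)
next
  case (3 s' T')
  then obtain j ml where j: "round_state r R j ml s'" "T\<^sub>1 + 22 * sum wt {x \<in> V. ar s' 4 x = j} \<le> T'" by blast
  then have "ml = []" using 3(3) by (simp add: round_state_def)
  then have e: "{x \<in> V. ar s' 4 x = j} = {}" using j(1) by (auto simp: round_state_def)
  have sc: "scale_inv r R D j (ar s' 4) (ar s' 5) (rows s' 8) (rows s' 9) (rows s' 10)"
    using j(1) by (simp add: round_state_def)
  show ?case using scale_done[OF sc e] scale_inv_bound[OF sc] j by (auto simp: round_state_def)
qed

end

section \<open>Writing the tables of one scale\<close>

definition copy_com :: com where
  "copy_com = While (Reg 40) (Rd 4 (Reg 18) \<oplus> Lit 1)
     (Wr 1 (Reg 17) (Rd 10 (Reg 41)) ;; Wr 1 (Reg 17 \<oplus> Lit 1) (Rd 9 (Reg 41)) ;;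
      Wr 1 (Reg 17 \<oplus> Lit 2) (Rd 8 (Reg 41)) ;; Asgn 17 (Reg 17 \<oplus> Lit 3) ;;
      Asgn 41 (Reg 41 \<oplus> Reg 10) ;; Asgn 40 (Reg 40 \<oplus> Lit 1))"

definition place_com :: com where
  "place_com = Asgn 18 (Rd 2 (Reg 24)) ;; Asgn 42 (Reg 38 \<oplus> Lit 3 \<otimes> (Reg 24 \<oplus> Lit 1)) ;;
     Wr 1 (Reg 42) (Reg 17) ;; Wr 1 (Reg 42 \<oplus> Lit 1) (Rd 5 (Reg 18)) ;;
     Wr 1 (Reg 42 \<oplus> Lit 2) (Rd 4 (Reg 18)) ;; Asgn 41 (Reg 18) ;; Asgn 40 (Lit 0) ;; copy_com ;;
     Asgn 24 (Reg 24 \<oplus> Lit 1)"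

text \<open>The base address is stored three words too low, because the indices of vertices start at
  1 and an entry has three words.\<close>

definition layout_com :: com where
  "layout_com = Asgn 38 (Reg 17 \<ominus> Lit 3) ;; Wr 1 (Lit 2 \<oplus> Reg 19) (Reg 38) ;;
     Asgn 17 (Reg 17 \<oplus> Lit 3 \<otimes> Reg 16) ;; Asgn 24 (Lit 0) ;; While (Reg 24) (Reg 16) place_com"

definition reset_com :: com where
  "reset_com = While (Reg 24) (Reg 16)
     (Asgn 18 (Rd 2 (Reg 24)) ;; Wr 4 (Reg 18) (Lit 0) ;; Wr 5 (Reg 18) (Lit 0) ;; Wr 6 (Reg 24) (Reg 18) ;;
      Asgn 24 (Reg 24 \<oplus> Lit 1))"

definition scale_com :: com where
  "scale_com = Asgn 24 (Lit 0) ;; reset_com ;; Asgn 39 (Lit 0) ;; Asgn 21 (Lit 0) ;; Asgn 22 (Reg 16) ;;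
     rounds_com ;; layout_com"

lemma layout_frames [simp]:
  "assigned copy_com = {17, 40, 41}" "written copy_com = {1}" "silent copy_com"
  "assigned place_com = {17, 18, 24, 40, 41, 42}" "written place_com = {1}" "silent place_com"
  "assigned layout_com = {17, 18, 24, 38, 40, 41, 42}" "written layout_com = {1}" "silent layout_com"
  "assigned reset_com = {18, 24}" "written reset_com = {4, 5, 6}" "silent reset_com"
  "assigned scale_com = {17, 18, 21, 22, 23, 24, 25, 26, 27, 28, 29, 30, 31, 32, 33, 34, 35, 36, 38, 39, 40, 41, 42}"
  "written scale_com = {1, 3, 4, 5, 6, 7, 8, 9, 10}" "silent scale_com"
  by (auto simp: copy_com_def place_com_def layout_com_def reset_com_def scale_com_def)

text \<open>The header still changes afterwards, by the base addresses of further scales and by the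
  length in word 0. The lower bounds keep entries and tables behind it, where these changes cannot
  reach them.\<close>

definition placed :: "nat \<Rightarrow> nat set \<Rightarrow> nat \<Rightarrow> (nat \<Rightarrow> nat) \<Rightarrow> nat \<Rightarrow> (nat \<Rightarrow> nat) \<Rightarrow> (nat \<Rightarrow> nat) \<Rightarrow>
    (nat \<Rightarrow> nat \<Rightarrow> nat) \<Rightarrow> (nat \<Rightarrow> nat \<Rightarrow> nat) \<Rightarrow> (nat \<Rightarrow> nat \<Rightarrow> nat) \<Rightarrow> bool" where
  "placed len V K D i S H dp pr rt \<longleftrightarrow> encodes len V K D i S H dp pr rt \<and>
     (\<forall>x\<in>V. 2 + K \<le> entry K D i x \<and> 2 + K \<le> D (entry K D i x))"

text \<open>Another scale writes its own base address and cells from \<open>len\<close> on. The base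
  of scale \<open>i\<close>, the indices and all cells between the header and \<open>len\<close> are
  preserved, and these are all that the entries and tables of scale \<open>i\<close> depend
  on.\<close>

lemma placed_mono:
  assumes p: "placed len V K D i S H dp pr rt" and len: "len \<le> len'" "\<And>x. x \<in> V \<Longrightarrow> 2 + K + x < len"
    and i: "i < K" "i\<^sub>0 < K" "i \<noteq> i\<^sub>0"
    and same: "\<And>z. z < len \<Longrightarrow> z \<noteq> 2 + i\<^sub>0 \<Longrightarrow> D' z = D z"
  shows "placed len' V K D' i S H dp pr rt"
proof -
  have ent: "entry K D' i x = entry K D i x" if "x \<in> V" for x
    using len(2)[OF that] i same[of "2 + i"] same[of "2 + K + x"] unfolding entry_def by auto
  have high: "D' z = D z" if "z < len" "2 + K \<le> z" for z using same[OF that(1)] that(2) i by auto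
  have e: "encodes len V K D i S H dp pr rt" and lo: "\<forall>x\<in>V. 2 + K \<le> entry K D i x \<and> 2 + K \<le> D (entry K D i x)"
    using p unfolding placed_def by blast+
  have *: "2 + K \<le> entry K D i x \<and> 2 + K \<le> D (entry K D i x) \<and> D' (entry K D i x) = D (entry K D i x) \<and>
      entry K D i x + 2 < len' \<and> D' (entry K D i x + 1) = H x \<and> D' (entry K D i x + 2) = S x \<and>
      (\<forall>j\<le>S x. D (entry K D i x) + 3 * j + 2 < len' \<and> D' (D (entry K D i x) + 3 * j) = rt j x \<and>
         D' (D (entry K D i x) + 3 * j + 1) = pr j x \<and> D' (D (entry K D i x) + 3 * j + 2) = dp j x)"
    if x: "x \<in> V" for x
  proof (intro conjI allI impI)
    have l: "2 + K \<le> entry K D i x" "2 + K \<le> D (entry K D i x)" using lo x by auto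
    have ex: "entry K D i x + 2 < len" "D (entry K D i x + 1) = H x" "D (entry K D i x + 2) = S x"
      "\<And>j. j \<le> S x \<Longrightarrow> D (entry K D i x) + 3 * j + 2 < len \<and> D (D (entry K D i x) + 3 * j) = rt j x \<and>
         D (D (entry K D i x) + 3 * j + 1) = pr j x \<and> D (D (entry K D i x) + 3 * j + 2) = dp j x"
      using e x unfolding encodes_def by blast+
    show "2 + K \<le> entry K D i x" "2 + K \<le> D (entry K D i x)" by (rule l)+
    show "D' (entry K D i x) = D (entry K D i x)" by (rule high) (use l ex(1) in linarith)+
    show "entry K D i x + 2 < len'" using ex(1) len(1) by linarith
    show "D' (entry K D i x + 1) = H x" "D' (entry K D i x + 2) = S x"
      using high[of "entry K D i x + 1"] high[of "entry K D i x + 2"] l ex(1-3) by auto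
    fix j assume j: "j \<le> S x"
    let ?a = "D (entry K D i x) + 3 * j"
    have a: "?a + 2 < len" "2 + K \<le> ?a" using ex(4)[OF j] l by auto
    show "?a + 2 < len'" using a len(1) by linarith
    show "D' ?a = rt j x" "D' (?a + 1) = pr j x" "D' (?a + 2) = dp j x"
      using high[of ?a] high[of "?a + 1"] high[of "?a + 2"] ex(4)[OF j] a by auto
  qed
  show ?thesis unfolding placed_def encodes_def
  proof (intro conjI ballI)
    fix x assume x: "x \<in> V"
    note s = *[OF x]
    then have d: "D' (entry K D i x) = D (entry K D i x)" by blast
    show "2 + K \<le> entry K D' i x" "2 + K \<le> D' (entry K D' i x)" "entry K D' i x + 2 < len'"
      "D' (entry K D' i x + 1) = H x" "D' (entry K D' i x + 2) = S x"
      "\<forall>j\<le>S x. D' (entry K D' i x) + 3 * j + 2 < len' \<and> D' (D' (entry K D' i x) + 3 * j) = rt j x \<and>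
         D' (D' (entry K D' i x) + 3 * j + 1) = pr j x \<and> D' (D' (entry K D' i x) + 3 * j + 2) = dp j x"
      unfolding ent[OF x] d using s by blast+
  qed
qed

context construction
begin

lemma row_index_less: "m < 4 * nv \<Longrightarrow> x < n \<Longrightarrow> p \<le> Suc m \<Longrightarrow> p * n + x < W"
proof -
  assume "m < 4 * nv" "x < n" "p \<le> Suc m"
  then have "p \<le> 4 * n" using nv_le by linarith
  then have "p * n \<le> (4 * n) * n" by (rule mult_right_mono) simp
  then have "p * n \<le> 4 * (n * n)" by (simp only: mult.assoc)
  then show ?thesis using \<open>x < n\<close> size_bounds(3) by linarith
qed

lemma copy_wp:
  assumes v: "vr s 10 = n" "vr s 17 = f" "vr s 18 = x" "vr s 40 = 0" "vr s 41 = x"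
    and m: "ar s 4 x = m" "m < 4 * nv" "x < n" and f: "f + 3 * Suc m < W" and T: "Suc m \<le> T"
  shows "wp copy_com (\<lambda>s' T'. vr s' 17 = f + 3 * Suc m \<and> (\<forall>z<f. ar s' 1 z = ar s 1 z) \<and>
     (\<forall>j\<le>m. ar s' 1 (f + 3 * j) = rows s 10 j x \<and> ar s' 1 (f + 3 * j + 1) = rows s 9 j x \<and>
        ar s' 1 (f + 3 * j + 2) = rows s 8 j x) \<and> T' + Suc m = T) s T"
  unfolding copy_com_def
proof (rule wp_While[where I = "\<lambda>s' T'. vr s' 40 \<le> Suc m \<and> vr s' 17 = f + 3 * vr s' 40 \<and>
     vr s' 41 = vr s' 40 * n + x \<and> (\<forall>z<f. ar s' 1 z = ar s 1 z) \<and>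
     (\<forall>j<vr s' 40. ar s' 1 (f + 3 * j) = rows s 10 j x \<and> ar s' 1 (f + 3 * j + 1) = rows s 9 j x \<and>
        ar s' 1 (f + 3 * j + 2) = rows s 8 j x) \<and> T' + vr s' 40 = T"], goal_cases)
  case 1
  show ?case using v by simp
next
  case (2 s' T')
  have fr: "vr s' 10 = n" "vr s' 18 = x" "ar s' 4 x = m" "ar s' 8 = ar s 8" "ar s' 9 = ar s 9" "ar s' 10 = ar s 10"
    using 2(2) v m by (auto simp: frame_def)
  let ?p = "vr s' 40"
  have "3 * Suc m < W" using f by simp
  then have "Suc m < 2 ^ w" using space by simp
  then have xW: "x < W" "Suc m < 2 ^ w" "1 < (2 :: nat) ^ w" using m(3) size_bounds(1,7) by simp_all
  have body: "0 < T' \<and> f + 3 * ?p + 2 < W \<and> ?p * n + x < W \<and> ?p * n + x + n < 2 ^ w \<and> Suc ?p < 2 ^ w \<and>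
      f + 3 * ?p + 3 < 2 ^ w" if "?p < Suc m"
  proof -
    have a: "?p * n + x < W" "Suc ?p * n + x < W"
      using row_index_less[OF m(2,3), of ?p] row_index_less[OF m(2,3), of "Suc ?p"] that by auto
    have b: "f + 3 * ?p + 2 < W" using f that by simp
    have "?p * n + x + n < 2 ^ w" using a(2) space by (simp add: algebra_simps)
    moreover have "Suc ?p < 2 ^ w" "f + 3 * ?p + 3 < 2 ^ w" "0 < T'" using that xW(2) 2(1) T b space by linarith+
    ultimately show ?thesis using a b by blast
  qed
  show ?case
    using 2(1) fr xW body size_bounds(8)[of 2] size_bounds(8)[of 3]
    by (auto simp: less_Suc_eq algebra_simps)
next
  case (3 s' T')
  have "vr s' 18 = x" "ar s' 4 x = m" using 3(2) v m by (auto simp: frame_def)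
  then have "vr s' 40 = Suc m" using 3(1,3) by auto
  then show ?case using 3(1) by (auto simp: less_Suc_eq_le)
qed

lemma sum_list_index: "distinct xs \<Longrightarrow> sum f (set xs) = (\<Sum>i<length xs. f (xs ! i))"
  by (simp add: sum_list_distinct_conv_sum_set[symmetric] sum_list_sum_nth atLeast0LessThan)

definition indexed :: "nat \<Rightarrow> nat list \<Rightarrow> st \<Rightarrow> bool" where
  "indexed K vl s \<longleftrightarrow> distinct vl \<and> set vl = V \<and> vr s 16 = nv \<and> vr s 15 = K \<and>
     (\<forall>q<nv. ar s 2 q = vl ! q \<and> ar s 1 (2 + K + vl ! q) = Suc q)"

text \<open>Three words per entry and three per record give at most
  \<open>3 * nv + 3 * (4 * nv) = 15 * nv\<close> words, written with one iteration per entry and one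
  per record, at most \<open>5 * nv\<close> in all.\<close>

lemma layout_wp:
  assumes ix: "indexed K vl s" and i: "vr s 19 = i" "i < K" and env: "env s"
    and S: "\<And>x. x \<in> V \<Longrightarrow> ar s 4 x < 4 * nv" "(\<Sum>x\<in>V. Suc (ar s 4 x)) \<le> 4 * nv"
    and f: "vr s 17 = f" "2 + K + n \<le> f" "f + 15 * nv + 5 < W"
    and T: "T\<^sub>1 + 5 * nv \<le> T"
  shows "wp layout_com (\<lambda>s' T'. placed (vr s' 17) V K (ar s' 1) i (ar s 4) (ar s 5) (rows s 8) (rows s 9) (rows s 10) \<and>
     (\<forall>z<f. z \<noteq> 2 + i \<longrightarrow> ar s' 1 z = ar s 1 z) \<and> f \<le> vr s' 17 \<and> vr s' 17 \<le> f + 15 * nv \<and> T\<^sub>1 \<le> T') s T"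
proof -
  have vl: "distinct vl" "set vl = V" "vr s 16 = nv" "vr s 15 = K"
    "\<And>q. q < nv \<Longrightarrow> ar s 2 q = vl ! q" "\<And>q. q < nv \<Longrightarrow> ar s 1 (2 + K + vl ! q) = Suc q"
    using ix unfolding indexed_def by blast+
  have len: "length vl = nv" using distinct_card[OF vl(1)] vl(2) card_V by simp
  have v10: "vr s 10 = n" by (rule envD(4)[OF env])
  let ?S = "\<lambda>q. Suc (ar s 4 (vl ! q))"
  let ?\<Sigma> = "\<lambda>q. \<Sum>i<q. ?S i"
  have \<Sigma>: "?\<Sigma> nv \<le> 4 * nv" "?\<Sigma> nv = (\<Sum>x\<in>V. Suc (ar s 4 x))"
    using sum_list_index[OF vl(1), of "\<lambda>x. Suc (ar s 4 x)"] S(2) vl(2) len by simp_all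
  have \<Sigma>_le: "?\<Sigma> q \<le> 4 * nv" if "q \<le> nv" for q
    using sum_mono2[of "{..<nv}" "{..<q}" ?S] that \<Sigma>(1) by auto
  let ?D = "(ar s 1)(2 + i := f - 3)"
  let ?s = "s\<lparr>ar := (ar s)(1 := ?D), vr := (vr s)(38 := f - 3, 17 := f + 3 * nv, 24 := 0)\<rparr>"
  define I where "I = (\<lambda>(s' :: st) T'. vr s' 24 \<le> nv \<and> vr s' 17 = f + 3 * nv + 3 * ?\<Sigma> (vr s' 24) \<and>
     (\<forall>z<f. ar s' 1 z = ?D z) \<and> T' + vr s' 24 + ?\<Sigma> (vr s' 24) = T \<and>
     (\<forall>q<vr s' 24. ar s' 1 (f + 3 * q + 1) = ar s 5 (vl ! q) \<and> ar s' 1 (f + 3 * q + 2) = ar s 4 (vl ! q) \<and>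
        f + 3 * nv \<le> ar s' 1 (f + 3 * q) \<and> ar s' 1 (f + 3 * q) + 3 * ?S q \<le> vr s' 17 \<and>
        (\<forall>j\<le>ar s 4 (vl ! q). ar s' 1 (ar s' 1 (f + 3 * q) + 3 * j) = rows s 10 j (vl ! q) \<and>
           ar s' 1 (ar s' 1 (f + 3 * q) + 3 * j + 1) = rows s 9 j (vl ! q) \<and>
           ar s' 1 (ar s' 1 (f + 3 * q) + 3 * j + 2) = rows s 8 j (vl ! q))))"
  have loop: "wp (While (Reg 24) (Reg 16) place_com) (\<lambda>s' T'. I s' T' \<and> vr s' 24 = nv) ?s T"
  proof (rule wp_While[where I = I], goal_cases)
    case 1
    show ?case unfolding I_def by simp
  next
    case (2 s' T')
    let ?q = "vr s' 24"
    note I = 2(1)[unfolded I_def]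
    have fr: "vr s' 10 = n" "vr s' 16 = nv" "vr s' 38 = f - 3" "ar s' 2 = ar s 2" "ar s' 4 = ar s 4"
      "ar s' 5 = ar s 5" "ar s' 8 = ar s 8" "ar s' 9 = ar s 9" "ar s' 10 = ar s 10"
      using 2(2) vl(3) v10 by (auto simp: frame_def)
    have step: "0 < T' \<and> wp place_com I s' (T' - 1)" if lt: "?q < nv"
    proof -
      let ?x = "vl ! ?q"
      let ?g = "vr s' 17"
      have xV: "?x \<in> V" using nth_mem[of ?q vl] lt len vl(2) by simp
      note xn = V_less(1)[OF xV]
      have \<Sigma>q: "?\<Sigma> (Suc ?q) = ?\<Sigma> ?q + ?S ?q" by simp
      have g: "?g = f + 3 * nv + 3 * ?\<Sigma> ?q" "?g + 3 * ?S ?q \<le> f + 15 * nv" "?g + 3 * ?S ?q < W"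
        using I \<Sigma>_le[of "Suc ?q"] lt f(3) unfolding \<Sigma>q by (linarith | auto)+
      have TT: "T' + ?q + ?\<Sigma> ?q = T" using I by blast
      have T': "0 < T'" "?S ?q \<le> T' - 1" using TT T \<Sigma>_le[of "Suc ?q"] lt unfolding \<Sigma>q by linarith+
      have e: "f - 3 + (3 + 3 * ?q) = f + 3 * ?q" using f(2) i(2) n_pos by simp
      have addr: "f + 3 * ?q + 2 < W" "f + 3 * ?q + 2 < f + 3 * nv" "?q < W" "?x < W" "Suc ?q < 2 ^ w"
        "f + 3 * ?q + 2 < 2 ^ w"
        using lt f(3) nv_le size_bounds(1) xn space by linarith+
      have addr3: "3 * Suc ?q < 2 ^ w" using lt f(3) space by simp
      let ?t = "s'\<lparr>ar := (ar s')(1 := (ar s' 1)(f + 3 * ?q := ?g, f + 3 * ?q + 1 := ar s 5 ?x, f + 3 * ?q + 2 := ar s 4 ?x)),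
        vr := (vr s')(18 := ?x, 42 := f + 3 * ?q, 41 := ?x, 40 := 0)\<rparr>"
      have "wp copy_com (\<lambda>s'' T''. vr s'' 17 = ?g + 3 * ?S ?q \<and> (\<forall>z<?g. ar s'' 1 z = ar ?t 1 z) \<and>
         (\<forall>j\<le>ar s 4 ?x. ar s'' 1 (?g + 3 * j) = rows ?t 10 j ?x \<and> ar s'' 1 (?g + 3 * j + 1) = rows ?t 9 j ?x \<and>
        ar s'' 1 (?g + 3 * j + 2) = rows ?t 8 j ?x) \<and> T'' + ?S ?q = T' - 1) ?t (T' - 1)"
        by (rule copy_wp) (use fr S(1)[OF xV] xn g T' in auto)
      then have "wp copy_com (wp (Asgn 24 (Reg 24 \<oplus> Lit 1)) I) ?t (T' - 1)"
      proof (rule wp_frame, elim conjE)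
        fix s'' T'' assume c: "vr s'' 17 = ?g + 3 * ?S ?q" "\<forall>z<?g. ar s'' 1 z = ar ?t 1 z"
          "\<forall>j\<le>ar s 4 ?x. ar s'' 1 (?g + 3 * j) = rows ?t 10 j ?x \<and> ar s'' 1 (?g + 3 * j + 1) = rows ?t 9 j ?x \<and>
            ar s'' 1 (?g + 3 * j + 2) = rows ?t 8 j ?x" "T'' + ?S ?q = T' - 1" and fr'': "frame copy_com ?t s''"
        have 24: "vr s'' 24 = ?q" using fr'' by (auto simp: frame_def)
        have low: "ar s'' 1 z = ar s' 1 z" if "z < ?g" "z < f + 3 * ?q \<or> f + 3 * ?q + 2 < z" for z
          using c(2) that by auto
        have new: "ar s'' 1 (f + 3 * ?q) = ?g" "ar s'' 1 (f + 3 * ?q + 1) = ar s 5 ?x"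
            "ar s'' 1 (f + 3 * ?q + 2) = ar s 4 ?x"
          using c(2) addr(2) g(1) by auto
        have "I (s''\<lparr>vr := (vr s'')(24 := Suc ?q)\<rparr>) T''"
        proof -
          have "\<forall>z<f. ar s'' 1 z = ?D z"
          proof (intro allI impI)
            fix z assume z: "z < f"
            then have "ar s'' 1 z = ar s' 1 z" using low[of z] g(1) by auto
            also have "\<dots> = ?D z" using I z by blast
            finally show "ar s'' 1 z = ?D z" .
          qed
          moreover have "ar s'' 1 (f + 3 * q + 1) = ar s 5 (vl ! q) \<and> ar s'' 1 (f + 3 * q + 2) = ar s 4 (vl ! q) \<and>
              f + 3 * nv \<le> ar s'' 1 (f + 3 * q) \<and> ar s'' 1 (f + 3 * q) + 3 * ?S q \<le> vr s'' 17 \<and>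
              (\<forall>j\<le>ar s 4 (vl ! q). ar s'' 1 (ar s'' 1 (f + 3 * q) + 3 * j) = rows s 10 j (vl ! q) \<and>
                 ar s'' 1 (ar s'' 1 (f + 3 * q) + 3 * j + 1) = rows s 9 j (vl ! q) \<and>
                 ar s'' 1 (ar s'' 1 (f + 3 * q) + 3 * j + 2) = rows s 8 j (vl ! q))"
            if "q < Suc ?q" for q
          proof (cases "q = ?q")
            case True
            then show ?thesis using new c(1,3) g(1) fr by simp
          next
            case False
            then have q: "q < ?q" using that by simp
            let ?a = "ar s' 1 (f + 3 * q)"
            have old: "ar s' 1 (f + 3 * q + 1) = ar s 5 (vl ! q)" "ar s' 1 (f + 3 * q + 2) = ar s 4 (vl ! q)"
              "f + 3 * nv \<le> ?a" "?a + 3 * ?S q \<le> ?g"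
              "\<forall>j\<le>ar s 4 (vl ! q). ar s' 1 (?a + 3 * j) = rows s 10 j (vl ! q) \<and>
                 ar s' 1 (?a + 3 * j + 1) = rows s 9 j (vl ! q) \<and> ar s' 1 (?a + 3 * j + 2) = rows s 8 j (vl ! q)"
              using I q by blast+
            have cell: "ar s'' 1 (f + 3 * q) = ?a" "ar s'' 1 (f + 3 * q + 1) = ar s' 1 (f + 3 * q + 1)"
              "ar s'' 1 (f + 3 * q + 2) = ar s' 1 (f + 3 * q + 2)"
              using low[of "f + 3 * q"] low[of "f + 3 * q + 1"] low[of "f + 3 * q + 2"] q lt g(1) by auto
            have rec: "ar s'' 1 (?a + 3 * j) = ar s' 1 (?a + 3 * j)"
              "ar s'' 1 (?a + 3 * j + 1) = ar s' 1 (?a + 3 * j + 1)"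
              "ar s'' 1 (?a + 3 * j + 2) = ar s' 1 (?a + 3 * j + 2)" if "j \<le> ar s 4 (vl ! q)" for j
            proof -
              have "?a + 3 * j + 2 < ?g" "f + 3 * ?q + 2 < ?a" using that old(3,4) addr(2) by simp_all
              then show "ar s'' 1 (?a + 3 * j) = ar s' 1 (?a + 3 * j)"
                "ar s'' 1 (?a + 3 * j + 1) = ar s' 1 (?a + 3 * j + 1)"
                "ar s'' 1 (?a + 3 * j + 2) = ar s' 1 (?a + 3 * j + 2)"
                using low[of "?a + 3 * j"] low[of "?a + 3 * j + 1"] low[of "?a + 3 * j + 2"] by auto
            qed
            have "?a + 3 * ?S q \<le> vr s'' 17" using old(4) c(1) by linarith
            then show ?thesis unfolding cell using old rec by simp
          qed
          moreover have "T'' + Suc ?q + ?\<Sigma> (Suc ?q) = T" unfolding \<Sigma>q using c(4) TT T' by linarith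
          moreover have "vr s'' 17 = f + 3 * nv + 3 * ?\<Sigma> (Suc ?q)" unfolding \<Sigma>q using c(1) g(1) by simp
          ultimately show ?thesis unfolding I_def using lt by (simp del: sum.lessThan_Suc)
        qed
        then show "wp (Asgn 24 (Reg 24 \<oplus> Lit 1)) I s'' T''" using addr(5) size_bounds(7) by (simp add: 24)
      qed
      then show ?thesis
        using T' addr addr3 size_bounds(7,8) vl(5)[OF lt] g(3) unfolding place_com_def
        by (simp add: fr e)
    qed
    show ?case
    proof (intro conjI impI)
      assume "aval (Reg 24) s' < aval (Reg 16) s'"
      then have "?q < nv" using fr(2) by simp
      then show "0 < T'" "wp place_com I s' (T' - 1)" using step by blast+
    qed simp_all
  next
    case (3 s' T')
    then show ?case using vl(3) unfolding I_def by (auto simp: frame_def)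
  qed
  have post: "placed (vr s' 17) V K (ar s' 1) i (ar s 4) (ar s 5) (rows s 8) (rows s 9) (rows s 10) \<and>
     (\<forall>z<f. z \<noteq> 2 + i \<longrightarrow> ar s' 1 z = ar s 1 z) \<and> f \<le> vr s' 17 \<and> vr s' 17 \<le> f + 15 * nv \<and> T\<^sub>1 \<le> T'"
    if "I s' T' \<and> vr s' 24 = nv" for s' T'
  proof -
    note I = that[unfolded I_def]
    have 24: "vr s' 24 = nv" and 17: "vr s' 17 = f + 3 * nv + 3 * ?\<Sigma> nv" and low: "\<And>z. z < f \<Longrightarrow> ar s' 1 z = ?D z"
      and TT: "T' + nv + ?\<Sigma> nv = T" using I by auto
    have ent: "\<exists>q<nv. x = vl ! q \<and> entry K (ar s' 1) i x = f + 3 * q" if x: "x \<in> V" for x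
    proof -
      obtain q where q: "q < nv" "x = vl ! q" using x vl(2) len by (metis in_set_conv_nth)
      have "ar s' 1 (2 + K + x) = Suc q"
        using low[of "2 + K + x"] V_less(1)[OF x] f(2) vl(6)[OF q(1)] q(2) i(2) by simp
      moreover have "ar s' 1 (2 + i) = f - 3" using low[of "2 + i"] f(2) i(2) by simp
      moreover have "f - 3 + 3 * Suc q = f + 3 * q" using f(2) i(2) n_pos by simp
      ultimately show ?thesis using q unfolding entry_def by auto
    qed
    have "placed (vr s' 17) V K (ar s' 1) i (ar s 4) (ar s 5) (rows s 8) (rows s 9) (rows s 10)"
      unfolding placed_def encodes_def
    proof (intro conjI ballI)
      fix x assume x: "x \<in> V"
      obtain q where q: "q < nv" "x = vl ! q" "entry K (ar s' 1) i x = f + 3 * q" using ent[OF x] by blast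
      let ?a = "ar s' 1 (f + 3 * q)"
      have r: "ar s' 1 (f + 3 * q + 1) = ar s 5 x" "ar s' 1 (f + 3 * q + 2) = ar s 4 x"
        "f + 3 * nv \<le> ?a" "?a + 3 * Suc (ar s 4 x) \<le> vr s' 17"
        "\<forall>j\<le>ar s 4 x. ar s' 1 (?a + 3 * j) = rows s 10 j x \<and>
           ar s' 1 (?a + 3 * j + 1) = rows s 9 j x \<and> ar s' 1 (?a + 3 * j + 2) = rows s 8 j x"
        using I q(1,2) 24 by blast+
      show "2 + K \<le> entry K (ar s' 1) i x" "2 + K \<le> ar s' 1 (entry K (ar s' 1) i x)"
        "entry K (ar s' 1) i x + 2 < vr s' 17" "ar s' 1 (entry K (ar s' 1) i x + 1) = ar s 5 x"
        "ar s' 1 (entry K (ar s' 1) i x + 2) = ar s 4 x"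
        unfolding q(3) using r 17 q(1) f(2) by (linarith | simp)+
      show "\<forall>j\<le>ar s 4 x. ar s' 1 (entry K (ar s' 1) i x) + 3 * j + 2 < vr s' 17 \<and>
        ar s' 1 (ar s' 1 (entry K (ar s' 1) i x) + 3 * j) = rows s 10 j x \<and>
        ar s' 1 (ar s' 1 (entry K (ar s' 1) i x) + 3 * j + 1) = rows s 9 j x \<and>
        ar s' 1 (ar s' 1 (entry K (ar s' 1) i x) + 3 * j + 2) = rows s 8 j x"
        unfolding q(3) using r(4,5) by auto
    qed
    then show ?thesis using low 17 TT T \<Sigma>(1) by auto
  qed
  have "wp (While (Reg 24) (Reg 16) place_com) (\<lambda>s' T'.
     placed (vr s' 17) V K (ar s' 1) i (ar s 4) (ar s 5) (rows s 8) (rows s 9) (rows s 10) \<and>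
     (\<forall>z<f. z \<noteq> 2 + i \<longrightarrow> ar s' 1 z = ar s 1 z) \<and> f \<le> vr s' 17 \<and> vr s' 17 \<le> f + 15 * nv \<and> T\<^sub>1 \<le> T') ?s T"
    by (rule wp_mono[OF loop]) (rule post)
  moreover have "f < 2 ^ w" "3 \<le> f" "3 * nv < 2 ^ w" "f + 3 * nv < 2 ^ w" "2 + i < W" "2 + i < 2 ^ w"
    using f i(2) n_pos space by linarith+
  ultimately show ?thesis
    using size_bounds(7,8) unfolding layout_com_def by (simp add: f(1) i(1) vl(3))
qed

lemma reset_wp:
  assumes ix: "indexed K vl s" and v: "vr s 24 = 0" and T: "nv \<le> T"
  shows "wp reset_com (\<lambda>s' T'. (\<forall>x\<in>V. ar s' 4 x = 0 \<and> ar s' 5 x = 0) \<and> (\<forall>q<nv. ar s' 6 q = vl ! q) \<and>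
     T' + nv = T) s T"
proof -
  have vl: "distinct vl" "set vl = V" "vr s 16 = nv" "\<And>q. q < nv \<Longrightarrow> ar s 2 q = vl ! q"
    using ix unfolding indexed_def by blast+
  have len: "length vl = nv" using distinct_card[OF vl(1)] vl(2) card_V by simp
  show ?thesis unfolding reset_com_def
  proof (rule wp_While[where I = "\<lambda>s' T'. vr s' 24 \<le> nv \<and>
      (\<forall>x\<in>set (take (vr s' 24) vl). ar s' 4 x = 0 \<and> ar s' 5 x = 0) \<and> (\<forall>q<vr s' 24. ar s' 6 q = vl ! q) \<and>
      T' + vr s' 24 = T"], goal_cases)
    case 1
    show ?case using v T by simp
  next
    case (2 s' T')
    have fr: "vr s' 16 = nv" "ar s' 2 = ar s 2" using 2(2) vl(3) by (auto simp: frame_def)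
    show ?case
    proof (cases "vr s' 24 < nv")
      case True
      have x: "vl ! vr s' 24 \<in> V" using True len vl(2) by auto
      have "take (Suc (vr s' 24)) vl = take (vr s' 24) vl @ [vl ! vr s' 24]"
        using True len by (simp add: take_Suc_conv_app_nth)
      moreover have "vr s' 24 < W" "vl ! vr s' 24 < W" "Suc (vr s' 24) < 2 ^ w"
        using True nv_le V_less(1)[OF x] size_bounds(1) space by linarith+
      ultimately show ?thesis using 2(1) True fr vl(4)[OF True] size_bounds(7,8) T by (auto simp: less_Suc_eq)
    qed (use fr in simp)
  next
    case (3 s' T')
    then have "vr s' 24 = nv" using vl(3) by (auto simp: frame_def)
    then show ?case using 3(1) vl(2) len by simp
  qed
qed

lemma nv_tot: "nv \<le> tot"
proof (cases "nv = 0")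
  case False
  then have "nv * 1 \<le> nv * D" using D_pos by (intro mult_left_mono) auto
  then show ?thesis using nv_D by linarith
qed simp

text \<open>Resetting costs \<open>nv\<close>, the rounds 22 times the total weight, at most
  \<open>44 * tot\<close>, and the layout \<open>5 * nv\<close>; as \<open>nv\<close> is at most
  \<open>tot\<close>, this is within \<open>60 * tot\<close>. The marks are back at 0, as the next
  scale expects.\<close>

lemma scale_wp:
  assumes ix: "indexed K vl s" and i: "vr s 19 = i" "i < K" and env: "env s" and r: "vr s 20 = r"
    and marks: "\<forall>x\<in>V. ar s 3 x = 0"
    and G: "\<And>g. 3 ^ g \<le> 2 ^ g * (3 * n) \<Longrightarrow> g \<le> G" "4 * r * (G + 3) < 2 ^ w" "4 * r * G + 2 * r \<le> R"
    and f: "vr s 17 = f" "2 + K + n \<le> f" "f + 15 * nv + 5 < W"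
    and T: "T\<^sub>1 + 60 * tot \<le> T"
  shows "wp scale_com (\<lambda>s' T'. (\<exists>S H dp pr rt. placed (vr s' 17) V K (ar s' 1) i S H dp pr rt \<and> scale_ok r R S H dp pr rt) \<and>
     (\<forall>z<f. z \<noteq> 2 + i \<longrightarrow> ar s' 1 z = ar s 1 z) \<and> f \<le> vr s' 17 \<and> vr s' 17 \<le> f + 15 * nv \<and>
     (\<forall>x\<in>V. ar s' 3 x = 0) \<and> T\<^sub>1 \<le> T') s T"
proof -
  let ?Q = "\<lambda>s' T'. (\<exists>S H dp pr rt. placed (vr s' 17) V K (ar s' 1) i S H dp pr rt \<and> scale_ok r R S H dp pr rt) \<and>
     (\<forall>z<f. z \<noteq> 2 + i \<longrightarrow> ar s' 1 z = ar s 1 z) \<and> f \<le> vr s' 17 \<and> vr s' 17 \<le> f + 15 * nv \<and>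
     (\<forall>x\<in>V. ar s' 3 x = 0) \<and> T\<^sub>1 \<le> T'"
  have vl: "distinct vl" "set vl = V" "vr s 16 = nv" "vr s 15 = K" using ix unfolding indexed_def by blast+
  have len: "length vl = nv" using distinct_card[OF vl(1)] vl(2) card_V by simp
  let ?s = "s\<lparr>vr := (vr s)(24 := 0)\<rparr>"
  have "wp reset_com (\<lambda>s' T'. (\<forall>x\<in>V. ar s' 4 x = 0 \<and> ar s' 5 x = 0) \<and> (\<forall>q<nv. ar s' 6 q = vl ! q) \<and>
     T' + nv = T) ?s T"
    by (rule reset_wp) (use ix T nv_tot in \<open>auto simp: indexed_def\<close>)
  then have "wp reset_com (wp (Asgn 39 (Lit 0) ;; Asgn 21 (Lit 0) ;; Asgn 22 (Reg 16) ;; rounds_com ;; layout_com) ?Q) ?s T"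
  proof (rule wp_frame, elim conjE)
    fix s\<^sub>1 T\<^sub>2 assume a: "\<forall>x\<in>V. ar s\<^sub>1 4 x = 0 \<and> ar s\<^sub>1 5 x = 0" "\<forall>q<nv. ar s\<^sub>1 6 q = vl ! q" "T\<^sub>2 + nv = T"
      and fr: "frame reset_com ?s s\<^sub>1"
    have v1: "vr s\<^sub>1 x = vr s x" if "x \<noteq> 18" "x \<noteq> 24" for x using fr that by (auto simp: frame_def)
    have a1: "ar s\<^sub>1 b = ar s b" if "b \<notin> {4, 5, 6}" for b using fr that by (auto simp: frame_def)
    let ?t = "s\<^sub>1\<lparr>vr := (vr s\<^sub>1)(39 := 0, 21 := 0, 22 := nv)\<rparr>"
    have envt: "env ?t" using env v1 a1 by (simp add: env_def)
    have "scale_inv r R D 0 (ar ?t 4) (ar ?t 5) (rows ?t 8) (rows ?t 9) (rows ?t 10)"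
      by (rule scale_init) (use a(1) in auto)
    moreover have "set vl = {x \<in> V. ar s\<^sub>1 4 x = 0}" using a(1) vl(2) by auto
    ultimately have rs: "round_state r R 0 vl ?t"
      unfolding round_state_def using envt a vl(1) len marks by (simp add: v1 a1 r)
    have tt: "(T\<^sub>1 + 5 * nv) + 22 * sum wt V \<le> T\<^sub>2" using T a(3) nv_tot size_bounds(4) by linarith
    have "wp rounds_com (\<lambda>s' T'. scale_ok r R (ar s' 4) (ar s' 5) (rows s' 8) (rows s' 9) (rows s' 10) \<and>
     (\<Sum>x\<in>V. Suc (ar s' 4 x)) \<le> 4 * nv \<and> (\<forall>x\<in>V. ar s' 3 x = 0) \<and> env s' \<and> T\<^sub>1 + 5 * nv \<le> T') ?t T\<^sub>2"
      by (rule rounds_wp[OF rs G tt])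
    then have "wp rounds_com (wp layout_com ?Q) ?t T\<^sub>2"
    proof (rule wp_frame, elim conjE)
      fix s\<^sub>2 T\<^sub>3 assume ok: "scale_ok r R (ar s\<^sub>2 4) (ar s\<^sub>2 5) (rows s\<^sub>2 8) (rows s\<^sub>2 9) (rows s\<^sub>2 10)"
        and S: "(\<Sum>x\<in>V. Suc (ar s\<^sub>2 4 x)) \<le> 4 * nv" and m: "\<forall>x\<in>V. ar s\<^sub>2 3 x = 0" and env2: "env s\<^sub>2"
        and T3: "T\<^sub>1 + 5 * nv \<le> T\<^sub>3" and fr2: "frame rounds_com ?t s\<^sub>2"
      have v2: "vr s\<^sub>2 15 = K" "vr s\<^sub>2 16 = nv" "vr s\<^sub>2 17 = f" "vr s\<^sub>2 19 = i" "ar s\<^sub>2 1 = ar s 1" "ar s\<^sub>2 2 = ar s 2"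
        using fr2 vl f(1) i(1) by (auto simp: frame_def v1 a1)
      have "indexed K vl s\<^sub>2" using ix v2 unfolding indexed_def by simp
      moreover have "ar s\<^sub>2 4 x < 4 * nv" if "x \<in> V" for x
      proof -
        have "Suc (ar s\<^sub>2 4 x) \<le> (\<Sum>x\<in>V. Suc (ar s\<^sub>2 4 x))" using finite_V that by (intro member_le_sum) auto
        then show ?thesis using S by simp
      qed
      ultimately have "wp layout_com (\<lambda>s' T'. placed (vr s' 17) V K (ar s' 1) i (ar s\<^sub>2 4) (ar s\<^sub>2 5) (rows s\<^sub>2 8) (rows s\<^sub>2 9) (rows s\<^sub>2 10) \<and>
        (\<forall>z<f. z \<noteq> 2 + i \<longrightarrow> ar s' 1 z = ar s\<^sub>2 1 z) \<and> f \<le> vr s' 17 \<and> vr s' 17 \<le> f + 15 * nv \<and> T\<^sub>1 \<le> T') s\<^sub>2 T\<^sub>3"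
        by (intro layout_wp i(2) env2 S f(2,3) T3 v2(3,4))
      then show "wp layout_com ?Q s\<^sub>2 T\<^sub>3"
      proof (rule wp_frame, elim conjE)
        fix s' T' assume p: "placed (vr s' 17) V K (ar s' 1) i (ar s\<^sub>2 4) (ar s\<^sub>2 5) (rows s\<^sub>2 8) (rows s\<^sub>2 9) (rows s\<^sub>2 10)"
          and o: "\<forall>z<f. z \<noteq> 2 + i \<longrightarrow> ar s' 1 z = ar s\<^sub>2 1 z" "f \<le> vr s' 17" "vr s' 17 \<le> f + 15 * nv" "T\<^sub>1 \<le> T'"
          and fr3: "frame layout_com s\<^sub>2 s'"
        have "ar s' 3 = ar s\<^sub>2 3" using fr3 by (auto simp: frame_def)
        then have "\<forall>x\<in>V. ar s' 3 x = 0" using m by simp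
        moreover have "\<exists>S H dp pr rt. placed (vr s' 17) V K (ar s' 1) i S H dp pr rt \<and> scale_ok r R S H dp pr rt"
          by (intro exI conjI, rule p, rule ok)
        ultimately show "?Q s' T'" using o v2(5) by simp
      qed
    qed
    then show "wp (Asgn 39 (Lit 0) ;; Asgn 21 (Lit 0) ;; Asgn 22 (Reg 16) ;; rounds_com ;; layout_com) ?Q s\<^sub>1 T\<^sub>2"
      using size_bounds(8) v1[of 16] vl(3) by simp
  qed
  then show ?thesis using size_bounds(8) unfolding scale_com_def by simp
qed

end

section \<open>All scales and the output\<close>

definition scales_com :: com where
  "scales_com = While (Reg 19) (Reg 15) (scale_com ;; Asgn 20 (Reg 20 \<otimes> Reg 14) ;; Asgn 19 (Reg 19 \<oplus> Lit 1))"

definition emit_com :: com where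
  "emit_com = Wr 1 (Lit 0) (Reg 17) ;; Asgn 18 (Lit 0) ;;
     While (Reg 18) (Reg 17) (Out (Rd 1 (Reg 18)) ;; Asgn 18 (Reg 18 \<oplus> Lit 1))"

definition log_com :: com where
  "log_com = While (Lit 0) (Reg 18) (Asgn 18 (Reg 18 \<oslash> Lit 2) ;; Asgn 12 (Reg 12 \<oplus> Lit 1))"

text \<open>Numbers the vertices of positive degree from 1 on and leaves index 0 to the isolated
  ones. The marks are cleared here since the memory may initially contain anything.\<close>

definition list_com :: com where
  "list_com = While (Reg 18) (Reg 10)
     (Wr 3 (Reg 18) (Lit 0) ;;
      Cond (Rd 0 (Lit 5 \<oplus> Reg 18)) (Rd 0 (Lit 6 \<oplus> Reg 18))
        (Wr 2 (Reg 16) (Reg 18) ;; Asgn 16 (Reg 16 \<oplus> Lit 1) ;; Wr 1 (Lit 2 \<oplus> Reg 15 \<oplus> Reg 18) (Reg 16))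
        (Wr 1 (Lit 2 \<oplus> Reg 15 \<oplus> Reg 18) (Lit 0)) ;;
      Asgn 18 (Reg 18 \<oplus> Lit 1))"

text \<open>Registers 12 to 15 receive \<open>L\<close>, \<open>b\<close>, \<open>2 ^ b\<close> and
  \<open>K\<close>. Register 37 becomes the average degree; on a graph without edges this divides by
  zero, which yields 0.\<close>

definition construct_com :: com where
  "construct_com =
     Asgn 10 (Rd 0 (Lit 0)) ;; Asgn 11 (Rd 0 (Lit 2)) ;; Asgn 12 (Lit 0) ;; Asgn 18 (Reg 10) ;; log_com ;;
     Asgn 13 (Reg 12 \<oslash> Reg 11 \<oslash> Lit 2 \<oplus> Lit 1) ;; Asgn 14 (Bin Shl (Lit 1) (Reg 13)) ;;
     Asgn 15 (Reg 12 \<oslash> Reg 13 \<oplus> Lit 2) ;; Asgn 43 (Rd 0 (Lit 5 \<oplus> Reg 10)) ;;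
     Asgn 16 (Lit 0) ;; Asgn 18 (Lit 0) ;; list_com ;;
     Wr 1 (Lit 1) (Reg 15) ;; Asgn 17 (Lit 2 \<oplus> Reg 15 \<oplus> Reg 10) ;; Asgn 37 (Reg 43 \<oslash> Reg 16) ;;
     Asgn 20 (Lit 1) ;; Asgn 19 (Lit 0) ;; scales_com ;; emit_com"

context construction
begin

text \<open>The constant \<open>B = 4 * G + 2\<close> is the depth of the trees in units of the
  radius: the last annulus begins at depth at most \<open>4 * r * G\<close>, and the cut is
  \<open>2 * r\<close> further out.\<close>

lemma scales_wp:
  assumes ix: "indexed K vl s" and env: "env s" and v: "vr s 19 = 0" "vr s 20 = 1" "vr s 14 = 2 ^ b" "vr s 17 = 2 + K + n"
    and marks: "\<forall>x\<in>V. ar s 3 x = 0"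
    and G: "\<And>g. 3 ^ g \<le> 2 ^ g * (3 * n) \<Longrightarrow> g \<le> G" "\<And>i. i < K \<Longrightarrow> 4 * 2 ^ (b * i) * (G + 3) < 2 ^ w"
    and B: "B = 4 * G + 2" and K: "2 ^ (b * K) < (2 :: nat) ^ w"
    and space': "2 + K + n + 15 * nv * K + 5 < W"
    and T: "T\<^sub>1 + K * (60 * tot + 1) \<le> T"
  shows "wp scales_com (\<lambda>s' T'.
     (\<forall>i<K. \<exists>S H dp pr rt. placed (vr s' 17) V K (ar s' 1) i S H dp pr rt \<and>
        scale_ok (2 ^ (b * i)) (B * 2 ^ (b * i)) S H dp pr rt) \<and>
     (\<forall>z<2 + K + n. z < 2 \<or> 2 + K \<le> z \<longrightarrow> ar s' 1 z = ar s 1 z) \<and> 2 + K + n \<le> vr s' 17 \<and>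
     vr s' 17 \<le> 2 + K + n + 15 * nv * K \<and> T\<^sub>1 \<le> T') s T"
proof -
  define I where "I = (\<lambda>(s' :: st) T'. vr s' 19 \<le> K \<and> vr s' 20 = 2 ^ (b * vr s' 19) \<and> indexed K vl s' \<and> env s' \<and>
     (\<forall>x\<in>V. ar s' 3 x = 0) \<and>
     (\<forall>i<vr s' 19. \<exists>S H dp pr rt. placed (vr s' 17) V K (ar s' 1) i S H dp pr rt \<and>
        scale_ok (2 ^ (b * i)) (B * 2 ^ (b * i)) S H dp pr rt) \<and>
     (\<forall>z<2 + K + n. z < 2 \<or> 2 + K \<le> z \<longrightarrow> ar s' 1 z = ar s 1 z) \<and> 2 + K + n \<le> vr s' 17 \<and>
     vr s' 17 \<le> 2 + K + n + 15 * nv * vr s' 19 \<and> T\<^sub>1 + (K - vr s' 19) * (60 * tot + 1) \<le> T')"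
  have K15: "vr s 15 = K" using ix by (simp add: indexed_def)
  show ?thesis unfolding scales_com_def
  proof (rule wp_While[where I = I], goal_cases)
    case 1
    show ?case unfolding I_def using ix env v marks T by simp
  next
    case (2 s' T')
    note I = 2(1)[unfolded I_def]
    let ?i = "vr s' 19" and ?f = "vr s' 17"
    have fr: "vr s' 15 = K" "vr s' 14 = 2 ^ b" using 2(2) v K15 by (auto simp: frame_def)
    have step: "0 < T' \<and> wp (scale_com ;; Asgn 20 (Reg 20 \<otimes> Reg 14) ;; Asgn 19 (Reg 19 \<oplus> Lit 1)) I s' (T' - 1)"
      if lt: "?i < K"
    proof -
      have "15 * nv * Suc ?i \<le> 15 * nv * K" using lt by (intro mult_left_mono) auto
      then have f: "?f + 15 * nv + 5 < W" using I space' by (simp add: algebra_simps)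
      have Suc_K: "K - ?i = Suc (K - Suc ?i)" using lt by simp
      have "(K - ?i) * (60 * tot + 1) = (60 * tot + 1) + (K - Suc ?i) * (60 * tot + 1)"
        by (subst Suc_K) (rule mult_Suc)
      moreover have "T\<^sub>1 + (K - ?i) * (60 * tot + 1) \<le> T'" using I by blast
      ultimately have "T\<^sub>1 + (60 * tot + 1) + (K - Suc ?i) * (60 * tot + 1) \<le> T'" by linarith
      then have T': "0 < T'" "(T\<^sub>1 + (K - Suc ?i) * (60 * tot + 1)) + 60 * tot \<le> T' - 1" by linarith+
      have R: "4 * 2 ^ (b * ?i) * G + 2 * 2 ^ (b * ?i) \<le> B * 2 ^ (b * ?i)" unfolding B by (simp add: algebra_simps)
      have ix': "indexed K vl s'" and env': "env s'" and 20: "vr s' 20 = 2 ^ (b * ?i)" and m: "\<forall>x\<in>V. ar s' 3 x = 0"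
        and lo: "2 + K + n \<le> ?f" using I by blast+
      have pw: "2 ^ (b * Suc ?i) < (2 :: nat) ^ w"
      proof -
        have "b * Suc ?i \<le> b * K" using lt by (intro mult_left_mono) auto
        then have "(2 :: nat) ^ (b * Suc ?i) \<le> 2 ^ (b * K)" by (rule power_increasing) simp
        then show ?thesis using K by linarith
      qed
      have num: "Suc ?i < 2 ^ w" using lt space' space by linarith
      have "wp scale_com (\<lambda>s'' T''. (\<exists>S H dp pr rt. placed (vr s'' 17) V K (ar s'' 1) ?i S H dp pr rt \<and>
          scale_ok (2 ^ (b * ?i)) (B * 2 ^ (b * ?i)) S H dp pr rt) \<and>
         (\<forall>z<?f. z \<noteq> 2 + ?i \<longrightarrow> ar s'' 1 z = ar s' 1 z) \<and> ?f \<le> vr s'' 17 \<and> vr s'' 17 \<le> ?f + 15 * nv \<and>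
         (\<forall>x\<in>V. ar s'' 3 x = 0) \<and> T\<^sub>1 + (K - Suc ?i) * (60 * tot + 1) \<le> T'') s' (T' - 1)"
        by (rule scale_wp[OF ix' refl lt env' 20 m G(1) G(2)[OF lt] R refl lo f T'(2)])
      then have "wp scale_com (wp (Asgn 20 (Reg 20 \<otimes> Reg 14) ;; Asgn 19 (Reg 19 \<oplus> Lit 1)) I) s' (T' - 1)"
      proof (rule wp_frame, elim conjE)
        fix s'' T'' assume p: "\<exists>S H dp pr rt. placed (vr s'' 17) V K (ar s'' 1) ?i S H dp pr rt \<and>
            scale_ok (2 ^ (b * ?i)) (B * 2 ^ (b * ?i)) S H dp pr rt"
          and o: "\<forall>z<?f. z \<noteq> 2 + ?i \<longrightarrow> ar s'' 1 z = ar s' 1 z" "?f \<le> vr s'' 17" "vr s'' 17 \<le> ?f + 15 * nv"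
            "\<forall>x\<in>V. ar s'' 3 x = 0" "T\<^sub>1 + (K - Suc ?i) * (60 * tot + 1) \<le> T''"
          and fr'': "frame scale_com s' s''"
        have v'': "vr s'' 14 = 2 ^ b" "vr s'' 15 = K" "vr s'' 16 = vr s' 16" "vr s'' 19 = ?i" "vr s'' 20 = 2 ^ (b * ?i)"
          "ar s'' 2 = ar s' 2"
          using fr'' fr 20 by (auto simp: frame_def)
        have env'': "env s''" by (rule env_frame[OF env' fr'']) auto
        let ?u = "s''\<lparr>vr := (vr s'')(20 := 2 ^ (b * Suc ?i), 19 := Suc ?i)\<rparr>"
        have cell: "ar s'' 1 (2 + K + x) = ar s' 1 (2 + K + x)" if "x < n" for x
          using o(1)[rule_format, of "2 + K + x"] lo lt that by auto
        have "indexed K vl ?u"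
          unfolding indexed_def
        proof (intro conjI allI impI)
          fix q assume q: "q < nv"
          have "vl ! q \<in> V"
            using ix' q distinct_card[of vl] card_V nth_mem[of q vl] unfolding indexed_def by auto
          then show "ar ?u 1 (2 + K + vl ! q) = Suc q"
            using cell[OF V_less(1)] ix' q unfolding indexed_def by simp
        qed (use ix' v'' in \<open>auto simp: indexed_def\<close>)
        moreover have "env ?u" using env'' by (simp add: env_def)
        moreover have "\<exists>S H dp pr rt. placed (vr s'' 17) V K (ar s'' 1) i S H dp pr rt \<and>
            scale_ok (2 ^ (b * i)) (B * 2 ^ (b * i)) S H dp pr rt" if i: "i < Suc ?i" for i
        proof (cases "i = ?i")
          case False
          then have "i < ?i" using i by simp
          then obtain S H dp pr rt where old: "placed ?f V K (ar s' 1) i S H dp pr rt"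
            "scale_ok (2 ^ (b * i)) (B * 2 ^ (b * i)) S H dp pr rt" using I by blast
          have "placed (vr s'' 17) V K (ar s'' 1) i S H dp pr rt"
            by (rule placed_mono[OF old(1) o(2), of ?i]) (use V_less(1) lo \<open>i < ?i\<close> lt o(1) in fastforce)+
          then show ?thesis using old(2) by blast
        qed (use p in simp)
        moreover have "\<forall>z<2 + K + n. z < 2 \<or> 2 + K \<le> z \<longrightarrow> ar s'' 1 z = ar s 1 z"
        proof (intro allI impI)
          fix z assume z: "z < 2 + K + n" "z < 2 \<or> 2 + K \<le> z"
          then have "ar s'' 1 z = ar s' 1 z" using o(1) lo lt by auto
          also have "\<dots> = ar s 1 z" using I z by blast
          finally show "ar s'' 1 z = ar s 1 z" .
        qed
        moreover have "vr s'' 17 \<le> 2 + K + n + 15 * nv * Suc ?i" using I o(3) by (simp add: algebra_simps)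
        ultimately have "I ?u T''" unfolding I_def using o lo lt by simp
        then show "wp (Asgn 20 (Reg 20 \<otimes> Reg 14) ;; Asgn 19 (Reg 19 \<oplus> Lit 1)) I s'' T''"
          using num pw size_bounds(7) by (simp add: v'' power_add[symmetric] add.commute)
      qed
      then show ?thesis using T'(1) by simp
    qed
    show ?case
    proof (intro conjI impI)
      assume "aval (Reg 19) s' < aval (Reg 15) s'"
      then have "?i < K" using fr by simp
      then show "0 < T'" "wp (scale_com ;; Asgn 20 (Reg 20 \<otimes> Reg 14) ;; Asgn 19 (Reg 19 \<oplus> Lit 1)) I s' (T' - 1)"
        using step by blast+
    qed simp_all
  next
    case (3 s' T')
    then have "vr s' 19 = K" using K15 unfolding I_def by (auto simp: frame_def)
    then show ?case using 3(1) unfolding I_def by auto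
  qed
qed

end

context machine
begin

lemma emit_wp:
  assumes "vr s 17 = f" "0 < f" "f < W" "ou s = []" "T\<^sub>1 + f \<le> T"
  shows "wp emit_com (\<lambda>s' T'. ou s' = map ((ar s 1)(0 := f)) [0..<f] \<and> T\<^sub>1 \<le> T') s T"
proof -
  let ?D = "(ar s 1)(0 := f)"
  let ?s = "s\<lparr>ar := (ar s)(1 := ?D), vr := (vr s)(18 := 0)\<rparr>"
  have w: "f < 2 ^ w" "1 < (2 :: nat) ^ w" using assms space by linarith+
  have "wp (While (Reg 18) (Reg 17) (Out (Rd 1 (Reg 18)) ;; Asgn 18 (Reg 18 \<oplus> Lit 1)))
     (\<lambda>s' T'. ou s' = map ?D [0..<f] \<and> T\<^sub>1 \<le> T') ?s T"
  proof (rule wp_While[where I = "\<lambda>s' T'. vr s' 18 \<le> f \<and> ou s' = map ?D [0..<vr s' 18] \<and>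
      T\<^sub>1 + (f - vr s' 18) \<le> T'"], goal_cases)
    case 1
    show ?case using assms by simp
  next
    case (2 s' T')
    have fr: "vr s' 17 = f" "ar s' 1 = ?D" using 2(2) assms(1) by (auto simp: frame_def)
    show ?case using 2(1) fr w assms(3) by auto
  next
    case (3 s' T')
    then have "vr s' 18 = f" using assms(1) by (auto simp: frame_def)
    then show ?case using 3(1) by simp
  qed
  then show ?thesis unfolding emit_com_def using assms w by simp
qed

lemma log_wp:
  assumes "vr s 12 = 0" "floorlog 2 (vr s 18) < 2 ^ w" "2 < (2 :: nat) ^ w" "T\<^sub>1 + floorlog 2 (vr s 18) \<le> T"
  shows "wp log_com (\<lambda>s' T'. vr s' 12 = floorlog 2 (vr s 18) \<and> T\<^sub>1 \<le> T') s T"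
  unfolding log_com_def
proof (rule wp_While[where I = "\<lambda>s' T'. vr s' 12 + floorlog 2 (vr s' 18) = floorlog 2 (vr s 18) \<and>
    T\<^sub>1 + floorlog 2 (vr s' 18) \<le> T'"], goal_cases)
  case 1
  show ?case using assms by simp
next
  case (2 s' T')
  have "floorlog 2 (vr s' 18) = Suc (floorlog 2 (vr s' 18 div 2))" if "0 < vr s' 18"
    using that by (subst compute_floorlog) simp
  then show ?case using 2(1) assms by auto
next
  case (3 s' T')
  then have "vr s' 18 = 0" by simp
  then show ?case using 3(1) by (simp add: compute_floorlog)
qed

lemma list_wp:
  assumes v: "vr s 10 = n" "vr s 15 = K" "vr s 16 = 0" "vr s 18 = 0"
    and off: "\<And>x. x < n \<Longrightarrow> ar s 0 (5 + x) = off x" "\<And>x. x < n \<Longrightarrow> ar s 0 (6 + x) = off (Suc x)"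
    and P: "P = (\<lambda>x. off x < off (Suc x))"
    and num: "8 + K + n < W" and T: "T\<^sub>1 + n \<le> T"
  shows "wp list_com (\<lambda>s' T'. vr s' 16 = length (filter P [0..<n]) \<and>
     (\<forall>q<vr s' 16. ar s' 2 q = filter P [0..<n] ! q \<and> ar s' 1 (2 + K + filter P [0..<n] ! q) = Suc q) \<and>
     (\<forall>x<n. ar s' 3 x = 0 \<and> (\<not> P x \<longrightarrow> ar s' 1 (2 + K + x) = 0)) \<and> T\<^sub>1 \<le> T') s T"
  unfolding list_com_def
proof (rule wp_While[where I = "\<lambda>s' T'. vr s' 18 \<le> n \<and> vr s' 16 = length (filter P [0..<vr s' 18]) \<and>
     (\<forall>q<vr s' 16. ar s' 2 q = filter P [0..<vr s' 18] ! q \<and> ar s' 1 (2 + K + filter P [0..<vr s' 18] ! q) = Suc q) \<and>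
     (\<forall>x<vr s' 18. ar s' 3 x = 0 \<and> (\<not> P x \<longrightarrow> ar s' 1 (2 + K + x) = 0)) \<and> T\<^sub>1 + (n - vr s' 18) \<le> T'"], goal_cases)
  case 1
  show ?case using v T by simp
next
  case (2 s' T')
  let ?x = "vr s' 18" and ?l = "filter P [0..<vr s' 18]"
  have fr: "vr s' 10 = n" "vr s' 15 = K" "ar s' 0 = ar s 0" using 2(2) v by (auto simp: frame_def)
  have I: "vr s' 16 = length ?l" "\<And>q. q < length ?l \<Longrightarrow> ar s' 2 q = ?l ! q \<and> ar s' 1 (2 + K + ?l ! q) = Suc q"
    "\<And>x. x < ?x \<Longrightarrow> ar s' 3 x = 0 \<and> (\<not> P x \<longrightarrow> ar s' 1 (2 + K + x) = 0)" "T\<^sub>1 + (n - ?x) \<le> T'"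
    using 2(1) by auto
  show ?case
  proof (cases "?x < n")
    case True
    have lt: "?l ! q < ?x" if "q < length ?l" for q using nth_mem[OF that] by auto
    have ne: "?l ! q \<noteq> ?x" if "q < length ?l" for q using lt[OF that] by simp
    have len: "length ?l \<le> ?x" using length_filter_le[of P "[0..<?x]"] by simp
    have num': "?x < W" "5 + ?x < W" "6 + ?x < W" "2 + K + ?x < W" "length ?l < W" "5 + ?x < 2 ^ w" "6 + ?x < 2 ^ w"
      "2 + K + ?x < 2 ^ w" "2 + K < 2 ^ w" "Suc ?x < 2 ^ w" "Suc (length ?l) < 2 ^ w" "1 < (2 :: nat) ^ w"
      "5 < (2 :: nat) ^ w" "6 < (2 :: nat) ^ w" "2 < (2 :: nat) ^ w"
      using True num len space by linarith+
    show ?thesis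
    proof (cases "P ?x")
      case P1: True
      then have "off ?x < off (Suc ?x)" using P by simp
      then show ?thesis
        using True num' P1 lt I off[OF True] by (auto simp: fr nth_append less_Suc_eq ne)
    next
      case P0: False
      then have "\<not> off ?x < off (Suc ?x)" using P by simp
      then show ?thesis
        using True num' P0 lt I off[OF True] by (auto simp: fr less_Suc_eq ne)
    qed
  qed (use fr in simp)
next
  case (3 s' T')
  then have "vr s' 18 = n" using v by (auto simp: frame_def)
  then show ?case using 3(1) by auto
qed

end

text \<open>Word 0 receives the final length only when everything else is in place. Base addresses,
  indices, entries and tables all lie at addresses from 2 on.\<close>

lemma placed_header:
  assumes "placed len V K D i S H dp pr rt"
  shows "encodes len V K (D(0 := c)) i S H dp pr rt"
proof -
  have e: "encodes len V K D i S H dp pr rt" and lo: "\<forall>x\<in>V. 2 + K \<le> entry K D i x \<and> 2 + K \<le> D (entry K D i x)"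
    using assms unfolding placed_def by blast+
  have ent: "entry K (D(0 := c)) i x = entry K D i x" for x by (simp add: entry_def)
  show ?thesis unfolding encodes_def
  proof
    fix x assume x: "x \<in> V"
    then have "2 + K \<le> entry K D i x" "2 + K \<le> D (entry K D i x)" using lo by auto
    then show "entry K (D(0 := c)) i x + 2 < len \<and> (D(0 := c)) (entry K (D(0 := c)) i x + 1) = H x \<and>
      (D(0 := c)) (entry K (D(0 := c)) i x + 2) = S x \<and>
      (\<forall>j\<le>S x. (D(0 := c)) (entry K (D(0 := c)) i x) + 3 * j + 2 < len \<and>
        (D(0 := c)) ((D(0 := c)) (entry K (D(0 := c)) i x) + 3 * j) = rt j x \<and>
        (D(0 := c)) ((D(0 := c)) (entry K (D(0 := c)) i x) + 3 * j + 1) = pr j x \<and>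
        (D(0 := c)) ((D(0 := c)) (entry K (D(0 := c)) i x) + 3 * j + 2) = dp j x)"
      unfolding ent using e x unfolding encodes_def by simp
  qed
qed

context construction
begin

text \<open>The summands of \<open>T\<close> are the iterations for the binary length of
  \<open>n\<close>, for the list of vertices, for the scales, and for emitting at most
  \<open>2 + K + n + 15 * nv * K\<close> words.\<close>

lemma construct_wp:
  assumes s: "ar s 0 0 = n" "ar s 0 2 = k" "\<And>x. x \<le> n \<Longrightarrow> ar s 0 (5 + x) = off x"
      "\<And>a. a < tot \<Longrightarrow> ar s 0 (6 + n + a) = nb a" "ou s = []"
    and tot: "off n = tot" "D = tot div nv"
    and L: "L = floorlog 2 n" "b = L div k div 2 + 1" "K = L div b + 2" "L + 2 < 2 ^ w" "2 ^ b < (2 :: nat) ^ w"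
    and G: "\<And>g. 3 ^ g \<le> 2 ^ g * (3 * n) \<Longrightarrow> g \<le> G" "\<And>i. i < K \<Longrightarrow> 4 * 2 ^ (b * i) * (G + 3) < 2 ^ w"
    and B: "B = 4 * G + 2" and K: "2 ^ (b * K) < (2 :: nat) ^ w"
    and space': "8 + K + n + 15 * nv * K < W"
    and T: "T = L + n + K * (60 * tot + 1) + (2 + K + n + 15 * nv * K)"
  shows "wp construct_com (\<lambda>s' T'. \<exists>Dm len. ou s' = map Dm [0..<len] \<and> Dm 0 = len \<and> Dm 1 = K \<and> 2 + K + n \<le> len \<and>
     len \<le> 2 + K + n + 15 * nv * K \<and> (\<forall>x<n. 0 < Dm (2 + K + x) \<longleftrightarrow> x \<in> V) \<and>
     (\<forall>i<K. \<exists>S H dp pr rt. encodes len V K Dm i S H dp pr rt \<and>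
        scale_ok (2 ^ (b * i)) (B * 2 ^ (b * i)) S H dp pr rt)) s T"
proof -
  let ?Q = "\<lambda>s' T'. \<exists>Dm len. ou s' = map Dm [0..<len] \<and> Dm 0 = len \<and> Dm 1 = K \<and> 2 + K + n \<le> len \<and>
     len \<le> 2 + K + n + 15 * nv * K \<and> (\<forall>x<n. 0 < Dm (2 + K + x) \<longleftrightarrow> x \<in> V) \<and>
     (\<forall>i<K. \<exists>S H dp pr rt. encodes len V K Dm i S H dp pr rt \<and>
        scale_ok (2 ^ (b * i)) (B * 2 ^ (b * i)) S H dp pr rt)"
  define P where "P = (\<lambda>x. off x < off (Suc x))"
  define T4 where "T4 = 2 + K + n + 15 * nv * K"
  define T3 where "T3 = T4 + K * (60 * tot + 1)"
  let ?l = "filter P [0..<n]"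
  have vl: "distinct ?l" "set ?l = V" by (auto simp: P_def V_eq)
  have lv: "length ?l = nv" using distinct_card[OF vl(1)] vl(2) card_V by simp
  let ?s1 = "s\<lparr>vr := (vr s)(10 := n, 11 := k, 12 := 0, 18 := n)\<rparr>"
  let ?c4 = "Wr 1 (Lit 1) (Reg 15) ;; Asgn 17 (Lit 2 \<oplus> Reg 15 \<oplus> Reg 10) ;; Asgn 37 (Reg 43 \<oslash> Reg 16) ;;
     Asgn 20 (Lit 1) ;; Asgn 19 (Lit 0) ;; scales_com ;; emit_com"
  let ?c2 = "Asgn 13 (Reg 12 \<oslash> Reg 11 \<oslash> Lit 2 \<oplus> Lit 1) ;; Asgn 14 (Bin Shl (Lit 1) (Reg 13)) ;;
     Asgn 15 (Reg 12 \<oslash> Reg 13 \<oplus> Lit 2) ;; Asgn 43 (Rd 0 (Lit 5 \<oplus> Reg 10)) ;;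
     Asgn 16 (Lit 0) ;; Asgn 18 (Lit 0) ;; list_com ;; ?c4"
  have num: "n < 2 ^ w" "5 + n < W" "5 + n < 2 ^ w" "2 + K + n < W" "2 + K + n < 2 ^ w" "2 + K < 2 ^ w" "2 < W" "0 < W"
    "1 < W" "K < 2 ^ w"
    using space' space by linarith+
  have bb: "L div k div 2 + 1 < 2 ^ w" "L div b + 2 < 2 ^ w"
  proof -
    have "L div k div 2 \<le> L" "L div b \<le> L" by (meson div_le_dividend le_trans)+
    then show "L div k div 2 + 1 < 2 ^ w" "L div b + 2 < 2 ^ w" using L(4) by linarith+
  qed
  have log: "wp log_com (\<lambda>s' T'. vr s' 12 = floorlog 2 (vr ?s1 18) \<and> T3 + n \<le> T') ?s1 T"
    by (rule log_wp) (use L(1,4) size_bounds(8)[of 2] T in \<open>auto simp: T3_def T4_def\<close>)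
  have "wp log_com (wp ?c2 ?Q) ?s1 T"
  proof (rule wp_frame[OF log], elim conjE)
    fix s\<^sub>2 T\<^sub>2 assume l: "vr s\<^sub>2 12 = floorlog 2 (vr ?s1 18)" and T2: "T3 + n \<le> T\<^sub>2" and fr: "frame log_com ?s1 s\<^sub>2"
    have v2: "vr s\<^sub>2 10 = n" "vr s\<^sub>2 11 = k" "vr s\<^sub>2 12 = L" "ar s\<^sub>2 = ar s" "ou s\<^sub>2 = []"
      using fr l L(1) s(5) by (auto simp: frame_def log_com_def)
    let ?s3 = "s\<^sub>2\<lparr>vr := (vr s\<^sub>2)(13 := b, 14 := 2 ^ b, 15 := K, 43 := tot, 16 := 0, 18 := 0)\<rparr>"
    have list: "wp list_com (\<lambda>s' T'. vr s' 16 = length ?l \<and>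
     (\<forall>q<vr s' 16. ar s' 2 q = ?l ! q \<and> ar s' 1 (2 + K + ?l ! q) = Suc q) \<and>
     (\<forall>x<n. ar s' 3 x = 0 \<and> (\<not> P x \<longrightarrow> ar s' 1 (2 + K + x) = 0)) \<and> T3 \<le> T') ?s3 T\<^sub>2"
    proof (rule list_wp[OF _ _ _ _ _ _ P_def])
      show "ar ?s3 0 (6 + x) = off (Suc x)" if "x < n" for x using s(3)[of "Suc x"] that v2 by simp
    qed (use v2 s(3) space' T2 in auto)
    have "wp list_com (wp ?c4 ?Q) ?s3 T\<^sub>2"
    proof (rule wp_frame[OF list], elim conjE)
      fix s\<^sub>4 T\<^sub>4 assume a: "vr s\<^sub>4 16 = length ?l" "\<forall>q<vr s\<^sub>4 16. ar s\<^sub>4 2 q = ?l ! q \<and> ar s\<^sub>4 1 (2 + K + ?l ! q) = Suc q"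
        "\<forall>x<n. ar s\<^sub>4 3 x = 0 \<and> (\<not> P x \<longrightarrow> ar s\<^sub>4 1 (2 + K + x) = 0)" "T3 \<le> T\<^sub>4" and fr4: "frame list_com ?s3 s\<^sub>4"
      have v4: "vr s\<^sub>4 10 = n" "vr s\<^sub>4 14 = 2 ^ b" "vr s\<^sub>4 15 = K" "vr s\<^sub>4 43 = tot" "ar s\<^sub>4 0 = ar s 0" "ou s\<^sub>4 = []" "vr s\<^sub>4 16 = nv"
        using fr4 v2 a(1) lv by (auto simp: frame_def list_com_def)
      let ?s5 = "s\<^sub>4\<lparr>ar := (ar s\<^sub>4)(1 := (ar s\<^sub>4 1)(1 := K)), vr := (vr s\<^sub>4)(17 := 2 + K + n, 37 := D, 20 := 1, 19 := 0)\<rparr>"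
      have ix: "indexed K ?l ?s5" unfolding indexed_def using vl a(2) v4 by auto
      have env5: "env ?s5" unfolding env_def
      proof (intro conjI allI impI)
        fix x assume "x < n"
        then show "ar ?s5 0 (6 + x) = off (Suc x)" using s(3)[of "Suc x"] v4 by simp
      qed (use s v4 in auto)
      have "wp scales_com (\<lambda>s' T'.
        (\<forall>i<K. \<exists>S H dp pr rt. placed (vr s' 17) V K (ar s' 1) i S H dp pr rt \<and>
          scale_ok (2 ^ (b * i)) (B * 2 ^ (b * i)) S H dp pr rt) \<and>
        (\<forall>z<2 + K + n. z < 2 \<or> 2 + K \<le> z \<longrightarrow> ar s' 1 z = ar ?s5 1 z) \<and> 2 + K + n \<le> vr s' 17 \<and>
        vr s' 17 \<le> 2 + K + n + 15 * nv * K \<and> T4 \<le> T') ?s5 T\<^sub>4"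
        by (rule scales_wp[OF ix env5 _ _ _ _ _ G B K])
          (use v4 a V_less(1) space' in \<open>auto simp: T3_def\<close>)
      then have "wp scales_com (wp emit_com ?Q) ?s5 T\<^sub>4"
      proof (rule wp_frame, elim conjE)
        fix s\<^sub>6 T\<^sub>6 assume p: "\<forall>i<K. \<exists>S H dp pr rt. placed (vr s\<^sub>6 17) V K (ar s\<^sub>6 1) i S H dp pr rt \<and>
            scale_ok (2 ^ (b * i)) (B * 2 ^ (b * i)) S H dp pr rt"
          and o: "\<forall>z<2 + K + n. z < 2 \<or> 2 + K \<le> z \<longrightarrow> ar s\<^sub>6 1 z = ar ?s5 1 z" "2 + K + n \<le> vr s\<^sub>6 17"
            "vr s\<^sub>6 17 \<le> 2 + K + n + 15 * nv * K" "T4 \<le> T\<^sub>6" and fr6: "frame scales_com ?s5 s\<^sub>6"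
        let ?f = "vr s\<^sub>6 17"
        have ou: "ou s\<^sub>6 = []" using fr6 v4 by (simp add: frame_def scales_com_def)
        have emit: "wp emit_com (\<lambda>s' T'. ou s' = map ((ar s\<^sub>6 1)(0 := ?f)) [0..<?f] \<and> 0 \<le> T') s\<^sub>6 T\<^sub>6"
          by (rule emit_wp) (use o space' ou in \<open>auto simp: T4_def\<close>)
        have idx: "0 < ((ar s\<^sub>6 1)(0 := ?f)) (2 + K + x) \<longleftrightarrow> x \<in> V" if x: "x < n" for x
        proof -
          have eq: "ar s\<^sub>6 1 (2 + K + x) = ar s\<^sub>4 1 (2 + K + x)" using o(1)[rule_format, of "2 + K + x"] x by simp
          show ?thesis
          proof (cases "x \<in> V")
            case True
            then obtain q where "q < nv" "x = ?l ! q" using vl(2) lv by (metis in_set_conv_nth)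
            then show ?thesis using eq a(2) v4 True by simp
          next
            case False
            then have "\<not> P x" using x by (auto simp: V_eq P_def)
            then show ?thesis using eq a(3) x False by simp
          qed
        qed
        have enc: "\<exists>S H dp pr rt. encodes ?f V K ((ar s\<^sub>6 1)(0 := ?f)) i S H dp pr rt \<and>
            scale_ok (2 ^ (b * i)) (B * 2 ^ (b * i)) S H dp pr rt" if i: "i < K" for i
        proof -
          obtain S H dp pr rt where pl: "placed ?f V K (ar s\<^sub>6 1) i S H dp pr rt"
            and ok: "scale_ok (2 ^ (b * i)) (B * 2 ^ (b * i)) S H dp pr rt"
            using p[rule_format, OF i] by (elim exE conjE)
          from placed_header[OF pl] ok show ?thesis by (intro exI conjI)
        qed
        have one: "ar s\<^sub>6 1 1 = K" using o(1)[rule_format, of 1] by simp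
        show "wp emit_com ?Q s\<^sub>6 T\<^sub>6"
        proof (rule wp_mono[OF emit], intro exI conjI)
          fix s' T' assume "ou s' = map ((ar s\<^sub>6 1)(0 := ?f)) [0..<?f] \<and> (0 :: nat) \<le> T'"
          then show "ou s' = map ((ar s\<^sub>6 1)(0 := ?f)) [0..<?f]" ..
        qed (use o idx enc one in simp_all)
      qed
      moreover have "2 + K + n < 2 ^ w" "tot div nv = D" using num tot by simp_all
      ultimately show "wp ?c4 ?Q s\<^sub>4 T\<^sub>4"
        using num size_bounds(8) v4 by simp
    qed
    then show "wp ?c2 ?Q s\<^sub>2 T\<^sub>2"
      using num size_bounds(8) v2 s(3)[of n] tot bb L(2,3,5) by simp
  qed
  then show ?thesis
    unfolding construct_com_def using num size_bounds(8) s(1,2) by simp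
qed

end

section \<open>Sizes\<close>

definition offset :: "nat list list \<Rightarrow> nat \<Rightarrow> nat" where
  "offset adj x = length (concat (take x adj))"

lemma offset_Suc: "x < length adj \<Longrightarrow> offset adj (Suc x) = offset adj x + length (adj ! x)"
  by (simp add: offset_def take_Suc_conv_app_nth)

lemma offset_mono: "offset adj x \<le> offset adj (Suc x)"
  by (cases "x < length adj") (simp_all add: offset_Suc, simp add: offset_def)

lemma offset_total: "offset adj (length adj) = length (concat adj)"
  by (simp add: offset_def)

lemma offset_le: "offset adj x \<le> length (concat adj)"
proof -
  have "concat adj = concat (take x adj) @ concat (drop x adj)"
    by (metis append_take_drop_id concat_append)
  then show ?thesis unfolding offset_def by (metis length_append le_add1)
qed

lemma concat_nth:
  assumes "x < length adj" "j < length (adj ! x)"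
  shows "concat adj ! (offset adj x + j) = adj ! x ! j"
proof -
  have "concat adj = concat (take x adj) @ adj ! x @ concat (drop (Suc x) adj)"
    using assms(1) by (metis concat.simps(2) concat_append id_take_nth_drop)
  then show ?thesis using assms(2) by (simp add: offset_def nth_append)
qed

lemma concat_nth_image:
  assumes "x < length adj"
  shows "(!) (concat adj) ` {offset adj x..<offset adj (Suc x)} = set (adj ! x)"
proof (intro equalityI subsetI)
  fix y assume "y \<in> (!) (concat adj) ` {offset adj x..<offset adj (Suc x)}"
  then obtain a where a: "offset adj x \<le> a" "a < offset adj (Suc x)" "y = concat adj ! a" by auto
  have j: "a - offset adj x < length (adj ! x)" using a offset_Suc[OF assms] by simp
  have "y = adj ! x ! (a - offset adj x)" using concat_nth[OF assms j] a by simp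
  then show "y \<in> set (adj ! x)" using j by simp
next
  fix y assume "y \<in> set (adj ! x)"
  then obtain j where j: "j < length (adj ! x)" "y = adj ! x ! j" by (metis in_set_conv_nth)
  have "y = concat adj ! (offset adj x + j)" using concat_nth[OF assms j(1)] j(2) by simp
  then show "y \<in> (!) (concat adj) ` {offset adj x..<offset adj (Suc x)}"
    using j(1) offset_Suc[OF assms] by (intro image_eqI[of _ _ "offset adj x + j"]) simp_all
qed

lemma simple_edge:
  assumes "simple_graph n E" "{x, y} \<in> E"
  shows "x < n" "y < n" "x \<noteq> y"
proof -
  have "{x, y} \<in> {{u, v} | u v. u < n \<and> v < n \<and> u \<noteq> v}"
    using assms unfolding simple_graph_def by blast
  then show "x < n" "y < n" "x \<noteq> y" by (auto simp: doubleton_eq_iff)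
qed

lemma simple_edges:
  assumes "simple_graph n E"
  shows "finite E" "card E \<le> n * n"
proof -
  have sub: "E \<subseteq> (\<lambda>(u, v). {u, v}) ` ({..<n} \<times> {..<n})"
    using assms unfolding simple_graph_def by auto
  show "finite E" by (rule finite_subset[OF sub]) simp
  show "card E \<le> n * n" using surj_card_le[OF _ sub] by simp
qed

section \<open>The graph behind the adjacency lists\<close>

locale graph_lists =
  fixes n :: nat and E :: "nat set set" and adj :: "nat list list"
  assumes simple: "simple_graph n E" and adj: "adj_lists n E adj"
begin

abbreviation nbrs :: "nat \<Rightarrow> nat set" where "nbrs x \<equiv> {y. {x, y} \<in> E}"

definition verts :: "nat set" where "verts = {x. x < n \<and> offset adj x < offset adj (Suc x)}"

lemma length_adj: "length adj = n" using adj by (simp add: adj_lists_def)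

lemma set_adj: "x < n \<Longrightarrow> set (adj ! x) = nbrs x" using adj by (simp add: adj_lists_def)

lemma length_nth_adj: "x < n \<Longrightarrow> length (adj ! x) = card (nbrs x)"
  using adj distinct_card[of "adj ! x"] by (simp add: adj_lists_def)

lemma nbrs_less: "nbrs x \<subseteq> {..<n}" using simple_edge[OF simple] by auto

lemma finite_nbrs: "finite (nbrs x)" using nbrs_less finite_subset by blast

lemma verts_nonempty: "x \<in> verts \<longleftrightarrow> (\<exists>y. {x, y} \<in> E)"
proof
  assume "x \<in> verts"
  then have "x < n" "0 < length (adj ! x)" using offset_Suc[of x adj] length_adj by (auto simp: verts_def)
  then show "\<exists>y. {x, y} \<in> E" using set_adj[of x] by (metis (mono_tags) length_pos_if_in_set
      length_greater_0_conv mem_Collect_eq nth_mem)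
next
  assume "\<exists>y. {x, y} \<in> E"
  then obtain y where y: "{x, y} \<in> E" by blast
  then have x: "x < n" using simple_edge[OF simple] by blast
  then have "y \<in> set (adj ! x)" using set_adj y by simp
  then show "x \<in> verts" using offset_Suc[of x adj] length_adj x length_pos_if_in_set by (auto simp: verts_def)
qed

lemma nbrs_sub: "nbrs x \<subseteq> verts"
  using verts_nonempty by (auto simp: insert_commute)

lemma verts_less: "verts \<subseteq> {..<n}" by (auto simp: verts_def)

lemma finite_verts: "finite verts" using verts_less finite_subset by blast

lemma isolated_eq: "isolated n E = {..<n} - verts"
proof -
  have "(\<forall>e\<in>E. v \<notin> e) \<longleftrightarrow> v \<notin> verts" for v
  proof
    assume v: "\<forall>e\<in>E. v \<notin> e"
    show "v \<notin> verts" using v by (auto simp: verts_nonempty)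
  next
    assume v: "v \<notin> verts"
    show "\<forall>e\<in>E. v \<notin> e"
    proof (intro ballI notI)
      fix e assume e: "e \<in> E" "v \<in> e"
      then obtain x y where "e = {x, y}" using simple unfolding simple_graph_def by blast
      then have "{v, x} \<in> E \<or> {v, y} \<in> E" using e by (auto simp: insert_commute)
      then show False using v verts_nonempty by blast
    qed
  qed
  then show ?thesis by (auto simp: isolated_def)
qed

lemma card_verts_isolated: "card verts + card (isolated n E) = n"
  using card_Diff_subset[OF finite_verts verts_less] card_mono[OF _ verts_less] by (simp add: isolated_eq)

lemma length_concat_adj: "length (concat adj) = (\<Sum>x<n. length (adj ! x))"
  by (simp add: length_concat sum_list_sum_nth length_adj atLeast0LessThan)

lemma length_concat_verts: "length (concat adj) = (\<Sum>x\<in>verts. length (adj ! x))"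
  unfolding length_concat_adj
proof (rule sum.mono_neutral_right)
  show "\<forall>x\<in>{..<n} - verts. length (adj ! x) = 0"
    using offset_Suc[of _ adj] length_adj by (auto simp: verts_def)
qed (use verts_less in auto)

lemma verts_le_total: "card verts \<le> length (concat adj)"
proof -
  have "(\<Sum>x\<in>verts. 1) \<le> (\<Sum>x\<in>verts. length (adj ! x))"
    by (rule sum_mono) (use offset_Suc[of _ adj] length_adj in \<open>auto simp: verts_def Suc_le_eq\<close>)
  then show ?thesis by (simp add: length_concat_verts)
qed

lemma total_le_square: "length (concat adj) \<le> n * n"
proof -
  have "length (concat adj) \<le> (\<Sum>x<n. n)" unfolding length_concat_adj
    by (rule sum_mono) (use length_nth_adj card_mono[OF _ nbrs_less] in simp)
  then show ?thesis by simp
qed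

text \<open>Entries of the lists are ordered pairs of neighbours, and a set arises from at most two
  ordered pairs.\<close>

lemma total_le_edges: "length (concat adj) \<le> 2 * card E"
proof -
  have "length (concat adj) = card (SIGMA x:{..<n}. nbrs x)"
    using length_concat_adj length_nth_adj finite_nbrs by simp
  also have "\<dots> \<le> card (\<Union>e\<in>E. {(x, y). {x, y} = e})"
  proof (rule card_mono)
    have "(\<Union>e\<in>E. {(x, y). {x, y} = e}) \<subseteq> {..<n} \<times> {..<n}" using simple_edge[OF simple] by auto
    then show "finite (\<Union>e\<in>E. {(x, y). {x, y} = e})" using finite_subset by blast
  qed auto
  also have "\<dots> \<le> (\<Sum>e\<in>E. card {(x, y). {x, y} = e})"
    by (rule card_UN_le[OF simple_edges(1)[OF simple]])
  also have "\<dots> \<le> (\<Sum>e\<in>E. 2)"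
  proof (rule sum_mono)
    fix e assume "e \<in> E"
    then obtain u v where "e = {u, v}" using simple unfolding simple_graph_def by blast
    then have "{(x, y). {x, y} = e} \<subseteq> {(u, v), (v, u)}" by (auto simp: doubleton_eq_iff)
    from card_mono[OF _ this] show "card {(x, y). {x, y} = e} \<le> 2"
      using card_insert_le_m1[of 2 "{(v, u)}" "(u, v)"] by simp
  qed
  finally show ?thesis by simp
qed

end

section \<open>Numerical estimates\<close>

lemma floorlog_facts:
  assumes "1 \<le> n" "L = floorlog 2 n"
  shows "1 \<le> L" "n < 2 ^ L" "2 ^ L \<le> 2 * n" "L \<le> n"
proof -
  have L: "2 ^ (L - 1) \<le> n" "n < 2 ^ L" using floorlog_bounds[of n 2] assms by simp_all
  show "1 \<le> L" using L(2) assms(1) by (cases L) simp_all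
  then show "2 ^ L \<le> 2 * n" using L(1) by (cases L) simp_all
  have "L - 1 < 2 ^ (L - 1)" by (rule less_exp)
  then show "L \<le> n" using L(1) by linarith
qed (use floorlog_bounds[of n 2] assms in simp)

text \<open>\<open>b\<close> is the least integer above \<open>L / (2 k)\<close>, so
  \<open>L div b\<close> is below \<open>2 * k\<close> and \<open>K\<close> is linear in
  \<open>k\<close>; since \<open>b\<close> is at least 1, \<open>K\<close> is also at most
  \<open>L + 2\<close>. The last index \<open>K - 1 = L div b + 1\<close> is the least one whose
  exponent \<open>b * (K - 1)\<close> exceeds \<open>L\<close>.\<close>

lemma scale_count:
  fixes L k :: nat
  assumes "1 \<le> k" "b = L div k div 2 + 1" "K = L div b + 2"
  shows "b \<le> L + 1" "K \<le> L + 2" "K \<le> 2 * k + 2" "L < b * (K - 1)" "b * (K - 1) \<le> 2 * L + 1" "b * K \<le> 3 * L + 2"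
proof -
  have "L div k div 2 \<le> L" by (meson div_le_dividend le_trans)
  then show b: "b \<le> L + 1" using assms(2) by simp
  show "K \<le> L + 2" using assms(3) by simp
  have "b = L div (k * 2) + 1" using assms(2) by (simp add: div_mult2_eq)
  then have "L < k * 2 * b" using dividend_less_times_div[of "k * 2" L] assms(1) by simp
  then have "L div b < k * 2" using less_mult_imp_div_less by blast
  then show "K \<le> 2 * k + 2" using assms(3) by simp
  have K: "K - 1 = L div b + 1" "K = L div b + 2" using assms(3) by simp_all
  show "L < b * (K - 1)" using dividend_less_times_div[of b L] assms(2) K by simp
  have le: "b * (L div b) \<le> L" by simp
  have "b * (L div b + 1) = b * (L div b) + b" by simp
  then show "b * (K - 1) \<le> 2 * L + 1" unfolding K(1) using le b by linarith
  have "b * (L div b + 2) = b * (L div b) + 2 * b" by simp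
  then show "b * K \<le> 3 * L + 2" unfolding K(2) using le b by linarith
qed

text \<open>The input caps \<open>k\<close> at the largest word. Where the cap takes effect, both
  \<open>k\<close> and the cap exceed \<open>L\<close>, and the quotient is 0 either way.\<close>

lemma div_min_large:
  fixes L k M :: nat
  assumes "L < M" "1 \<le> k"
  shows "L div min k M = L div k"
  using assms by (cases "k \<le> M") (simp_all add: min_def)

text \<open>Two annuli multiply the weight by 9/4, more than 2: from 8 being at most 9 it follows
  that \<open>2 ^ (g div 2)\<close> is at most \<open>(3/2) ^ g\<close>, hence at most
  \<open>3 * n\<close>.\<close>

lemma growth_rounds:
  fixes n g :: nat
  assumes "n < 2 ^ L" "3 ^ g \<le> 2 ^ g * (3 * n)"
  shows "g \<le> 2 * L + 4"
proof -
  define h r where "h = g div 2" and "r = g mod 2"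
  have g: "g = 2 * h + r" "r < 2" by (simp_all add: h_def r_def)
  have "(2 :: nat) ^ g * 2 ^ h = 8 ^ h * 2 ^ r"
    by (simp add: g power_add power_mult flip: power_mult_distrib)
  also have "\<dots> \<le> 9 ^ h * 3 ^ r" by (intro mult_mono power_mono) simp_all
  also have "\<dots> = 3 ^ g" by (simp add: g power_add power_mult)
  finally have "(2 :: nat) ^ g * 2 ^ h \<le> 3 ^ g" .
  then have "(2 :: nat) ^ g * 2 ^ h \<le> 2 ^ g * (3 * n)" using assms(2) by (rule order_trans)
  then have "(2 :: nat) ^ h \<le> 3 * n" by simp
  also have "\<dots> < 2 ^ (L + 2)" using assms(1) by simp
  finally have "h < L + 2" by (rule power_less_imp_less_exp[rotated]) simp
  then show ?thesis using g by simp
qed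

text \<open>Keeps the radii of the growing balls within a word: \<open>e\<close> is the exponent of
  the radius of a scale, and \<open>2 * L + 4\<close> bounds the number of annuli.\<close>

lemma radius_fits:
  assumes "1 \<le> L" "e \<le> 2 * L + 1"
  shows "4 * 2 ^ e * (2 * L + 4 + 3) < (2 :: nat) ^ (12 * L)"
proof -
  have lin: "2 * L + 4 + 3 \<le> 8 * 2 ^ L" using less_exp[of L] by linarith
  have "(2 :: nat) ^ e \<le> 2 ^ (2 * L + 1)" using assms(2) by (intro power_increasing) simp_all
  then have "4 * 2 ^ e * (2 * L + 4 + 3) \<le> 4 * 2 ^ (2 * L + 1) * (8 * 2 ^ L)"
    by (intro mult_le_mono lin le_refl)
  also have "\<dots> = (2 :: nat) ^ (2 + (2 * L + 1) + (3 + L))" by (simp only: power_add) simp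
  also have "\<dots> < 2 ^ (12 * L)" using assms(1) by (intro power_strict_increasing) simp_all
  finally show ?thesis .
qed

text \<open>The array length \<open>(n + 1) ^ 8\<close> is reached from \<open>n\<close> by one
  increment and three squarings, and sixteen arrays take at most \<open>2 ^ (4 + 8 * L)\<close>
  words. As \<open>L\<close> is at least 1, words of \<open>12 * L\<close> bits suffice; this is the
  constant 12 of the theorem. The excess \<open>(n + 1) ^ 6\<close> over the square is at least
  64.\<close>

lemma word_sizes:
  fixes n :: nat
  assumes "1 \<le> n" "1 \<le> L" "n < 2 ^ L"
  shows "16 * (n + 1) ^ 8 \<le> 2 ^ (12 * L)" "64 * (n + 1)\<^sup>2 \<le> (n + 1) ^ 8"
proof -
  have "(n + 1) ^ 8 \<le> (2 ^ L) ^ 8" using assms(3) by (intro power_mono) simp_all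
  then have "16 * (n + 1) ^ 8 \<le> 2 ^ 4 * 2 ^ (8 * L)" by (simp add: power_mult mult.commute)
  also have "\<dots> = 2 ^ (4 + 8 * L)" by (simp add: power_add)
  also have "\<dots> \<le> 2 ^ (12 * L)" using assms(2) by (intro power_increasing) simp_all
  finally show "16 * (n + 1) ^ 8 \<le> 2 ^ (12 * L)" .
  have "(2 :: nat) ^ 6 \<le> (n + 1) ^ 6" using assms(1) by (intro power_mono) simp_all
  then have "2 ^ 6 * (n + 1)\<^sup>2 \<le> (n + 1) ^ 6 * (n + 1)\<^sup>2" by (rule mult_right_mono) simp
  then show "64 * (n + 1)\<^sup>2 \<le> (n + 1) ^ 8" by (simp flip: power_add)
qed

lemma space_fits:
  fixes n nv K :: nat
  assumes "64 * (n + 1)\<^sup>2 \<le> W" "nv \<le> n" "K \<le> n + 2"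
  shows "8 + K + n + 15 * nv * K < W"
proof -
  have "15 * nv * K \<le> 15 * n * (n + 2)" using assms(2,3) by (intro mult_mono) simp_all
  also have "\<dots> = 15 * n\<^sup>2 + 30 * n" by (simp add: power2_eq_square algebra_simps)
  finally show ?thesis using assms(1,3) by (simp add: power2_eq_square algebra_simps)
qed

text \<open>With \<open>y = n^(1/r)\<close>, the inequality between \<open>ln y\<close> and
  \<open>y - 1\<close> gives a bound of \<open>r * (y - 1)\<close> on \<open>ln n\<close>. It is
  applied with \<open>r = t\<close> for the construction time and with \<open>r = 2 k\<close> for
  the stretch.\<close>

lemma floorlog_le_powr:
  fixes r :: real
  assumes "1 \<le> n" "2 ^ L \<le> 2 * n" "1 \<le> r"
  shows "real L \<le> 3 * r * n powr (1 / r)" "1 \<le> real n powr (1 / r)"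
proof -
  let ?y = "real n powr (1 / r)"
  show y: "1 \<le> ?y" using assms by (simp add: ge_one_powr_ge_zero)
  have "ln (1 / 2 :: real) \<le> 1 / 2 - 1" by (rule ln_le_minus_one) simp
  then have ln2: "1 / 2 \<le> ln (2 :: real)" by (simp add: ln_div)
  have "real (2 ^ L) \<le> real (2 * n)" using assms(2) of_nat_le_iff by blast
  then have "ln (2 ^ L) \<le> ln (2 * real n)" using assms(1) by (subst ln_le_cancel_iff) simp_all
  then have "L * ln 2 \<le> ln 2 + ln n" using assms(1) by (simp add: ln_mult ln_realpow)
  moreover have "ln n \<le> r * (?y - 1)"
  proof -
    have "ln n = r * ln ?y" using assms(1,3) by simp
    also have "\<dots> \<le> r * (?y - 1)" using y assms(1,3) by (intro mult_left_mono ln_le_minus_one) simp_all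
    finally show ?thesis .
  qed
  ultimately have "L * ln 2 \<le> ln 2 + r * (?y - 1)" by simp
  also have "r * (?y - 1) \<le> 2 * ln 2 * (r * (?y - 1))"
    using ln2 assms(3) y mult_right_mono[of 1 "2 * ln 2" "r * (?y - 1)"] by simp
  finally have "L * ln 2 \<le> (1 + 2 * (r * (?y - 1))) * ln 2" by (simp add: algebra_simps)
  then have "L \<le> 1 + 2 * (r * (?y - 1))" by simp
  moreover have "1 \<le> r * ?y" using mult_mono[of 1 r 1 ?y] assms(3) y by simp
  ultimately show "real L \<le> 3 * r * ?y" using assms(3) by (simp add: algebra_simps)
qed

text \<open>With \<open>y = n^(1/(2k))\<close>, the ratio \<open>2 ^ b\<close> is at most
  \<open>4 * y\<close>, and twice the depth factor is at most \<open>52 * L\<close>, where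
  \<open>L\<close> is at most \<open>6 * k * y\<close>. The product is
  \<open>4 * 52 * 6 = 1248\<close> times \<open>k * y * y\<close>.\<close>

lemma stretch_bound:
  assumes n: "1 \<le> n" "2 ^ L \<le> 2 * n" and L: "1 \<le> L" and k: "1 \<le> k" and b: "b = L div k div 2 + 1"
  shows "real (2 ^ b * (2 * (4 * (2 * L + 4) + 2))) \<le> 1248 * (real k * real n powr (1 / real k))"
proof -
  let ?y = "real n powr (1 / (2 * real k))"
  have b': "b - 1 = L div (k * 2)" using b by (simp add: div_mult2_eq)
  have "b - 1 \<le> real L / (2 * real k)"
    unfolding b' using of_nat_div_le_of_nat[of L "k * 2", where ?'a = real] by (simp add: mult.commute)
  then have "2 powr (b - 1) \<le> 2 powr (real L * (1 / (2 * real k)))" by (intro powr_mono) simp_all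
  also have "\<dots> = (2 ^ L) powr (1 / (2 * real k))" by (simp add: powr_powr flip: powr_realpow)
  also have "\<dots> \<le> (2 * real n) powr (1 / (2 * real k))"
  proof (rule powr_mono2)
    have "real (2 ^ L) \<le> real (2 * n)" using n(2) of_nat_le_iff by blast
    then show "2 ^ L \<le> 2 * real n" by simp
  qed simp_all
  also have "\<dots> = 2 powr (1 / (2 * real k)) * ?y" by (simp add: powr_mult)
  also have "\<dots> \<le> 2 powr 1 * ?y" using k by (intro mult_right_mono powr_mono) simp_all
  finally have "2 ^ (b - 1) \<le> 2 * ?y" by (simp add: powr_realpow)
  then have two: "real (2 ^ b) \<le> 4 * ?y" using b by simp
  have "real L \<le> 3 * (2 * real k) * ?y" by (rule floorlog_le_powr) (use n k in simp_all)
  then have "real (2 * (4 * (2 * L + 4) + 2)) \<le> 52 * (3 * (2 * real k) * ?y)" using L by simp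
  then have "real (2 ^ b) * real (2 * (4 * (2 * L + 4) + 2)) \<le> 4 * ?y * (52 * (3 * (2 * real k) * ?y))"
    using two by (intro mult_mono) simp_all
  also have "\<dots> = 1248 * (real k * (?y * ?y))" by simp
  also have "?y * ?y = real n powr (1 / real k)" by (simp flip: powr_add)
  finally show ?thesis by simp
qed

text \<open>Terms linear in \<open>n\<close> are absorbed through \<open>n = nv + iso\<close>: there
  are at most \<open>tot\<close> vertices with neighbours, and the isolated ones remain as a
  separate term. The rest is \<open>O(L * tot)\<close>, with \<open>L\<close> at most
  \<open>3 t n^(1/t)\<close> and \<open>tot\<close> at most \<open>2 * m\<close>.\<close>

lemma time_bound:
  fixes tot nv n iso K L m t :: nat
  assumes n: "1 \<le> n" "2 ^ L \<le> 2 * n" "L \<le> n" "nv + iso = n" and nv: "nv \<le> tot" and tot: "tot \<le> 2 * m"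
    and K: "K \<le> L + 2" and L: "1 \<le> L" and t: "1 \<le> t"
  shows "real (1 + (L + n + K * (60 * tot + 1) + (2 + K + n + 15 * nv * K)))
    \<le> 1500 * (real t * real m * real n powr (1 / real t) + real iso)"
proof -
  let ?z = "real n powr (1 / real t)"
  have KL: "K \<le> 3 * L" using K L by simp
  have "15 * nv * K \<le> 15 * tot * (3 * L)" "K * (60 * tot + 1) \<le> 3 * L * (60 * tot + 1)"
    using KL nv by (intro mult_mono; simp)+
  moreover have tL: "tot \<le> L * tot" using L by simp
  ultimately have "1 + (L + n + K * (60 * tot + 1) + (2 + K + n + 15 * nv * K)) \<le> 3 + 7 * L + 2 * n + 225 * (L * tot)"
    using KL by (simp add: algebra_simps)
  also have "\<dots> \<le> 12 * n + 225 * (L * tot)" using n(1,3) by simp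
  also have "\<dots> \<le> 237 * (L * tot) + 12 * iso" using n(4) nv tL by linarith
  finally have "real (1 + (L + n + K * (60 * tot + 1) + (2 + K + n + 15 * nv * K)))
      \<le> real (237 * (L * tot) + 12 * iso)" using of_nat_le_iff by blast
  also have "\<dots> = 237 * (real L * real tot) + 12 * real iso" by simp
  also have "real L * real tot \<le> 3 * real t * ?z * (2 * real m)"
  proof (rule mult_mono)
    show "real L \<le> 3 * real t * ?z" by (rule floorlog_le_powr) (use n t in simp_all)
    show "real tot \<le> 2 * real m" using tot by simp
  qed simp_all
  finally have "real (1 + (L + n + K * (60 * tot + 1) + (2 + K + n + 15 * nv * K)))
      \<le> 1422 * (real t * real m * ?z) + 12 * real iso" by (simp add: algebra_simps)
  also have "\<dots> \<le> 1500 * (real t * real m * ?z) + 1500 * real iso"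
    by (intro add_mono mult_right_mono) simp_all
  finally show ?thesis by (simp add: distrib_left)
qed

text \<open>With \<open>K\<close> at most \<open>4 * k\<close>, entries and tables take at most
  \<open>60 * (k * n)\<close> words and the header at most \<open>7 * (k * n)\<close>.\<close>

lemma length_bound:
  fixes K k n nv len :: nat
  assumes "1 \<le> n" "1 \<le> k" "K \<le> 2 * k + 2" "nv \<le> n" "len \<le> 2 + K + n + 15 * nv * K"
  shows "len \<le> 67 * (k * n)"
proof -
  have K: "K \<le> 4 * k" using assms by simp
  then have "nv * K \<le> n * (4 * k)" using assms(4) by (intro mult_mono) simp_all
  then have "15 * nv * K \<le> 60 * (k * n)" by (simp add: algebra_simps)
  moreover have "n \<le> k * n" "k \<le> k * n" "1 \<le> k * n" using assms by simp_all
  ultimately show ?thesis using assms(5) K by linarith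
qed

lemma fits_graph_input:
  assumes "graph_lists n E adj" and n: "6 + n + n * n < 2 ^ w" "1 \<le> n"
  shows "fits w (graph_input w n E adj k p t)"
proof -
  interpret graph_lists n E adj by fact
  have less: "n < 2 ^ w" "n * n < 2 ^ w" using n by simp_all
  have "offset adj i < 2 ^ w" for i
    using offset_le[of adj i] total_le_square less(2) by linarith
  moreover have "y < 2 ^ w" if x: "x \<in> set adj" and y: "y \<in> set x" for x y
  proof -
    obtain i where "i < n" "x = adj ! i" using x length_adj by (auto simp: in_set_conv_nth)
    then have "y \<in> nbrs i" using set_adj y by simp
    then show ?thesis using nbrs_less less(1) by fastforce
  qed
  moreover have "min a (2 ^ w - 1) < 2 ^ w" for a :: nat by (simp add: min_less_iff_disj)
  moreover have "card E < 2 ^ w" using simple_edges(2)[OF simple] less(2) by linarith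
  moreover have "length (concat adj) + n + 6 \<le> 2 ^ w" using total_le_square n by linarith
  ultimately show ?thesis using less unfolding fits_def graph_input_def by (auto simp: offset_def)
qed

lemma nth_skip5: "(a # b # c # d # e # xs) ! (5 + i) = xs ! i"
  by (simp add: eval_nat_numeral)

lemma graph_input_nth:
  assumes "length adj = n"
  shows "graph_input w n E adj k p t ! 0 = n" "graph_input w n E adj k p t ! 2 = min k (2 ^ w - 1)"
    "x \<le> n \<Longrightarrow> graph_input w n E adj k p t ! (5 + x) = offset adj x"
    "a < length (concat adj) \<Longrightarrow> graph_input w n E adj k p t ! (6 + n + a) = concat adj ! a"
    "length (graph_input w n E adj k p t) = 6 + n + length (concat adj)"
proof -
  let ?I = "graph_input w n E adj k p t"
  show "?I ! 0 = n" "?I ! 2 = min k (2 ^ w - 1)" "length ?I = 6 + n + length (concat adj)"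
    by (simp_all add: graph_input_def)
  have skip: "?I ! (5 + i) = (map (offset adj) [0..<Suc n] @ concat adj) ! i" for i
    unfolding graph_input_def by (simp add: nth_skip5 offset_def[abs_def] del: upt_Suc)
  show "x \<le> n \<Longrightarrow> ?I ! (5 + x) = offset adj x"
    unfolding skip by (simp add: nth_append del: upt_Suc)
  have "6 + n + a = 5 + (Suc n + a)" by simp
  then show "a < length (concat adj) \<Longrightarrow> ?I ! (6 + n + a) = concat adj ! a"
    unfolding skip by (simp only: skip) (simp add: nth_append del: upt_Suc)
qed

section \<open>The final bounds\<close>

context machine
begin

text \<open>Reads the arrays off the memory as it is found, including its uninitialised part; array
  0 begins at address 0, with the input of the construction or with the stored structure.\<close>

definition load_st :: "ram \<Rightarrow> st" where
  "load_st \<sigma> = \<lparr>vr = reg \<sigma>, ar = (\<lambda>a x. mem \<sigma> (a * W + x)), ou = out \<sigma>\<rparr>"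

text \<open>Compiled code expects the array length in register 2; a few hand-written instructions
  \<open>pre\<close> provide it.\<close>

lemma run_program:
  assumes pre: "(step w (pre @ comp (length pre) c) ^^ a) \<sigma>\<^sub>0 = \<sigma>\<^sub>1" "pc \<sigma>\<^sub>1 = length pre" "reg \<sigma>\<^sub>1 2 = W"
    and ex: "exec c (load_st \<sigma>\<^sub>1) t s'" and bd: "bounded w \<sigma>\<^sub>0"
  shows "\<exists>T \<sigma>. halts_within w (pre @ comp (length pre) c) \<sigma>\<^sub>0 T \<sigma> \<and> sim \<sigma> s' \<and>
    T \<le> a + length (comp (length pre) c) * Suc t \<and> bounded w \<sigma>"
proof -
  have "sim \<sigma>\<^sub>1 (load_st \<sigma>\<^sub>1)" using pre(3) by (simp add: sim_def load_st_def)
  from comp_correct[OF ex code_at_self pre(2) this] obtain T \<sigma> where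
    run: "(step w (pre @ comp (length pre) c) ^^ T) \<sigma>\<^sub>1 = \<sigma>" and
    fin: "pc \<sigma> = length pre + length (comp (length pre) c)" "sim \<sigma> s'" "T \<le> length (comp (length pre) c) * Suc t"
    by blast
  have all: "(step w (pre @ comp (length pre) c) ^^ (a + T)) \<sigma>\<^sub>0 = \<sigma>"
    by (rule funpow_step_trans[OF pre(1) run])
  have "bounded w \<sigma>" using bounded_steps[OF bd] all by blast
  then show ?thesis using all fin
    by (intro exI[of _ "a + T"] exI[of _ \<sigma>]) (simp add: halts_within_def)
qed

end

lemma bounded_start: "(\<And>x. x \<in> set args \<Longrightarrow> x < 2 ^ w) \<Longrightarrow> (\<And>i. M i < 2 ^ w) \<Longrightarrow> bounded w (start args M)"
  by (auto simp: bounded_def start_def)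

section \<open>Set-up instructions and the two complete programs\<close>

text \<open>Register 2 is 0 at the start, so the load fetches \<open>n\<close> from address 0;
  adding 1 and squaring three times gives \<open>(n + 1) ^ 8\<close>.\<close>

definition construct_pre :: "instr list" where
  "construct_pre = [Const 3 1, Load 2 2, Oper Add 2 2 3, Oper Mul 2 2 2, Oper Mul 2 2 2, Oper Mul 2 2 2]"

definition construct_prog :: "instr list" where
  "construct_prog = construct_pre @ comp (length construct_pre) construct_com"

text \<open>The arguments occupy registers 0 and 1, so register 3 is 0 and word 0 of the structure
  is read: its own length, which becomes the array length.\<close>

definition query_pre :: "instr list" where
  "query_pre = [Load 2 3]"

definition query_prog :: "instr list" where
  "query_prog = query_pre @ comp (length query_pre) query_com"

lemma construct_pre_run:
  assumes M: "M 0 = n" and W: "(n + 1) ^ 8 < 2 ^ w"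
  shows "(step w (construct_pre @ xs) ^^ 6) (start [] M) =
    \<lparr>pc = 6, reg = (\<lambda>_. 0)(3 := 1, 2 := (n + 1) ^ 8), mem = M, out = []\<rparr>"
proof -
  define a where "a = n + 1"
  define a2 where "a2 = a * a"
  define a4 where "a4 = a2 * a2"
  define a8 where "a8 = a4 * a4"
  have "((a ^ 2) ^ 2) ^ 2 = a ^ 8" by (simp flip: power_mult)
  then have a8_eq: "a8 = (n + 1) ^ 8"
    unfolding a8_def a4_def a2_def a_def by (simp only: power2_eq_square)
  have "1 \<le> a" "1 \<le> a2" "1 \<le> a4" by (simp_all add: a_def a2_def a4_def)
  then have "a \<le> a2" "a2 \<le> a4" "a4 \<le> a8" by (simp_all add: a2_def a4_def a8_def)
  then have less: "a < 2 ^ w" "a2 < 2 ^ w" "a4 < 2 ^ w" "a8 < 2 ^ w" "1 < (2 :: nat) ^ w" "Suc n < 2 ^ w"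
    using W a8_eq \<open>1 \<le> a\<close> \<open>1 \<le> a2\<close> \<open>1 \<le> a4\<close> by (simp_all add: a_def)
  let ?s = "\<lambda>p x. \<lparr>pc = p, reg = (\<lambda>_. 0)(3 := 1, 2 := x), mem = M, out = []\<rparr>"
  let ?f = "step w (construct_pre @ xs)"
  have sq: "Suc n = a" "a * a = a2" "a2 * a2 = a4" "a4 * a4 = a8" by (simp_all add: a_def a2_def a4_def a8_def)
  have "?f (start [] M) = \<lparr>pc = 1, reg = (\<lambda>_. 0)(3 := 1), mem = M, out = []\<rparr>"
    using less(5) by (cases w) (simp_all add: step_def construct_pre_def start_def)
  moreover have "?f \<lparr>pc = 1, reg = (\<lambda>_. 0)(3 := 1), mem = M, out = []\<rparr> = ?s 2 n"
    by (simp add: step_def construct_pre_def M)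
  moreover have "?f (?s 2 n) = ?s 3 a" using less(1) by (simp add: step_def construct_pre_def sq)
  moreover have "?f (?s 3 a) = ?s 4 a2" using less(2) by (simp add: step_def construct_pre_def sq)
  moreover have "?f (?s 4 a2) = ?s 5 a4" using less(3) by (simp add: step_def construct_pre_def sq)
  moreover have "?f (?s 5 a4) = ?s 6 a8" using less(4) by (simp add: step_def construct_pre_def sq)
  moreover have "(?f ^^ 6) (start [] M) = ?f (?f (?f (?f (?f (?f (start [] M))))))"
    by (simp add: numeral_eq_Suc)
  ultimately show ?thesis unfolding a8_eq by simp
qed

lemma graph_dist_le: "is_path E u P v \<Longrightarrow> graph_dist E u v \<le> path_length P"
  unfolding graph_dist_def by (rule Least_le) blast

context stored_oracle
begin

text \<open>The structure stays intact by the frame property: \<open>query_com\<close> does not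
  write to array 0, which is the memory below \<open>W\<close>.\<close>

lemma query_run:
  assumes uv: "u < n" "v < n" and M: "holds w (map D [0..<W]) M" and D0: "D 0 = W"
  shows "\<exists>T s. halts_within w query_prog (start [u, v] M) T s \<and> holds w (map D [0..<W]) (mem s) \<and>
    T \<le> 1 + length (comp (length query_pre) query_com) * Suc (3 * path_length (out s)) \<and>
    (if \<exists>P. is_path E u P v
     then is_path E u (out s) v \<and> path_length (out s) \<le> 2 ^ b * (2 * B) * graph_dist E u v
     else out s = [])"
proof -
  have W0: "0 < W" "n < W" using header K_pos by simp_all
  have M': "M x = D x" if "x < W" for x using M that by (simp add: holds_def)
  let ?\<sigma> = "(start [u, v] M)\<lparr>pc := 1, reg := (reg (start [u, v] M))(2 := W)\<rparr>"
  have pre: "(step w (query_pre @ comp (length query_pre) query_com) ^^ 1) (start [u, v] M) = ?\<sigma>"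
    using M'[OF W0(1)] D0 by (simp add: step_def query_pre_def start_def)
  have "\<exists>t s'. exec query_com (load_st ?\<sigma>) t s' \<and> t \<le> 3 * path_length (ou s') \<and>
    (if \<exists>P. is_path E u P v
     then is_path E u (ou s') v \<and> path_length (ou s') \<le> 2 ^ b * (2 * B) * graph_dist E u v
     else ou s' = [])"
    by (rule query_exec[OF uv]) (use M' in \<open>simp_all add: load_st_def start_def\<close>)
  then obtain t s' where ex: "exec query_com (load_st ?\<sigma>) t s'" and t: "t \<le> 3 * path_length (ou s')"
    and res: "if \<exists>P. is_path E u P v
     then is_path E u (ou s') v \<and> path_length (ou s') \<le> 2 ^ b * (2 * B) * graph_dist E u v
     else ou s' = []" by (elim exE conjE)
  have bd: "bounded w (start [u, v] M)"
  proof (rule bounded_start)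
    have "n < 2 ^ w" using W0(2) space by simp
    then show "x < 2 ^ w" if "x \<in> set [u, v]" for x using that uv by auto
    show "M i < 2 ^ w" for i using M by (simp add: holds_def)
  qed
  have "\<exists>T \<sigma>. halts_within w (query_pre @ comp (length query_pre) query_com) (start [u, v] M) T \<sigma> \<and> sim \<sigma> s' \<and>
    T \<le> 1 + length (comp (length query_pre) query_com) * Suc t \<and> bounded w \<sigma>"
    by (rule run_program[OF pre _ _ ex bd]) (simp_all add: query_pre_def)
  then obtain T \<sigma> where run: "halts_within w query_prog (start [u, v] M) T \<sigma>" and sm: "sim \<sigma> s'"
    and T: "T \<le> 1 + length (comp (length query_pre) query_com) * Suc t" and bs: "bounded w \<sigma>"
    unfolding query_prog_def by (elim exE conjE)
  have ou: "out \<sigma> = ou s'" using sm by (simp add: sim_def)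
  have "0 \<notin> written query_com" by (simp add: query_com_def test_com_def climb_com_def)
  then have fr: "ar s' 0 = ar (load_st ?\<sigma>) 0" using exec_frame[OF ex] by (simp add: frame_def)
  have mem: "mem \<sigma> x = D x" if x: "x < W" for x
  proof -
    have "\<forall>a<16. \<forall>x<W. mem \<sigma> (a * W + x) = ar s' a x" using sm by (simp add: sim_def)
    from this[rule_format, of 0 x] x have "mem \<sigma> x = ar s' 0 x" by simp
    then show ?thesis using fr M'[OF x] by (simp add: load_st_def start_def)
  qed
  have "length (comp (length query_pre) query_com) * Suc t \<le>
      length (comp (length query_pre) query_com) * Suc (3 * path_length (out \<sigma>))"
    using t unfolding ou by (intro mult_le_mono) simp_all
  then have "T \<le> 1 + length (comp (length query_pre) query_com) * Suc (3 * path_length (out \<sigma>))"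
    using T by linarith
  moreover have "holds w (map D [0..<W]) (mem \<sigma>)" using mem bs by (simp add: holds_def bounded_def)
  ultimately show ?thesis using run res[folded ou] by (intro exI conjI)
qed

text \<open>For code length \<open>l\<close> and a path of length \<open>d\<close>, the time
  \<open>1 + l * (1 + 3 * d)\<close> is at most \<open>(1 + 3 * l) * (1 + d)\<close>, which is where
  the lower bound on \<open>C\<close> comes from.\<close>

lemma is_path_reporting:
  assumes D0: "D 0 = W" and less: "\<And>x. x < W \<Longrightarrow> D x < 2 ^ w"
    and \<alpha>: "1 \<le> \<alpha>" "real (2 ^ b * (2 * B)) \<le> \<alpha>"
    and C: "1 + 3 * real (length (comp (length query_pre) query_com)) \<le> C"
  shows "path_reporting_oracle w n E \<alpha> 0 C query_prog (map D [0..<W])"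
  unfolding path_reporting_oracle_def
proof (intro conjI allI impI)
  show "fits w (map D [0..<W])" using less space by (auto simp: fits_def)
  fix u v M assume uv: "u < n" "v < n" and M: "holds w (map D [0..<W]) M"
  let ?l = "length (comp (length query_pre) query_com)"
  from query_run[OF uv M D0] obtain T s where run: "halts_within w query_prog (start [u, v] M) T s"
      "holds w (map D [0..<W]) (mem s)" and T: "T \<le> 1 + ?l * Suc (3 * path_length (out s))"
    and res: "if \<exists>P. is_path E u P v
     then is_path E u (out s) v \<and> path_length (out s) \<le> 2 ^ b * (2 * B) * graph_dist E u v
     else out s = []" by (elim exE conjE)
  have "real T \<le> real (1 + ?l * Suc (3 * path_length (out s)))" using T of_nat_le_iff by blast
  also have "\<dots> \<le> (1 + 3 * real ?l) * (1 + real (path_length (out s)))" by (simp add: algebra_simps)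
  also have "\<dots> \<le> C * (1 + real (path_length (out s)))" using C by (rule mult_right_mono) simp
  finally have time: "real T \<le> C * (1 + real (path_length (out s)))" .
  have "if \<exists>P. is_path E u P v
    then is_path E u (out s) v \<and> graph_dist E u v \<le> path_length (out s) \<and>
      real (path_length (out s)) \<le> \<alpha> * real (graph_dist E u v) + 0
    else out s = []"
  proof (cases "\<exists>P. is_path E u P v")
    case True
    then have p: "is_path E u (out s) v" "path_length (out s) \<le> 2 ^ b * (2 * B) * graph_dist E u v"
      using res by simp_all
    have "real (path_length (out s)) \<le> real (2 ^ b * (2 * B) * graph_dist E u v)"
      using p(2) of_nat_le_iff by blast
    also have "\<dots> = real (2 ^ b * (2 * B)) * real (graph_dist E u v)" by (rule of_nat_mult)
    also have "\<dots> \<le> \<alpha> * real (graph_dist E u v)" using \<alpha>(2) by (rule mult_right_mono) simp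
    finally show ?thesis unfolding if_P[OF True] using p(1) graph_dist_le[OF p(1)] by simp
  qed (use res in simp)
  then show "\<exists>T s. halts_within w query_prog (start [u, v] M) T s \<and> holds w (map D [0..<W]) (mem s) \<and>
      real T \<le> C * (1 + real (path_length (out s))) \<and>
      (if \<exists>P. is_path E u P v
       then is_path E u (out s) v \<and> graph_dist E u v \<le> path_length (out s) \<and>
         real (path_length (out s)) \<le> \<alpha> * real (graph_dist E u v) + 0
       else out s = [])"
    using run time by (intro exI conjI)
qed (use \<alpha> in simp_all)

end

section \<open>Assembling construction and query\<close>

context graph_lists
begin

definition weight :: "nat \<Rightarrow> nat" where
  "weight x = offset adj (Suc x) - offset adj x + length (concat adj) div card verts"

sublocale weighted_graph verts nbrs weight
proof
  show "nbrs x \<subseteq> verts" for x by (rule nbrs_sub)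
  show "y \<in> nbrs x \<Longrightarrow> x \<in> nbrs y" for x y by (simp add: insert_commute)
qed (rule finite_verts)

lemma construction:
  assumes "16 * W \<le> 2 ^ w" "64 * (n + 1)\<^sup>2 \<le> W" "1 \<le> n"
  shows "construction w W verts nbrs weight n (length (concat adj)) (card verts)
    (length (concat adj) div card verts) (offset adj) ((!) (concat adj))"
proof (intro construction.intro machine.intro construction_axioms.intro weighted_graph_axioms assms(1,2))
  let ?tot = "length (concat adj)" and ?nv = "card verts"
  show "verts = {x. x < n \<and> offset adj x < offset adj (Suc x)}" by (rule verts_def)
  show "offset adj x \<le> offset adj (Suc x)" for x by (rule offset_mono)
  show "offset adj x \<le> ?tot" for x by (rule offset_le)
  show "nbrs x = (!) (concat adj) ` {offset adj x..<offset adj (Suc x)}" if "x \<in> verts" for x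
  proof -
    have "x < n" using that verts_less by blast
    then show ?thesis using concat_nth_image[of x adj] set_adj[of x] length_adj by simp
  qed
  show "weight x = offset adj (Suc x) - offset adj x + ?tot div ?nv" for x by (rule weight_def)
  show "0 < ?nv \<Longrightarrow> 0 < ?tot div ?nv" using verts_le_total by (simp only: div_greater_zero_iff)
  show nvD: "?nv * (?tot div ?nv) \<le> ?tot" by simp
  show "?tot \<le> 2 * (?nv * (?tot div ?nv))"
  proof (cases "?nv = 0")
    case True
    then have "verts = {}" using finite_verts by simp
    then show ?thesis using length_concat_verts by simp
  next
    case False
    \<comment> \<open>The average is at least 1, because no vertex of \<open>verts\<close> is
      isolated; so the remainder of the division is below \<open>?nv * (?tot div ?nv)\<close>, and
      rounding loses at most half.\<close>
    then have "?nv * 1 \<le> ?nv * (?tot div ?nv)"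
      using verts_le_total by (intro mult_le_mono2) (simp add: Suc_le_eq div_greater_zero_iff)
    moreover have "?tot mod ?nv < ?nv" using False by simp
    moreover have "?tot = ?nv * (?tot div ?nv) + ?tot mod ?nv" by simp
    ultimately show ?thesis by linarith
  qed
  have "weight x = length (adj ! x) + ?tot div ?nv" if "x \<in> verts" for x
    using that verts_less offset_Suc[of x adj] length_adj by (auto simp: weight_def)
  then have "sum weight verts = (\<Sum>x\<in>verts. length (adj ! x) + ?tot div ?nv)" by (intro sum.cong) simp_all
  also have "\<dots> = ?tot + ?nv * (?tot div ?nv)" by (simp only: sum.distrib length_concat_verts sum_constant of_nat_id)
  finally show "sum weight verts \<le> ?tot + ?nv * (?tot div ?nv)" by simp
  show "?tot \<le> n * n" by (rule total_le_square)
qed (use assms(3) in simp_all)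

lemma construct_run:
  assumes n: "1 \<le> n" and k: "1 \<le> k" and L: "L = floorlog 2 n" and w: "w = 12 * L"
    and b: "b = L div k div 2 + 1" and K: "K = L div b + 2" and M: "holds w (graph_input w n E adj k p t) M"
  shows "\<exists>T \<sigma> Dm len. halts_within w construct_prog (start [] M) T \<sigma> \<and>
    T \<le> 6 + length (comp (length construct_pre) construct_com) *
      Suc (L + n + K * (60 * length (concat adj) + 1) + (2 + K + n + 15 * card verts * K)) \<and>
    bounded w \<sigma> \<and> out \<sigma> = map Dm [0..<len] \<and> Dm 0 = len \<and> Dm 1 = K \<and> 2 + K + n \<le> len \<and>
    len \<le> 2 + K + n + 15 * card verts * K \<and> 16 * len \<le> 2 ^ w \<and> (\<forall>x<n. 0 < Dm (2 + K + x) \<longleftrightarrow> x \<in> verts) \<and>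
    (\<forall>i<K. \<exists>S H dp pr rt. encodes len verts K Dm i S H dp pr rt \<and>
       scale_ok (2 ^ (b * i)) ((4 * (2 * L + 4) + 2) * 2 ^ (b * i)) S H dp pr rt)"
proof -
  let ?tot = "length (concat adj)"
  define W where "W = (n + 1) ^ 8"
  define I where "I = graph_input w n E adj k p t"
  define kk where "kk = min k (2 ^ w - 1)"
  note fl = floorlog_facts[OF n L] and sc = scale_count[OF k b K]
  have W: "16 * W \<le> 2 ^ w" "64 * (n + 1)\<^sup>2 \<le> W"
    unfolding W_def w by (rule word_sizes[OF n fl(1,2)])+
  have big: "64 * (n + 1) \<le> W"
  proof -
    have "64 * (n + 1) \<le> 64 * (n + 1)\<^sup>2" by (simp add: power2_eq_square)
    then show ?thesis using W(2) by linarith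
  qed
  interpret C: construction w W verts nbrs weight n ?tot "card verts" "?tot div card verts" "offset adj" "(!) (concat adj)"
    by (rule construction[OF W n])
  have nv: "card verts \<le> n" using card_verts_isolated by simp
  have room: "8 + K + n + 15 * card verts * K < W"
    by (rule space_fits[OF W(2) nv]) (use sc(2) fl(4) in linarith)
  have lenI: "I ! 0 = n" "I ! 2 = kk" "length I = 6 + n + ?tot"
    using graph_input_nth(1,2,5)[OF length_adj] unfolding I_def kk_def by blast+
  have MI: "M i = I ! i" if "i < length I" for i using M that unfolding I_def[symmetric] by (simp add: holds_def)
  let ?\<sigma> = "\<lparr>pc = 6, reg = (\<lambda>_. 0)(3 := 1, 2 := W), mem = M, out = []\<rparr>"
  have "0 < W" using big by simp
  then have "W < 2 ^ w" using W(1) by simp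
  with lenI MI[of 0] have pre: "(step w (construct_pre @ comp (length construct_pre) construct_com) ^^ 6) (start [] M) = ?\<sigma>"
    using construct_pre_run[of M n w] unfolding W_def by simp
  let ?s = "C.load_st ?\<sigma>"
  have ar: "ar ?s 0 x = M x" for x by (simp add: C.load_st_def)
  have s1: "ar ?s 0 0 = n" using MI[of 0] lenI ar by simp
  have s2: "ar ?s 0 2 = kk" using MI[of 2] lenI ar by simp
  have s3: "ar ?s 0 (5 + x) = offset adj x" if "x \<le> n" for x
    using MI[of "5 + x"] lenI(3) graph_input_nth(3)[OF length_adj that, of w E k p t, folded I_def] that unfolding ar by simp
  have s4: "ar ?s 0 (6 + n + a) = concat adj ! a" if "a < ?tot" for a
    using MI[of "6 + n + a"] lenI(3) graph_input_nth(4)[OF length_adj that, of w E k p t, folded I_def] that unfolding ar by simp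
  have s5: "ou ?s = []" by (simp add: C.load_st_def)
  have off: "offset adj n = ?tot" using offset_total[of adj] length_adj by simp
  have "L + 2 < W" using fl(4) big by simp
  then have L2: "L + 2 < 2 ^ w" using \<open>W < 2 ^ w\<close> by (rule less_trans)
  \<comment> \<open>The program sees the capped parameter, which leads to the same
    \<open>b\<close>.\<close>
  have kk: "b = L div kk div 2 + 1"
    unfolding kk_def using b div_min_large[of L "2 ^ w - 1" k] L2 k by simp
  have pow: "2 ^ e < (2 :: nat) ^ w" if "e \<le> 3 * L + 2" for e
    using that fl(1) unfolding w by (intro power_strict_increasing) simp_all
  have bw: "2 ^ b < (2 :: nat) ^ w" "2 ^ (b * K) < (2 :: nat) ^ w"
    using pow sc(1,6) by simp_all
  have Gb: "g \<le> 2 * L + 4" if "3 ^ g \<le> 2 ^ g * (3 * n)" for g by (rule growth_rounds[OF fl(2) that])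
  have rad: "4 * 2 ^ (b * i) * (2 * L + 4 + 3) < 2 ^ w" if "i < K" for i
  proof -
    have "b * i \<le> b * (K - 1)" using that by (intro mult_le_mono2) simp
    then show ?thesis unfolding w by (intro radius_fits[OF fl(1)]) (use sc(5) in linarith)
  qed
  define Tm where "Tm = L + n + K * (60 * ?tot + 1) + (2 + K + n + 15 * card verts * K)"
  note wp = C.construct_wp[OF s1 s2 s3 s4 s5 off refl L kk K L2 bw(1) Gb rad refl bw(2) room Tm_def]
  have "\<exists>tt s'. C.exec construct_com ?s tt s' \<and> tt \<le> Tm \<and> (\<exists>Dm len. ou s' = map Dm [0..<len] \<and>
      Dm 0 = len \<and> Dm 1 = K \<and> 2 + K + n \<le> len \<and> len \<le> 2 + K + n + 15 * card verts * K \<and>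
      (\<forall>x<n. 0 < Dm (2 + K + x) \<longleftrightarrow> x \<in> verts) \<and>
      (\<forall>i<K. \<exists>S H dp pr rt. encodes len verts K Dm i S H dp pr rt \<and>
         scale_ok (2 ^ (b * i)) ((4 * (2 * L + 4) + 2) * 2 ^ (b * i)) S H dp pr rt))"
    by (rule wp[unfolded C.wp_def])
  then obtain tt s' Dm len where ex: "C.exec construct_com ?s tt s'" and tt: "tt \<le> Tm"
    and o: "ou s' = map Dm [0..<len]" and D: "Dm 0 = len" "Dm 1 = K" "2 + K + n \<le> len"
      "len \<le> 2 + K + n + 15 * card verts * K" "\<forall>x<n. 0 < Dm (2 + K + x) \<longleftrightarrow> x \<in> verts"
      "\<forall>i<K. \<exists>S H dp pr rt. encodes len verts K Dm i S H dp pr rt \<and>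
       scale_ok (2 ^ (b * i)) ((4 * (2 * L + 4) + 2) * 2 ^ (b * i)) S H dp pr rt"
    by (elim exE conjE)
  have bd: "bounded w (start [] M)" by (rule bounded_start) (use M in \<open>simp_all add: holds_def\<close>)
  have "\<exists>T \<sigma>. halts_within w (construct_pre @ comp (length construct_pre) construct_com) (start [] M) T \<sigma> \<and> C.sim \<sigma> s' \<and>
    T \<le> 6 + length (comp (length construct_pre) construct_com) * Suc tt \<and> bounded w \<sigma>"
    by (rule C.run_program[OF pre _ _ ex bd]) (simp_all add: construct_pre_def)
  then obtain T \<sigma> where run: "halts_within w construct_prog (start [] M) T \<sigma>" and sm: "C.sim \<sigma> s'"
    and T: "T \<le> 6 + length (comp (length construct_pre) construct_com) * Suc tt" and bs: "bounded w \<sigma>"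
    unfolding construct_prog_def by (elim exE conjE)
  have "length (comp (length construct_pre) construct_com) * Suc tt \<le>
    length (comp (length construct_pre) construct_com) * Suc Tm" using tt by (intro mult_le_mono) simp_all
  then have T': "T \<le> 6 + length (comp (length construct_pre) construct_com) * Suc Tm" using T by linarith
  have ou: "out \<sigma> = map Dm [0..<len]" using sm o by (simp add: C.sim_def)
  have "len \<le> W" using D(4) room by linarith
  then have len: "16 * len \<le> 2 ^ w" using W(1) by simp
  show ?thesis by (intro exI conjI) (rule run T'[unfolded Tm_def] bs ou D len)+
qed

text \<open>The witnesses are \<open>1248 k n^(1/k)\<close> for \<open>\<alpha>\<close> and 0 for
  \<open>\<beta>\<close>, and the structure has at most \<open>67 * k * n\<close> words. These meet
  the stated bounds since \<open>t\<close> is at least 1 and the remaining terms are nonnegative.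
  \<open>C\<close> is the sum of what the construction time and the query time ask for, and its
  first summand exceeds the numerical constants.\<close>

lemma main_bounds:
  fixes k p t :: nat and C :: real
  assumes n: "1 \<le> n" and k: "1 \<le> k" and p: "1 \<le> p" and t: "1 \<le> t" and w: "w = 12 * floorlog 2 n"
    and M: "holds w (graph_input w n E adj k p t) M"
    and C: "C = 1500 * (6 + real (length (comp (length construct_pre) construct_com))) +
      (1 + 3 * real (length (comp (length query_pre) query_com)))"
  shows "\<exists>T s \<alpha> \<beta>. halts_within w construct_prog (start [] M) T s \<and>
    real T \<le> C * (real t * real (card E) * real n powr (1 / real t) + real (card (isolated n E))) \<and>
    real (length (out s)) \<le> C * (real k * real n + real t * real n powr (1 + 1 / real t) / real p) \<and>
    \<alpha> \<le> C * (real t * (real k * real n powr (1 / real k))) \<and>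
    \<beta> \<le> C * (real p * (real k * real n powr (1 / real k))) \<and>
    path_reporting_oracle w n E \<alpha> \<beta> C query_prog (out s)"
proof -
  define L b K where "L = floorlog 2 n" and "b = L div k div 2 + 1" and "K = L div b + 2"
  let ?B = "4 * (2 * L + 4) + 2" and ?lc = "length (comp (length construct_pre) construct_com)"
  have wL: "w = 12 * L" using w L_def by simp
  note fl = floorlog_facts[OF n L_def] and sc = scale_count[OF k b_def K_def]
  from construct_run[OF n k L_def wL b_def K_def M] obtain T \<sigma> D len where
    run: "halts_within w construct_prog (start [] M) T \<sigma>" and
    T: "T \<le> 6 + ?lc * Suc (L + n + K * (60 * length (concat adj) + 1) + (2 + K + n + 15 * card verts * K))" and
    bs: "bounded w \<sigma>" and ou: "out \<sigma> = map D [0..<len]" and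
    D: "D 0 = len" "D 1 = K" "2 + K + n \<le> len" "len \<le> 2 + K + n + 15 * card verts * K" "16 * len \<le> 2 ^ w"
      "\<forall>x<n. 0 < D (2 + K + x) \<longleftrightarrow> x \<in> verts" and
    sc': "\<forall>i<K. \<exists>S H dp pr rt. encodes len verts K D i S H dp pr rt \<and>
       scale_ok (2 ^ (b * i)) (?B * 2 ^ (b * i)) S H dp pr rt"
    by (elim exE conjE)
  \<comment> \<open>The premise \<open>i < K\<close> is moved into \<open>R\<close>, so that the
    five functions can be chosen over all \<open>i\<close>.\<close>
  define R where "R = (\<lambda>i S H dp pr rt. i < K \<longrightarrow> encodes len verts K D i S H dp pr rt \<and>
       scale_ok (2 ^ (b * i)) (?B * 2 ^ (b * i)) S H dp pr rt)"
  have "\<forall>i. \<exists>S H dp pr rt. R i S H dp pr rt" using sc' unfolding R_def by blast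
  from choice[OF this] obtain S where "\<forall>i. \<exists>H dp pr rt. R i (S i) H dp pr rt" by (rule exE)
  from choice[OF this] obtain H where "\<forall>i. \<exists>dp pr rt. R i (S i) (H i) dp pr rt" by (rule exE)
  from choice[OF this] obtain dp where "\<forall>i. \<exists>pr rt. R i (S i) (H i) (dp i) pr rt" by (rule exE)
  from choice[OF this] obtain pr where "\<forall>i. \<exists>rt. R i (S i) (H i) (dp i) (pr i) rt" by (rule exE)
  from choice[OF this] obtain rt where R: "\<forall>i. R i (S i) (H i) (dp i) (pr i) (rt i)" by (rule exE)
  have so: "stored_oracle w len verts nbrs n K b ?B E D S H dp pr rt"
  proof (intro stored_oracle.intro machine.intro stored_oracle_axioms.intro weighted_graph_axioms)
    show "x \<in> verts" if "{x, y} \<in> E" for x y using that verts_nonempty by blast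
    show "encodes len verts K D i (S i) (H i) (dp i) (pr i) (rt i)"
      "scale_ok (2 ^ (b * i)) (?B * 2 ^ (b * i)) (S i) (H i) (dp i) (pr i) (rt i)" if "i < K" for i
      using R that unfolding R_def by blast+
    have "n < 2 ^ L" by (rule fl(2))
    also have "\<dots> \<le> 2 ^ (b * (K - 1))" using sc(4) by (intro power_increasing) simp_all
    finally show "n \<le> 2 ^ (b * (K - 1))" by simp
    show "0 < b" "0 < K" by (simp_all add: b_def K_def)
    show "0 < D (2 + K + x) \<longleftrightarrow> x \<in> verts" if "x < n" for x using D(6) that by blast
  qed (use D(2,3,5) verts_less in simp_all)
  interpret Q: stored_oracle w len verts nbrs weight n K b ?B E D S H dp pr rt by (rule so)
  let ?\<alpha> = "1248 * (real k * real n powr (1 / real k))"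
  have X: "1 \<le> real k * real n powr (1 / real k)"
  proof -
    have "1 * 1 \<le> real k * real n powr (1 / real k)"
      by (intro mult_mono) (use k floorlog_le_powr(2)[OF n fl(3), of "real k"] in simp_all)
    then show ?thesis by simp
  qed
  have "1500 * 6 \<le> 1500 * (6 + real ?lc)" by simp
  then have C9: "9000 \<le> C" "1500 * (6 + real ?lc) \<le> C"
    "1 + 3 * real (length (comp (length query_pre) query_com)) \<le> C" unfolding C by simp_all
  have "D x < 2 ^ w" if "x < len" for x
    using bs that unfolding bounded_def ou by simp
  moreover have "real (2 ^ b * (2 * ?B)) \<le> ?\<alpha>" by (rule stretch_bound[OF n fl(3,1) k b_def])
  ultimately have orc: "path_reporting_oracle w n E ?\<alpha> 0 C query_prog (out \<sigma>)"
    unfolding ou by (intro Q.is_path_reporting[OF D(1)] C9(3)) (use X in simp_all)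
  have "1248 * 1 \<le> C * real t" using C9(1) t by (intro mult_mono) simp_all
  then have "1248 * (real k * real n powr (1 / real k)) \<le> C * real t * (real k * real n powr (1 / real k))"
    by (intro mult_right_mono) (use X in simp_all)
  then have a: "?\<alpha> \<le> C * (real t * (real k * real n powr (1 / real k)))" by (simp only: mult.assoc)
  have be: "0 \<le> C * (real p * (real k * real n powr (1 / real k)))"
    using C9(1) by (intro mult_nonneg_nonneg) simp_all
  let ?S = "real t * real (card E) * real n powr (1 / real t) + real (card (isolated n E))"
  let ?T = "L + n + K * (60 * length (concat adj) + 1) + (2 + K + n + 15 * card verts * K)"
  have "real T \<le> real (6 + ?lc * Suc ?T)" using T of_nat_le_iff by blast
  also have "\<dots> = 6 + real ?lc * real (1 + ?T)"
    by (simp only: of_nat_add of_nat_mult Suc_eq_plus1_left of_nat_numeral of_nat_1)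
  also have "\<dots> \<le> 6 * real (1 + ?T) + real ?lc * real (1 + ?T)" by (intro add_right_mono) simp
  also have "\<dots> = (6 + real ?lc) * real (1 + ?T)" by (simp only: distrib_right)
  also have "\<dots> \<le> (6 + real ?lc) * (1500 * ?S)"
    by (intro mult_left_mono time_bound[OF n fl(3,4) card_verts_isolated verts_le_total total_le_edges sc(2) fl(1) t]) simp
  also have "\<dots> = (1500 * (6 + real ?lc)) * ?S" by (simp only: mult.assoc mult.left_commute mult.commute)
  also have "\<dots> \<le> C * ?S" by (intro mult_right_mono C9(2)) simp
  finally have time: "real T \<le> C * ?S" .
  have "card verts \<le> n" using card_verts_isolated by linarith
  then have "len \<le> 67 * (k * n)" by (rule length_bound[OF n k sc(3) _ D(4)])
  then have "real len \<le> real (67 * (k * n))" using of_nat_le_iff by blast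
  then have "real len \<le> 67 * (real k * real n)" by simp
  also have "\<dots> \<le> C * (real k * real n + real t * real n powr (1 + 1 / real t) / real p)"
  proof (rule mult_mono)
    have "0 \<le> real t * real n powr (1 + 1 / real t) / real p" by (intro divide_nonneg_nonneg mult_nonneg_nonneg) simp_all
    then show "real k * real n \<le> real k * real n + real t * real n powr (1 + 1 / real t) / real p" by linarith
  qed (use C9(1) in simp_all)
  finally have space: "real (length (out \<sigma>)) \<le> C * (real k * real n + real t * real n powr (1 + 1 / real t) / real p)"
    unfolding ou by simp
  show ?thesis by (intro exI conjI) (rule run time space a be orc)+
qed

end

(* Words have w = c * floorlog 2 n bits, floorlog 2 n being the length of n in binary. The
   constants and both programs are independent of the graph and of k, p, t. The summand
   card (isolated n E), the part of the input not bounded by m, vanishes for every connected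
   graph with at least two vertices. *)
theorem theorem3:
  shows "\<exists>(c::nat) (C::real) (construct::instr list) (query::instr list). c > 0 \<and> C > 0 \<and>
    (\<forall>(n::nat) (E::nat set set) (k::nat) (p::nat) (t::nat) (adj::nat list list).
       n \<ge> 1 \<and> simple_graph n E \<and> k \<ge> 1 \<and> p \<ge> 1 \<and> t \<ge> 1 \<and> adj_lists n E adj \<longrightarrow>
       (let w = c * floorlog 2 n; m = card E; I = graph_input w n E adj k p t in
        fits w I \<and>
        (\<forall>M. holds w I M \<longrightarrow>
          (\<exists>T s \<alpha> \<beta>.
             halts_within w construct (start [] M) T s \<and>
             real T \<le> C * (real t * real m * real n powr (1 / real t) + real (card (isolated n E))) \<and>
             real (length (out s)) \<le>
               C * (real k * real n + real t * real n powr (1 + 1 / real t) / real p) \<and>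
             \<alpha> \<le> C * (real t * (real k * real n powr (1 / real k))) \<and>
             \<beta> \<le> C * (real p * (real k * real n powr (1 / real k))) \<and>
             path_reporting_oracle w n E \<alpha> \<beta> C query (out s)))))"
proof -
  define C where "C = 1500 * (6 + real (length (comp (length construct_pre) construct_com))) +
    (1 + 3 * real (length (comp (length query_pre) query_com)))"
  have C0: "0 < C" unfolding C_def by (simp add: add_pos_nonneg)
  show ?thesis
    unfolding Let_def
  proof (rule exI[of _ "12 :: nat"], rule exI[of _ C], rule exI[of _ construct_prog], rule exI[of _ query_prog],
      intro conjI allI impI)
    fix n :: nat and E :: "nat set set" and k p t :: nat and adj :: "nat list list"
    assume a: "n \<ge> 1 \<and> simple_graph n E \<and> k \<ge> 1 \<and> p \<ge> 1 \<and> t \<ge> 1 \<and> adj_lists n E adj"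
    then have n: "1 \<le> n" and k: "1 \<le> k" "1 \<le> p" "1 \<le> t" by blast+
    interpret graph_lists n E adj by unfold_locales (use a in blast)+
    let ?w = "12 * floorlog 2 n"
    note ws = word_sizes[OF n floorlog_facts(1,2)[OF n refl]]
    have "64 * (n + 1)\<^sup>2 = 64 * (n * n) + 128 * n + 64" by (simp add: power2_eq_square algebra_simps)
    then have "6 + n + n * n < 2 ^ ?w" using ws by linarith
    then show "fits ?w (graph_input ?w n E adj k p t)"
      by (rule fits_graph_input[OF graph_lists_axioms _ n])
    show "\<exists>T s \<alpha> \<beta>. halts_within ?w construct_prog (start [] M) T s \<and>
        real T \<le> C * (real t * real (card E) * real n powr (1 / real t) + real (card (isolated n E))) \<and>
        real (length (out s)) \<le> C * (real k * real n + real t * real n powr (1 + 1 / real t) / real p) \<and>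
        \<alpha> \<le> C * (real t * (real k * real n powr (1 / real k))) \<and>
        \<beta> \<le> C * (real p * (real k * real n powr (1 / real k))) \<and>
        path_reporting_oracle ?w n E \<alpha> \<beta> C query_prog (out s)"
      if "holds ?w (graph_input ?w n E adj k p t) M" for M
      by (rule main_bounds[OF n k refl that C_def])
  qed (use C0 in simp_all)
qed

end
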